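(* Let $\mathcal{T}\in\mathbb{R}^{n_1\times\dots\times n_d}$, let $\mathcal{I}=\{I_{\ell,k}\}$ ($0\le \ell\le L$, $1\le k\le K_\ell$) be an index tree on $D=\{1,\dots,d\}$, let $\mathcal{R}=(r_{\ell,k})$ be TTN ranks (positive integers) and $\mathcal{P}=(p_{\ell,k})$ (integer) oversampling parameters. For every non-root node let $X_{\ell,k}\in\mathbb{R}^{n_{D\setminus I_{\ell,k}}\times r_{\ell,k}}$ and $Y_{\ell,k}\in\mathbb{R}^{n_{I_{\ell,k}}\times(r_{\ell,k}+p_{\ell,k})}$ be independent standard Gaussian random matrices (i.i.d. $N(0,1)$ entries, all matrices mutually independent), and let $\widehat{\mathcal{T}}$ be the resulting TTNN approximant of $\mathcal{T}$. Then for any TTN ranks $\hat{\mathcal{R}}=(\hat r_{\ell,k})$ such that $\hat r_{\ell,k}<r_{\ell,k}-1$ for all non-root nodes, $$\mathbb{E}\|\mathcal{T}-\widehat{\mathcal{T}}\|_F\le\sum_{\ell=1}^{L}\sum_{k=1}^{K_\ell}\Big[\prod_{(t,s)>(\ell,k)}c_{t,s}\Big]c'_{\ell,k}\sqrt{\sum_{i>\hat r_{\ell,k}}\sigma_i(\mathcal{T}^{\ell,k})^2}\le\left(\sum_{\ell=1}^{L}\sum_{k=1}^{K_\ell}\Big[\prod_{(t,s)>(\ell,k)}c_{t,s}\Big]c'_{\ell,k}\right)\|\mathcal{T}-\mathcal{T}_{\hat{\mathcal{R}}}\|_F,$$ where $\mathcal{T}_{\hat{\mathcal{R}}}$ is any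 best TTN approximation of $\mathcal{T}$ of TTN rank $\hat{\mathcal{R}}$ (best in Frobenius norm, with respect to $\mathcal{I}$), $\sigma_i(\cdot)$ is the $i$-th largest singular value, the products run over pairs $(t,s)$ with $1\le t\le L$, $1\le s\le K_t$ that are strictly larger than $(\ell,k)$ in lexicographic order, and $$c_{\ell,k}=1+\sqrt{\frac{r_{\ell,k}}{p_{\ell,k}-1}},\qquad c'_{\ell,k}=\sqrt{1+\frac{r_{\ell,k}}{p_{\ell,k}-1}}\cdot\sqrt{1+\frac{\hat r_{\ell,k}}{r_{\ell,k}-\hat r_{\ell,k}-1}}.$$
   Context: Matricization: for $I\subseteq D$ let $n_I=\prod_{i\in I}n_i$ (with $n_\emptyset=1$). For $\mathcal{S}\in\mathbb{R}^{n_1\times\dots\times n_d}$, $\mathcal{S}^I\in\mathbb{R}^{n_I\times n_{D\setminus I}}$ is the matrix whose rows are indexed by the multi-indices $(i_\mu)_{\mu\in I}$ and columns by $(i_\mu)_{\mu\in D\setminus I}$ (both enumerated in a fixed colexicographic order), with the corresponding entries of $\mathcal{S}$. The Frobenius norm of a tensor is the Euclidean norm of its entries. Index tree: a rooted tree $\mathcal{I}$ whose nodes are nonempty subsets $I_{\ell,k}\subseteq D$, where $\ell\in\{0,\dots,L\}$ is the level (depth) and $k\in\{1,\dots,K_\ell\}$ enumerates the nodes of level $\ell$; the root is $I_{0,1}=D$, and each node is either a leaf or contains the union of its children, which are pairwise disjoint (the union may be strictly smaller than the node). Leaves may lie at any level. Consequently distinct nodes of the same level are disjoint. Write $\mathcal{S}^{\ell,k}=\mathcal{S}^{I_{\ell,k}}$.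 TTN rank: given positive integers $\mathcal{R}=(r_{\ell,k})$ indexed by the non-root nodes, with the convention $r_{0,1}=1$, a tensor $\mathcal{S}$ has TTN rank $\mathcal{R}$ if there are matrices $U_{\ell,k}\in\mathbb{R}^{n_{I_{\ell,k}}\times r_{\ell,k}}$ for all nodes such that $U_{0,1}$ is the vectorization of $\mathcal{S}$, and for each non-leaf node $I$ with children $t_1,\dots,t_m$ and leftover indices $J=I\setminus(t_1\cup\dots\cup t_m)$ there is an array $B_I$ with $$U_I\big((i_\mu)_{\mu\in I},a\big)=\sum_{a_1,\dots,a_m}\Big(\prod_{s=1}^m U_{t_s}\big((i_\mu)_{\mu\in t_s},a_s\big)\Big)B_I\big(a_1,\dots,a_m,(i_\mu)_{\mu\in J},a\big)$$ (the $U$ at leaves are arbitrary). TTNN approximant: for each non-root node define $$P_{\ell,k}=\mathcal{T}^{\ell,k}X_{\ell,k}(Y_{\ell,k}^T\mathcal{T}^{\ell,k}X_{\ell,k})^\dagger Y_{\ell,k}^T\in\mathbb{R}^{n_{I_{\ell,k}}\times n_{I_{\ell,k}}},$$ with $\dagger$ the Moore–Penrose pseudoinverse. For $M\in\mathbb{R}^{n_I\times n_I}$ let $M^{[I]}$ be the linear operator on $\mathbb{R}^{n_1\times\dots\times n_d}$ with $(M^{[I]}\mathcal{S})^I=M\mathcal{S}^I$. Put $\mathcal{T}^{(0)}=\mathcal{T}$ and $\mathcal{T}^{(\ell)}=P_{\ell,1}^{[I_{\ell,1}]}\cdots P_{\ell,K_\ell}^{[I_{\ell,K_\ell}]}\mathcal{T}^{(\ell-1)}$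 for $\ell=1,\dots,L$ (operators of one level commute). The TTNN approximant is $\widehat{\mathcal{T}}=\mathcal{T}^{(L)}$. *)

theory Defs
  imports "HOL-Probability.Probability" "Jordan_Normal_Form.Char_Poly"
begin

section \<open>Moore-Penrose pseudoinverse and singular values of real matrices\<close>

definition is_pinv :: "real mat \<Rightarrow> real mat \<Rightarrow> bool" where
  "is_pinv A B \<longleftrightarrow> B \<in> carrier_mat (dim_col A) (dim_row A)
     \<and> A * B * A = A \<and> B * A * B = B
     \<and> transpose_mat (A * B) = A * B \<and> transpose_mat (B * A) = B * A"

definition pinv :: "real mat \<Rightarrow> real mat" where
  "pinv A = (THE B. is_pinv A B)"

text \<open>The square roots of the eigenvalues of \<open>A\<^sup>T A\<close>, with multiplicity and in decreasing order;
  an \<open>m \<times> n\<close> matrix has \<open>min m n\<close> singular values.\<close>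

definition singular_values :: "real mat \<Rightarrow> real list" where
  "singular_values A = take (min (dim_row A) (dim_col A))
     (rev (sorted_list_of_multiset
        (image_mset sqrt (proots (char_poly (transpose_mat A * A))))))"

text \<open>The numbering starts at 1, and there is nothing (hence 0) beyond \<open>min m n\<close>.\<close>

definition sing_val :: "real mat \<Rightarrow> nat \<Rightarrow> real" where
  "sing_val A i = (if 1 \<le> i \<and> i \<le> length (singular_values A)
     then singular_values A ! (i - 1) else 0)"


section \<open>Tensors and matricizations\<close>

text \<open>A tensor with modes \<open>D\<close> and mode sizes \<open>n \<mu>\<close> is a real function of multi-indices. Only its
  values on \<open>multi_indices n D\<close> matter. Each index \<open>i \<mu>\<close> runs over \<open>{0..<n \<mu>}\<close>, to agree with
  the numbering of the rows and columns of matrices.\<close>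

type_synonym tensor = "(nat \<Rightarrow> nat) \<Rightarrow> real"

definition multi_indices :: "(nat \<Rightarrow> nat) \<Rightarrow> nat set \<Rightarrow> (nat \<Rightarrow> nat) set" where
  "multi_indices n I = PiE I (\<lambda>\<mu>. {0..<n \<mu>})"

definition dim_prod :: "(nat \<Rightarrow> nat) \<Rightarrow> nat set \<Rightarrow> nat" where
  "dim_prod n I = (\<Prod>\<mu>\<in>I. n \<mu>)"

definition frob_norm :: "(nat \<Rightarrow> nat) \<Rightarrow> nat set \<Rightarrow> tensor \<Rightarrow> real" where
  "frob_norm n D S = sqrt (\<Sum>i\<in>multi_indices n D. (S i)\<^sup>2)"

text \<open>Position of \<open>(i \<mu>)\<^sub>\<mu>\<^sub>\<in>\<^sub>I\<close> in the colexicographic order (the smallest mode varies fastest), and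
  the inverse map.\<close>

definition colex_pos :: "(nat \<Rightarrow> nat) \<Rightarrow> nat set \<Rightarrow> (nat \<Rightarrow> nat) \<Rightarrow> nat" where
  "colex_pos n I i = (\<Sum>\<mu>\<in>I. i \<mu> * dim_prod n {\<nu>\<in>I. \<nu> < \<mu>})"

definition colex_nth :: "(nat \<Rightarrow> nat) \<Rightarrow> nat set \<Rightarrow> nat \<Rightarrow> nat \<Rightarrow> nat" where
  "colex_nth n I q = (\<lambda>\<mu>\<in>I. q div dim_prod n {\<nu>\<in>I. \<nu> < \<mu>} mod n \<mu>)"

definition matricize :: "(nat \<Rightarrow> nat) \<Rightarrow> nat set \<Rightarrow> nat set \<Rightarrow> tensor \<Rightarrow> real mat" where
  "matricize n D I S = Matrix.mat (dim_prod n I) (dim_prod n (D - I))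
     (\<lambda>(a, b). S (\<lambda>\<mu>\<in>D. if \<mu> \<in> I then colex_nth n I a \<mu> else colex_nth n (D - I) b \<mu>))"

definition tensorize :: "(nat \<Rightarrow> nat) \<Rightarrow> nat set \<Rightarrow> nat set \<Rightarrow> real mat \<Rightarrow> tensor" where
  "tensorize n D I A = (\<lambda>i. A $$ (colex_pos n I i, colex_pos n (D - I) i))"

text \<open>The operator \<open>M\<^sup>[\<^sup>I\<^sup>]\<close>; see \<open>matricize_mode_apply\<close> below.\<close>

definition mode_apply :: "(nat \<Rightarrow> nat) \<Rightarrow> nat set \<Rightarrow> nat set \<Rightarrow> real mat \<Rightarrow> tensor \<Rightarrow> tensor" where
  "mode_apply n D I M S = tensorize n D I (M * matricize n D I S)"

lemma colex_pos_insert: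
  assumes "finite I" "\<forall>x\<in>I. x < b"
  shows "colex_pos n (insert b I) i = colex_pos n I i + i b * dim_prod n I"
proof -
  have b: "b \<notin> I" using assms by auto
  have 1: "{\<nu>. (\<nu> = b \<or> \<nu> \<in> I) \<and> \<nu> < b} = I" using assms by auto
  have 2: "{\<nu>. (\<nu> = b \<or> \<nu> \<in> I) \<and> \<nu> < \<mu>} = {\<nu>\<in>I. \<nu> < \<mu>}" if "\<mu> \<in> I" for \<mu> using assms that by auto
  show ?thesis unfolding colex_pos_def using assms b by (simp add: 1 2 cong: sum.cong)
qed

lemma dim_prod_insert:
  assumes "finite I" "b \<notin> I"
  shows "dim_prod n (insert b I) = n b * dim_prod n I"
  using assms by (simp add: dim_prod_def)

lemma colex_nth_pos_aux:
  assumes "finite I" "q < dim_prod n I"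
  shows "(\<forall>\<mu>\<in>I. colex_nth n I q \<mu> < n \<mu>) \<and> colex_pos n I (colex_nth n I q) = q"
  using assms
proof (induction I arbitrary: q rule: finite_linorder_max_induct)
  case empty
  then show ?case by (simp add: colex_pos_def dim_prod_def)
next
  case (insert b A)
  have b: "b \<notin> A" using insert by auto
  have 1: "{\<nu>. (\<nu> = b \<or> \<nu> \<in> A) \<and> \<nu> < b} = A" using insert by auto
  have 2: "{\<nu>. (\<nu> = b \<or> \<nu> \<in> A) \<and> \<nu> < \<mu>} = {\<nu>\<in>A. \<nu> < \<mu>}" if "\<mu> \<in> A" for \<mu> using insert that by auto
  let ?N = "dim_prod n A"
  have q: "q < n b * ?N" using insert.prems dim_prod_insert[OF insert.hyps(1) b] by simp
  hence N: "?N > 0" by (cases "?N") auto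
  have nb: "q div ?N < n b" using q by (simp add: less_mult_imp_div_less)
  have cb: "colex_nth n (insert b A) q b = q div ?N"
    using nb by (simp add: colex_nth_def 1)
  have cA: "colex_nth n (insert b A) q \<mu> = colex_nth n A (q mod ?N) \<mu>" if m: "\<mu> \<in> A" for \<mu>
  proof -
    let ?W = "dim_prod n {\<nu>\<in>A. \<nu> < \<mu>}"
    have "{\<nu>\<in>A. \<nu> < \<mu>} \<union> {\<nu>\<in>A. \<nu> \<ge> \<mu>} = A" by auto
    moreover have "{\<nu>\<in>A. \<nu> \<ge> \<mu>} = insert \<mu> {\<nu>\<in>A. \<nu> > \<mu>}" using m by auto
    ultimately have A: "A = insert \<mu> ({\<nu>\<in>A. \<nu> < \<mu>} \<union> {\<nu>\<in>A. \<nu> > \<mu>})" by auto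
    have "?N = n \<mu> * dim_prod n ({\<nu>\<in>A. \<nu> < \<mu>} \<union> {\<nu>\<in>A. \<nu> > \<mu>})"
      by (subst A, rule dim_prod_insert) (use insert.hyps(1) in auto)
    also have "dim_prod n ({\<nu>\<in>A. \<nu> < \<mu>} \<union> {\<nu>\<in>A. \<nu> > \<mu>}) = ?W * dim_prod n {\<nu>\<in>A. \<nu> > \<mu>}"
      unfolding dim_prod_def by (rule prod.union_disjoint) (use insert.hyps(1) in auto)
    finally obtain c where c: "?N = ?W * (n \<mu> * c)" by (metis mult.left_commute)
    have "q mod ?N div ?W = q div ?W mod (n \<mu> * c)"
      unfolding c using N c by (simp add: mod_mult2_eq)
    hence "q mod ?N div ?W mod n \<mu> = q div ?W mod n \<mu>" by (simp add: mod_mult2_eq)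
    thus ?thesis using m by (simp add: colex_nth_def 2)
  qed
  have IH: "(\<forall>\<mu>\<in>A. colex_nth n A (q mod ?N) \<mu> < n \<mu>) \<and> colex_pos n A (colex_nth n A (q mod ?N)) = q mod ?N"
    by (rule insert.IH) (use N in auto)
  have "colex_pos n A (colex_nth n (insert b A) q) = colex_pos n A (colex_nth n A (q mod ?N))"
    unfolding colex_pos_def by (intro sum.cong) (auto simp: cA)
  hence "colex_pos n (insert b A) (colex_nth n (insert b A) q) = q"
    using IH insert.hyps by (simp add: colex_pos_insert cb mod_div_mult_eq)
  thus ?case using IH cA cb nb by auto
qed

lemma colex_pos_cong: "(\<And>\<mu>. \<mu> \<in> I \<Longrightarrow> i \<mu> = j \<mu>) \<Longrightarrow> colex_pos n I i = colex_pos n I j"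
  unfolding colex_pos_def by (intro sum.cong) auto

lemma matricize_mode_apply:
  assumes "finite D" "I \<subseteq> D" "M \<in> carrier_mat (dim_prod n I) (dim_prod n I)"
  shows "matricize n D I (mode_apply n D I M S) = M * matricize n D I S"
proof -
  have f: "finite I" "finite (D - I)" using assms finite_subset by auto
  let ?A = "M * matricize n D I S"
  have A: "?A \<in> carrier_mat (dim_prod n I) (dim_prod n (D - I))"
    using assms by (auto simp: matricize_def)
  show ?thesis
  proof (rule eq_matI)
    fix a b assume "a < dim_row ?A" "b < dim_col ?A"
    hence ab: "a < dim_prod n I" "b < dim_prod n (D - I)" using A by auto
    let ?i = "\<lambda>\<mu>\<in>D. if \<mu> \<in> I then colex_nth n I a \<mu> else colex_nth n (D - I) b \<mu>"
    have 1: "colex_pos n I ?i = a"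
      using colex_nth_pos_aux[OF f(1) ab(1)] assms(2)
      by (subst colex_pos_cong[where j = "colex_nth n I a"]) auto
    have 2: "colex_pos n (D - I) ?i = b"
      using colex_nth_pos_aux[OF f(2) ab(2)]
      by (subst colex_pos_cong[where j = "colex_nth n (D - I) b"]) auto
    show "matricize n D I (mode_apply n D I M S) $$ (a, b) = ?A $$ (a, b)"
      unfolding mode_apply_def tensorize_def
      using ab 1 2 by (subst matricize_def) simp
  qed (use A in \<open>auto simp: matricize_def\<close>)
qed

section \<open>Index trees and TTN ranks\<close>

text \<open>The nodes of the tree are the pairs \<open>(l, k)\<close> with \<open>l \<le> depth\<close> and \<open>1 \<le> k \<le> width l\<close>, the node
  \<open>(l, k)\<close> carries the set \<open>node_set l k\<close>, and for \<open>l \<ge> 1\<close> its parent is \<open>(l - 1, parent l k)\<close>.\<close>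

record index_tree =
  depth :: nat
  width :: "nat \<Rightarrow> nat"
  node_set :: "nat \<Rightarrow> nat \<Rightarrow> nat set"
  parent :: "nat \<Rightarrow> nat \<Rightarrow> nat"

definition tree_nodes :: "index_tree \<Rightarrow> (nat \<times> nat) set" where
  "tree_nodes \<I> = (SIGMA l:{0..depth \<I>}. {1..width \<I> l})"

definition nonroot_nodes :: "index_tree \<Rightarrow> (nat \<times> nat) set" where
  "nonroot_nodes \<I> = (SIGMA l:{1..depth \<I>}. {1..width \<I> l})"

text \<open>Second coordinates of the children of \<open>(l, k)\<close>, all of which have level \<open>l + 1\<close>.\<close>

definition children :: "index_tree \<Rightarrow> nat \<Rightarrow> nat \<Rightarrow> nat set" where
  "children \<I> l k = {s. (l + 1, s) \<in> tree_nodes \<I> \<and> parent \<I> (l + 1) s = k}"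

definition is_index_tree :: "nat \<Rightarrow> index_tree \<Rightarrow> bool" where
  "is_index_tree d \<I> \<longleftrightarrow>
     width \<I> 0 = 1 \<and> node_set \<I> 0 1 = {1..d} \<and>
     (\<forall>l\<le>depth \<I>. 1 \<le> width \<I> l) \<and>
     (\<forall>(l, k)\<in>tree_nodes \<I>. node_set \<I> l k \<noteq> {} \<and> node_set \<I> l k \<subseteq> {1..d}) \<and>
     (\<forall>(l, k)\<in>nonroot_nodes \<I>. (l - 1, parent \<I> l k) \<in> tree_nodes \<I>) \<and>
     (\<forall>(l, k)\<in>tree_nodes \<I>.
        (\<Union>s\<in>children \<I> l k. node_set \<I> (l + 1) s) \<subseteq> node_set \<I> l k \<and>
        disjoint_family_on (node_set \<I> (l + 1)) (children \<I> l k))"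

text \<open>Ranks are given for the non-root nodes; at the root the convention is \<open>r\<^sub>0\<^sub>,\<^sub>1 = 1\<close>.\<close>

definition node_rank :: "(nat \<Rightarrow> nat \<Rightarrow> nat) \<Rightarrow> nat \<Rightarrow> nat \<Rightarrow> nat" where
  "node_rank r l k = (if l = 0 then 1 else r l k)"

definition has_ttn_rank ::
  "(nat \<Rightarrow> nat) \<Rightarrow> nat \<Rightarrow> index_tree \<Rightarrow> (nat \<Rightarrow> nat \<Rightarrow> nat) \<Rightarrow> tensor \<Rightarrow> bool" where
  "has_ttn_rank n d \<I> r S \<longleftrightarrow>
     (\<exists>U :: nat \<Rightarrow> nat \<Rightarrow> real mat.
        (\<forall>(l, k)\<in>tree_nodes \<I>.
           U l k \<in> carrier_mat (dim_prod n (node_set \<I> l k)) (node_rank r l k)) \<and>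
        (\<forall>i\<in>multi_indices n {1..d}. U 0 1 $$ (colex_pos n {1..d} i, 0) = S i) \<and>
        (\<forall>(l, k)\<in>tree_nodes \<I>. children \<I> l k \<noteq> {} \<longrightarrow>
           (let I = node_set \<I> l k;
                C = children \<I> l k;
                J = I - (\<Union>s\<in>C. node_set \<I> (l + 1) s)
            in \<exists>B :: (nat \<Rightarrow> nat) \<Rightarrow> (nat \<Rightarrow> nat) \<Rightarrow> nat \<Rightarrow> real.
                 \<forall>i\<in>multi_indices n I. \<forall>a<node_rank r l k.
                   U l k $$ (colex_pos n I i, a) =
                   (\<Sum>\<alpha>\<in>PiE C (\<lambda>s. {0..<node_rank r (l + 1) s}).
                      (\<Prod>s\<in>C. U (l + 1) s $$ (colex_pos n (node_set \<I> (l + 1) s) i, \<alpha> s))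
                      * B \<alpha> (restrict i J) a))))"

definition best_ttn_approx ::
  "(nat \<Rightarrow> nat) \<Rightarrow> nat \<Rightarrow> index_tree \<Rightarrow> (nat \<Rightarrow> nat \<Rightarrow> nat) \<Rightarrow> tensor \<Rightarrow> tensor \<Rightarrow> bool" where
  "best_ttn_approx n d \<I> r T S \<longleftrightarrow> has_ttn_rank n d \<I> r S \<and>
     (\<forall>S'. has_ttn_rank n d \<I> r S' \<longrightarrow>
        frob_norm n {1..d} (T - S) \<le> frob_norm n {1..d} (T - S'))"


section \<open>The TTNN approximant\<close>

definition ttnn_proj ::
  "(nat \<Rightarrow> nat) \<Rightarrow> nat \<Rightarrow> index_tree \<Rightarrow> tensor \<Rightarrow> (nat \<Rightarrow> nat \<Rightarrow> real mat) \<Rightarrow>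
   (nat \<Rightarrow> nat \<Rightarrow> real mat) \<Rightarrow> nat \<Rightarrow> nat \<Rightarrow> real mat" where
  "ttnn_proj n d \<I> T X Y l k =
     (let TI = matricize n {1..d} (node_set \<I> l k) T
      in TI * X l k * pinv (transpose_mat (Y l k) * TI * X l k) * transpose_mat (Y l k))"

fun ttnn_level ::
  "(nat \<Rightarrow> nat) \<Rightarrow> nat \<Rightarrow> index_tree \<Rightarrow> tensor \<Rightarrow> (nat \<Rightarrow> nat \<Rightarrow> real mat) \<Rightarrow>
   (nat \<Rightarrow> nat \<Rightarrow> real mat) \<Rightarrow> nat \<Rightarrow> tensor" where
  "ttnn_level n d \<I> T X Y 0 = T"
| "ttnn_level n d \<I> T X Y (Suc l) =
     foldr (\<lambda>k. mode_apply n {1..d} (node_set \<I> (Suc l) k) (ttnn_proj n d \<I> T X Y (Suc l) k))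
       [1..<Suc (width \<I> (Suc l))] (ttnn_level n d \<I> T X Y l)"

definition ttnn ::
  "(nat \<Rightarrow> nat) \<Rightarrow> nat \<Rightarrow> index_tree \<Rightarrow> tensor \<Rightarrow> (nat \<Rightarrow> nat \<Rightarrow> real mat) \<Rightarrow>
   (nat \<Rightarrow> nat \<Rightarrow> real mat) \<Rightarrow> tensor" where
  "ttnn n d \<I> T X Y = ttnn_level n d \<I> T X Y (depth \<I>)"


section \<open>Independent Gaussian sketching matrices\<close>

text \<open>An \<open>m \<times> n\<close> matrix as a point of the product measurable space of its entries.\<close>

definition mat_entries :: "nat \<Rightarrow> nat \<Rightarrow> real mat \<Rightarrow> nat \<times> nat \<Rightarrow> real" where
  "mat_entries m n A = (\<lambda>ij\<in>{0..<m} \<times> {0..<n}. A $$ ij)"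

definition mat_space :: "nat \<Rightarrow> nat \<Rightarrow> (nat \<times> nat \<Rightarrow> real) measure" where
  "mat_space m n = PiM ({0..<m} \<times> {0..<n}) (\<lambda>_. borel)"

definition std_gaussian_mat :: "'w measure \<Rightarrow> nat \<Rightarrow> nat \<Rightarrow> ('w \<Rightarrow> real mat) \<Rightarrow> bool" where
  "std_gaussian_mat M m n G \<longleftrightarrow>
     (\<forall>\<omega>\<in>space M. G \<omega> \<in> carrier_mat m n) \<and>
     (\<forall>i<m. \<forall>j<n. distributed M lborel (\<lambda>\<omega>. G \<omega> $$ (i, j)) std_normal_density) \<and>
     prob_space.indep_vars M (\<lambda>_. borel) (\<lambda>ij \<omega>. G \<omega> $$ ij) ({0..<m} \<times> {0..<n})"

text \<open>In the joint independence of all \<open>X l k\<close> and \<open>Y l k\<close>, \<open>Inl (l, k)\<close> stands for \<open>X l k\<close> and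
  \<open>Inr (l, k)\<close> for \<open>Y l k\<close>.\<close>

definition gaussian_sketches ::
  "'w measure \<Rightarrow> (nat \<Rightarrow> nat) \<Rightarrow> nat \<Rightarrow> index_tree \<Rightarrow> (nat \<Rightarrow> nat \<Rightarrow> nat) \<Rightarrow> (nat \<Rightarrow> nat \<Rightarrow> nat) \<Rightarrow>
   (nat \<Rightarrow> nat \<Rightarrow> 'w \<Rightarrow> real mat) \<Rightarrow> (nat \<Rightarrow> nat \<Rightarrow> 'w \<Rightarrow> real mat) \<Rightarrow> bool" where
  "gaussian_sketches M n d \<I> r p X Y \<longleftrightarrow>
     (let rows = (\<lambda>l k. dim_prod n (node_set \<I> l k));
          cols = (\<lambda>l k. dim_prod n ({1..d} - node_set \<I> l k))
      in (\<forall>(l, k)\<in>nonroot_nodes \<I>.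
            std_gaussian_mat M (cols l k) (r l k) (X l k) \<and>
            std_gaussian_mat M (rows l k) (r l k + p l k) (Y l k)) \<and>
         prob_space.indep_vars M
           (case_sum (\<lambda>(l, k). mat_space (cols l k) (r l k))
                     (\<lambda>(l, k). mat_space (rows l k) (r l k + p l k)))
           (case_sum (\<lambda>(l, k) \<omega>. mat_entries (cols l k) (r l k) (X l k \<omega>))
                     (\<lambda>(l, k) \<omega>. mat_entries (rows l k) (r l k + p l k) (Y l k \<omega>)))
           (nonroot_nodes \<I> <+> nonroot_nodes \<I>))"


section \<open>The constants of the error bound\<close>

definition c_const :: "nat \<Rightarrow> nat \<Rightarrow> real" where
  "c_const r p = 1 + sqrt (real r / (real p - 1))"

definition c'_const :: "nat \<Rightarrow> nat \<Rightarrow> nat \<Rightarrow> real" where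
  "c'_const r p r' =
     sqrt (1 + real r / (real p - 1)) * sqrt (1 + real r' / (real r - real r' - 1))"

text \<open>The factor \<open>[\<Prod>\<^sub>(\<^sub>t\<^sub>,\<^sub>s\<^sub>)\<^sub>>\<^sub>(\<^sub>l\<^sub>,\<^sub>k\<^sub>) c\<^sub>t\<^sub>,\<^sub>s] c'\<^sub>l\<^sub>,\<^sub>k\<close>, the pairs being ordered lexicographically.\<close>

definition node_factor ::
  "index_tree \<Rightarrow> (nat \<Rightarrow> nat \<Rightarrow> nat) \<Rightarrow> (nat \<Rightarrow> nat \<Rightarrow> nat) \<Rightarrow> (nat \<Rightarrow> nat \<Rightarrow> nat) \<Rightarrow>
   nat \<Rightarrow> nat \<Rightarrow> real" where
  "node_factor \<I> r p r' l k =
     (\<Prod>(t, s)\<in>{(t, s). (t, s) \<in> nonroot_nodes \<I> \<and> (l < t \<or> l = t \<and> k < s)}.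
        c_const (r t s) (p t s))
     * c'_const (r l k) (p l k) (r' l k)"

text \<open>\<open>(\<Sum>\<^sub>i\<^sub>>\<^sub>q \<sigma>\<^sub>i(A)\<^sup>2)\<^sup>1\<^sup>/\<^sup>2\<close>\<close>

definition sv_tail :: "real mat \<Rightarrow> nat \<Rightarrow> real" where
  "sv_tail A q = sqrt (\<Sum>i\<in>{q<..min (dim_row A) (dim_col A)}. (sing_val A i)\<^sup>2)"

end

theory Submission
  imports Defs
begin

text \<open>
  The order of the projections within a level is irrelevant, because nodes of one level are disjoint.
  Applying them in lexicographic order and writing \<open>T\<^sub>j = P\<^sub>j T\<^sub>j\<^sub>-\<^sub>1\<close>, the splitting
  \<open>T - T\<^sub>j = (T - P\<^sub>j T) + P\<^sub>j (T - T\<^sub>j\<^sub>-\<^sub>1)\<close> and the independence of \<open>P\<^sub>j\<close> from \<open>T\<^sub>j\<^sub>-\<^sub>1\<close> reduce the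
  bound to \<open>E \<parallel>T - P\<^sub>j T\<parallel> \<le> c'\<^sub>j \<cdot> tail\<^sub>j\<close> and \<open>E \<parallel>P\<^sub>j S\<parallel> \<le> c\<^sub>j \<parallel>S\<parallel>\<close> for fixed \<open>S\<close>.

  If \<open>Q\<close> is an orthonormal basis of the range of \<open>A X\<close> and \<open>G = Y\<^sup>T Q\<close> has full column rank, then
  \<open>P = Q G\<^sup>\<dagger> Y\<^sup>T\<close>, so that \<open>P S = Q Q\<^sup>T S + Q G\<^sup>\<dagger> Y\<^sup>T W\<close> with \<open>W = S - Q Q\<^sup>T S\<close>. Both estimates, and
  the range finder estimate for \<open>X\<close>, follow from
  \<open>E \<parallel>G\<^sup>\<dagger> Y\<^sup>T W\<parallel>\<^sup>2 \<le> q / (m - q - 1) \<parallel>W\<parallel>\<^sup>2\<close> for a Gaussian \<open>n \<times> m\<close> matrix \<open>Y\<close>, \<open>Q\<^sup>T Q = 1\<close>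
  and \<open>Q\<^sup>T W = 0\<close>. Instead of rotation invariance and the inverse Wishart distribution, the proof
  regularizes \<open>G\<^sup>\<dagger>\<close> to \<open>K G\<^sup>T\<close> with \<open>K = (G\<^sup>T G + e)\<^sup>-\<^sup>1\<close> and integrates by parts twice. The field
  \<open>Q K G\<^sup>T\<close> has divergence at least \<open>(m - q - 1) tr K\<close> and pairs with \<open>Y\<close> to at most \<open>q\<close>; the field
  \<open>W W\<^sup>T Y G K\<^sup>2 G\<^sup>T\<close> gives \<open>E \<parallel>K G\<^sup>T Y\<^sup>T W\<parallel>\<^sup>2 = \<parallel>W\<parallel>\<^sup>2 E \<parallel>K G\<^sup>T\<parallel>\<^sup>2 \<le> \<parallel>W\<parallel>\<^sup>2 E tr K\<close>. Finally \<open>e\<close> tends to 0.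

  The second inequality is the Eckart-Young bound: every unfolding of a tensor of TTN rank \<open>r'\<close>
  at a node has matrix rank at most the rank of that node.
\<close>

section \<open>Trace, Frobenius norm and orthonormal columns\<close>

text \<open>The pseudoinverse jumps where the rank drops, and its moments are not known beforehand
  to be finite, so it cannot be integrated by parts itself; K is smooth with entries bounded by 1 /
  e. The denominator m - q - 1 counts traces: differentiating the factor G^T of the first field
  yields m tr K, while differentiating K takes away about q tr K and another tr K. The same trace
  bound shows that G has full column rank almost surely, which is what makes the formula for P
  available. The two constants differ in shape for a geometric reason. Both summands of P S lie in
  the range of Q, so only the triangle inequality is left and c is 1 plus a square root. In T - P T
  the part W is orthogonal to the range of Q, so Pythagoras gives the square root of a sum, and the
  range finder contributes the second factor of c' in the same way. The error estimates use
  nonnegative integrals, so that integrability of the error is a conclusion. Independence enters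
  through Fubini on a product of Gaussian measures, to which the given sketches are
  transported.\<close>

lemma mult_mat_entry:
  assumes "i < dim_row A" "j < dim_col B" "dim_col A = dim_row B"
  shows "(A * B) $$ (i, j) = (\<Sum>k<dim_row B. A $$ (i, k) * B $$ (k, j))"
  using assms by (auto simp: scalar_prod_def atLeast0LessThan intro!: sum.cong)

text \<open>The premises are equations between dimensions, not carriers, so that the simplifier can solve them.\<close>

lemma mat_assoc:
  "dim_col A = dim_row B \<Longrightarrow> dim_col B = dim_row C \<Longrightarrow> (A * B) * C = A * (B * (C :: 'a :: semiring_0 mat))"
  by (rule assoc_mult_mat[of _ "dim_row A" "dim_col A" _ "dim_col B" _ "dim_col C"]) auto

lemma mat_add_mult:
  "dim_row A = dim_row B \<Longrightarrow> dim_col A = dim_col B \<Longrightarrow> dim_col A = dim_row C \<Longrightarrow>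
   (A + B) * C = A * C + B * (C :: 'a :: ring mat)"
  by (rule add_mult_distrib_mat[of _ "dim_row A" "dim_col A" _ _ "dim_col C"]) auto

lemma mat_mult_add:
  "dim_row B = dim_row C \<Longrightarrow> dim_col B = dim_col C \<Longrightarrow> dim_col A = dim_row C \<Longrightarrow>
   A * (B + C) = A * B + A * (C :: 'a :: ring mat)"
  by (rule mult_add_distrib_mat[of _ "dim_row A" "dim_col A" _ "dim_col C"]) auto

lemma mat_minus_mult:
  "dim_row A = dim_row B \<Longrightarrow> dim_col A = dim_col B \<Longrightarrow> dim_col A = dim_row C \<Longrightarrow>
   (A - B) * C = A * C - B * (C :: 'a :: ring mat)"
  by (rule minus_mult_distrib_mat[of _ "dim_row A" "dim_col A" _ _ "dim_col C"]) auto

lemma mat_mult_minus: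
  "dim_row B = dim_row C \<Longrightarrow> dim_col B = dim_col C \<Longrightarrow> dim_col A = dim_row C \<Longrightarrow>
   A * (B - C) = A * B - A * (C :: 'a :: ring mat)"
  by (rule mult_minus_distrib_mat[of _ "dim_row A" "dim_col A" _ "dim_col C"]) auto

lemma mat_smult_mult: "dim_col A = dim_row B \<Longrightarrow> (c \<cdot>\<^sub>m A) * B = c \<cdot>\<^sub>m (A * (B :: 'a :: comm_ring mat))"
  by (rule mult_smult_assoc_mat[of _ "dim_row A" "dim_col A" _ "dim_col B"]) auto

lemma mat_mult_smult: "dim_col A = dim_row B \<Longrightarrow> A * (c \<cdot>\<^sub>m B) = c \<cdot>\<^sub>m (A * (B :: 'a :: comm_ring mat))"
  by (rule mult_smult_distrib[of _ "dim_row A" "dim_col A" _ "dim_col B"]) auto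

lemma mat_transpose_mult:
  "dim_col A = dim_row B \<Longrightarrow> (A * B)\<^sup>T = B\<^sup>T * (A :: 'a :: comm_semiring_0 mat)\<^sup>T"
  by (rule transpose_mult[of _ "dim_row A" "dim_col A" _ "dim_col B"]) auto

lemma mat_transpose_add:
  "dim_row A = dim_row B \<Longrightarrow> dim_col A = dim_col B \<Longrightarrow>
   (A + B)\<^sup>T = A\<^sup>T + B\<^sup>T"
  by (intro eq_matI) auto

lemma mat_transpose_minus:
  "dim_row A = dim_row B \<Longrightarrow> dim_col A = dim_col B \<Longrightarrow>
   (A - B)\<^sup>T = A\<^sup>T - B\<^sup>T"
  by (intro eq_matI) auto

lemma mat_transpose_smult: "(c \<cdot>\<^sub>m A)\<^sup>T = c \<cdot>\<^sub>m A\<^sup>T"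
  by (intro eq_matI) auto

lemma mat_left_one: "n = dim_row A \<Longrightarrow> 1\<^sub>m n * A = (A :: 'a :: semiring_1 mat)"
  by (rule left_mult_one_mat[of _ _ "dim_col A"]) auto

lemma mat_right_one: "n = dim_col A \<Longrightarrow> A * 1\<^sub>m n = (A :: 'a :: semiring_1 mat)"
  by (rule right_mult_one_mat[of _ "dim_row A"]) auto

lemmas mat_alg = mat_assoc mat_transpose_mult mat_transpose_add mat_transpose_minus
  mat_transpose_smult mat_left_one mat_right_one mat_smult_mult mat_mult_smult

lemmas mat_distrib = mat_add_mult mat_mult_add mat_minus_mult mat_mult_minus

definition mtr :: "real mat \<Rightarrow> real" where
  "mtr A = (\<Sum>i<dim_row A. A $$ (i, i))"

lemma mtr_comm:
  assumes "dim_col A = dim_row B" "dim_col B = dim_row A"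
  shows "mtr (A * B) = mtr (B * A)"
proof -
  have "mtr (A * B) = (\<Sum>i<dim_row A. \<Sum>k<dim_row B. A $$ (i, k) * B $$ (k, i))"
    unfolding mtr_def using assms by (intro sum.cong) (auto simp: mult_mat_entry simp del: index_mult_mat(1))
  also have "\<dots> = (\<Sum>k<dim_row B. \<Sum>i<dim_row A. B $$ (k, i) * A $$ (i, k))"
    by (subst sum.swap) (simp add: mult.commute)
  also have "\<dots> = mtr (B * A)"
    unfolding mtr_def using assms by (intro sum.cong) (auto simp: mult_mat_entry simp del: index_mult_mat(1))
  finally show ?thesis .
qed

lemma mtr_add: "dim_row A = dim_row B \<Longrightarrow> dim_row A \<le> dim_col B \<Longrightarrow> mtr (A + B) = mtr A + mtr B"
  unfolding mtr_def by (simp add: sum.distrib)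

lemma mtr_minus: "dim_row A = dim_row B \<Longrightarrow> dim_row A \<le> dim_col B \<Longrightarrow> mtr (A - B) = mtr A - mtr B"
  unfolding mtr_def by (simp add: sum_subtractf)

lemma mtr_smult: "dim_row A \<le> dim_col A \<Longrightarrow> mtr (c \<cdot>\<^sub>m A) = c * mtr A"
  unfolding mtr_def by (simp add: sum_distrib_left)

lemma mtr_transpose: "dim_row A = dim_col A \<Longrightarrow> mtr (A\<^sup>T) = mtr A"
  unfolding mtr_def by simp

lemma mtr_one: "mtr (1\<^sub>m n) = real n"
  unfolding mtr_def by simp

lemma mtr_zero [simp]: "mtr (0\<^sub>m n n) = 0"
  unfolding mtr_def by simp

definition mfro2 :: "real mat \<Rightarrow> real" where
  "mfro2 A = (\<Sum>i<dim_row A. \<Sum>j<dim_col A. (A $$ (i, j))\<^sup>2)"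

definition mfro :: "real mat \<Rightarrow> real" where
  "mfro A = sqrt (mfro2 A)"

lemma mfro2_nonneg [simp]: "0 \<le> mfro2 A"
  unfolding mfro2_def by (intro sum_nonneg) auto

lemma mfro_nonneg [simp]: "0 \<le> mfro A"
  unfolding mfro_def by simp

lemma mfro_sq: "(mfro A)\<^sup>2 = mfro2 A"
  unfolding mfro_def by simp

lemma mfro2_transpose: "mfro2 (A\<^sup>T) = mfro2 A"
  unfolding mfro2_def by (subst sum.swap) simp

lemma mfro2_mtr: "mfro2 A = mtr (A * A\<^sup>T)"
  unfolding mfro2_def mtr_def
  by (intro sum.cong) (auto simp: mult_mat_entry power2_eq_square simp del: index_mult_mat(1))

lemma mfro2_mtr': "mfro2 A = mtr (A\<^sup>T * A)"
  using mfro2_mtr[of "A\<^sup>T"] by (simp add: mfro2_transpose)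

lemma mfro_eq_L2: "mfro A = L2_set (\<lambda>ij. A $$ ij) ({..<dim_row A} \<times> {..<dim_col A})"
  unfolding mfro_def mfro2_def L2_set_def by (simp add: sum.cartesian_product split_def)

lemma mfro_triangle:
  assumes "dim_row A = dim_row B" "dim_col A = dim_col B"
  shows "mfro (A + B) \<le> mfro A + mfro B"
proof -
  have "mfro (A + B) = L2_set (\<lambda>ij. A $$ ij + B $$ ij) ({..<dim_row B} \<times> {..<dim_col B})"
    unfolding mfro_eq_L2 by (rule L2_set_cong) (auto simp: assms)
  also have "\<dots> \<le> mfro A + mfro B"
    unfolding mfro_eq_L2 assms by (rule L2_set_triangle_ineq)
  finally show ?thesis .
qed

lemma mfro2_entry: "i < dim_row A \<Longrightarrow> j < dim_col A \<Longrightarrow> (A $$ (i, j))\<^sup>2 \<le> mfro2 A"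
proof -
  assume ij: "i < dim_row A" "j < dim_col A"
  have "(A $$ (i, j))\<^sup>2 \<le> (\<Sum>j<dim_col A. (A $$ (i, j))\<^sup>2)"
    using ij by (intro member_le_sum) auto
  also have "\<dots> \<le> mfro2 A"
    unfolding mfro2_def using ij by (intro member_le_sum[where f="\<lambda>i. \<Sum>j<dim_col A. (A $$ (i, j))\<^sup>2"] sum_nonneg) auto
  finally show ?thesis .
qed

lemma mfro2_eq_0: "mfro2 A = 0 \<Longrightarrow> A = 0\<^sub>m (dim_row A) (dim_col A)"
  using mfro2_entry[of _ A] by (intro eq_matI) auto

lemma mfro2_pythagoras:
  assumes "dim_row A = dim_row B" "dim_col A = dim_col B"
    and "A\<^sup>T * B = 0\<^sub>m (dim_col B) (dim_col B)"
  shows "mfro2 (A + B) = mfro2 A + mfro2 B"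
proof -
  have "(A\<^sup>T * B)\<^sup>T = 0\<^sub>m (dim_col B) (dim_col B)"
    unfolding assms by simp
  hence 1: "B\<^sup>T * A = 0\<^sub>m (dim_col B) (dim_col B)"
    using assms(1,2) by (simp add: mat_transpose_mult)
  have "mfro2 (A + B) = mtr (A\<^sup>T * (A + B) + B\<^sup>T * (A + B))"
    unfolding mfro2_mtr' by (subst mat_transpose_add, simp_all add: assms(1,2), subst mat_add_mult, simp_all add: assms(1,2))
  also have "\<dots> = mtr ((A\<^sup>T * A + A\<^sup>T * B) + (B\<^sup>T * A + B\<^sup>T * B))"
    by (subst (1 2) mat_mult_add) (simp_all add: assms(1,2))
  also have "\<dots> = mfro2 A + mfro2 B"
    unfolding mfro2_mtr' using 1 assms by (subst mtr_add; simp add: mtr_add)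
  finally show ?thesis .
qed

lemma mfro2_pythagoras':
  assumes "dim_row A = dim_row B" "dim_col A = dim_col B"
    and "A * B\<^sup>T = 0\<^sub>m (dim_row B) (dim_row B)"
  shows "mfro2 (A + B) = mfro2 A + mfro2 B"
proof -
  have "mfro2 (A\<^sup>T + B\<^sup>T) = mfro2 (A\<^sup>T) + mfro2 (B\<^sup>T)"
    by (rule mfro2_pythagoras) (simp_all add: assms)
  moreover have "A\<^sup>T + B\<^sup>T = (A + B)\<^sup>T"
    by (rule mat_transpose_add[symmetric]) (simp_all add: assms)
  ultimately show ?thesis by (simp only: mfro2_transpose)
qed

text \<open>A matrix without columns qualifies, so that bases of the zero space need no separate
  treatment.\<close>

definition orthocols :: "real mat \<Rightarrow> bool" where
  "orthocols Q \<longleftrightarrow> Q\<^sup>T * Q = 1\<^sub>m (dim_col Q)"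

lemma mfro2_orthocols_mult:
  assumes "orthocols Q" "dim_col Q = dim_row A"
  shows "mfro2 (Q * A) = mfro2 A"
proof -
  have "mfro2 (Q * A) = mtr (A\<^sup>T * ((Q\<^sup>T * Q) * A))"
    unfolding mfro2_mtr' using assms(2) by (simp add: mat_alg)
  thus ?thesis using assms unfolding orthocols_def mfro2_mtr' by (simp add: mat_alg)
qed

lemma ortho_complement:
  assumes "orthocols Q" "dim_row Q = dim_row A"
  shows "Q\<^sup>T * (A - Q * (Q\<^sup>T * A)) = 0\<^sub>m (dim_col Q) (dim_col A)"
proof -
  have "Q\<^sup>T * (A - Q * (Q\<^sup>T * A)) =
     Q\<^sup>T * A - (Q\<^sup>T * Q) * (Q\<^sup>T * A)"
    using assms(2) by (simp add: mat_alg mat_distrib)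
  also have "\<dots> = Q\<^sup>T * A - Q\<^sup>T * A"
    using assms unfolding orthocols_def by (simp add: mat_alg)
  also have "\<dots> = 0\<^sub>m (dim_col Q) (dim_col A)" by (intro eq_matI) auto
  finally show ?thesis .
qed

lemma mfro2_ortho_split:
  assumes "orthocols Q" "dim_row Q = dim_row A"
  shows "mfro2 A = mfro2 (Q\<^sup>T * A) + mfro2 (A - Q * (Q\<^sup>T * A))"
proof -
  let ?B = "A - Q * (Q\<^sup>T * A)" and ?C = "Q * (Q\<^sup>T * A)"
  have 1: "?C\<^sup>T * ?B = (A\<^sup>T * Q) * (Q\<^sup>T * ?B)"
    using assms(2) by (simp add: mat_alg)
  have "mfro2 (?C + ?B) = mfro2 ?C + mfro2 ?B"
    by (rule mfro2_pythagoras) (use assms in \<open>simp_all add: 1 ortho_complement\<close>)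
  moreover have "?C + ?B = A" by (rule eq_matI) (use assms in auto)
  ultimately show ?thesis using assms by (simp add: mfro2_orthocols_mult)
qed

lemma mfro2_transpose_ortho_mult_le:
  assumes "orthocols Q" "dim_row Q = dim_row A"
  shows "mfro2 (Q\<^sup>T * A) \<le> mfro2 A"
  using mfro2_ortho_split[OF assms] mfro2_nonneg[of "A - Q * (Q\<^sup>T * A)"] by linarith

lemma mfro2_mult_ortho_le:
  assumes "orthocols Q" "dim_row Q = dim_col A"
  shows "mfro2 (A * Q) \<le> mfro2 A"
  using mfro2_transpose_ortho_mult_le[of Q "A\<^sup>T"] assms mfro2_transpose[of "A * Q"]
  by (simp add: mat_alg mfro2_transpose)

lemma orthocols_mfro2: "orthocols Q \<Longrightarrow> mfro2 Q = real (dim_col Q)"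
  unfolding orthocols_def mfro2_mtr' by (simp add: mtr_one)

text \<open>Dimension counting by norms: the squared norm of \<open>Q\<close> is its number of
  columns, and multiplying the identity by \<open>Q\<^sup>T\<close> cannot increase its squared
  norm, which is the number of rows.\<close>

lemma orthocols_dim_le:
  assumes "orthocols Q" shows "dim_col Q \<le> dim_row Q"
proof -
  have "real (dim_col Q) = mfro2 (Q\<^sup>T * 1\<^sub>m (dim_row Q))"
    using orthocols_mfro2[OF assms] by (simp add: mat_alg mfro2_transpose)
  also have "\<dots> \<le> mfro2 (1\<^sub>m (dim_row Q))"
    by (rule mfro2_transpose_ortho_mult_le[OF assms]) simp
  also have "\<dots> = real (dim_row Q)"
    unfolding mfro2_mtr by (simp add: mat_alg mtr_one)
  finally show ?thesis by simp
qed

lemma orthocols_square: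
  assumes "orthocols V" "V \<in> carrier_mat n n"
  shows "V * V\<^sup>T = 1\<^sub>m n"
proof (rule mat_mult_left_right_inverse)
  show "V\<^sup>T \<in> carrier_mat n n" "V \<in> carrier_mat n n" using assms(2) by auto
  show "V\<^sup>T * V = 1\<^sub>m n" using assms unfolding orthocols_def by (metis carrier_matD(2))
qed

section \<open>The spectral theorem for real symmetric matrices\<close>

definition mdiag :: "nat \<Rightarrow> (nat \<Rightarrow> real) \<Rightarrow> real mat" where
  "mdiag n f = Matrix.mat n n (\<lambda>(i, j). if i = j then f i else 0)"

lemma mdiag_dim [simp]: "dim_row (mdiag n f) = n" "dim_col (mdiag n f) = n"
  unfolding mdiag_def by simp_all

lemma mult_mdiag_entry:
  assumes "i < dim_row A" "j < n" "dim_col A = n"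
  shows "(A * mdiag n f) $$ (i, j) = A $$ (i, j) * f j"
proof -
  have "(A * mdiag n f) $$ (i, j) = (\<Sum>k<n. A $$ (i, k) * mdiag n f $$ (k, j))"
    using assms by (subst mult_mat_entry) auto
  also have "\<dots> = (\<Sum>k<n. if k = j then A $$ (i, j) * f j else 0)"
    using assms by (intro sum.cong) (auto simp: mdiag_def)
  finally show ?thesis using assms by simp
qed

lemma transpose_mdiag: "(mdiag n f)\<^sup>T = mdiag n f"
  unfolding mdiag_def by (intro eq_matI) auto

lemma mdiag_mult: "mdiag n f * mdiag n g = mdiag n (\<lambda>i. f i * g i)"
  by (rule eq_matI) (auto simp: mult_mdiag_entry simp del: index_mult_mat(1), auto simp: mdiag_def)

definition firstcols :: "real mat \<Rightarrow> nat \<Rightarrow> real mat" where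
  "firstcols V q = Matrix.mat (dim_row V) q (\<lambda>ij. V $$ ij)"

lemma firstcols_dim [simp]: "dim_row (firstcols V q) = dim_row V" "dim_col (firstcols V q) = q"
  unfolding firstcols_def by simp_all

lemma firstcols_entry: "i < dim_row V \<Longrightarrow> j < q \<Longrightarrow> firstcols V q $$ (i, j) = V $$ (i, j)"
  unfolding firstcols_def by simp

lemma mult_firstcols:
  assumes "dim_col A = dim_row V" "q \<le> dim_col V"
  shows "A * firstcols V q = firstcols (A * V) q"
  using assms
  by (intro eq_matI) (auto simp: mult_mat_entry firstcols_entry simp del: index_mult_mat(1) intro!: sum.cong)

lemma orthocols_firstcols:
  assumes "orthocols V" "q \<le> dim_col V"
  shows "orthocols (firstcols V q)"
  unfolding orthocols_def
proof (intro eq_matI)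
  fix i j assume "i < dim_row (1\<^sub>m (dim_col (firstcols V q)) :: real mat)"
    "j < dim_col (1\<^sub>m (dim_col (firstcols V q)) :: real mat)"
  hence ij: "i < q" "j < q" by auto
  have "((firstcols V q)\<^sup>T * firstcols V q) $$ (i, j) = (V\<^sup>T * V) $$ (i, j)"
    using ij assms by (auto simp: mult_mat_entry firstcols_entry simp del: index_mult_mat(1) intro!: sum.cong)
  thus "((firstcols V q)\<^sup>T * firstcols V q) $$ (i, j) = 1\<^sub>m (dim_col (firstcols V q)) $$ (i, j)"
    using assms ij unfolding orthocols_def by simp
qed auto

text \<open>The projector 1 - V V^T has trace n - k > 0, so some entry is nonzero. The column of the
  projector with that entry is orthogonal to V and only has to be normalized.\<close>

lemma exists_unit_orthogonal:
  assumes V: "V \<in> carrier_mat n k" "orthocols V" "k < n"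
  shows "\<exists>x\<in>carrier_mat n 1. V\<^sup>T * x = 0\<^sub>m k 1 \<and> mfro2 x = 1"
proof -
  let ?P = "1\<^sub>m n - V * V\<^sup>T"
  have d: "dim_row V = n" "dim_col V = k" using V by auto
  have "?P \<noteq> 0\<^sub>m n n"
  proof
    assume "?P = 0\<^sub>m n n"
    hence "mtr ?P = 0" by simp
    moreover have "mtr ?P = real n - mtr (V * V\<^sup>T)"
      using d by (subst mtr_minus) (auto simp: mtr_one)
    moreover have "mtr (V * V\<^sup>T) = real k"
      using orthocols_mfro2[OF V(2)] d by (simp add: mfro2_mtr)
    ultimately show False using V by simp
  qed
  then obtain i j where ij: "i < n" "j < n" "?P $$ (i, j) \<noteq> 0"
    using d by (auto simp: mat_eq_iff simp del: index_minus_mat(1) index_mult_mat(1))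
  define e where "e = Matrix.mat n 1 (\<lambda>(i, _). if i = j then 1 else 0 :: real)"
  define y where "y = ?P * e"
  have de: "dim_row e = n" "dim_col e = 1" unfolding e_def by auto
  have dy: "dim_row y = n" "dim_col y = 1" unfolding y_def using d de by auto
  have "y $$ (i, 0) = (\<Sum>k<n. if k = j then ?P $$ (i, j) else 0)"
    unfolding y_def using ij d de
    by (subst mult_mat_entry) (simp_all add: e_def if_distrib[of "(*) _"] cong: if_cong del: index_minus_mat(1) index_mult_mat(1))
  hence "y $$ (i, 0) \<noteq> 0" using ij by simp
  hence py: "mfro2 y > 0"
    using mfro2_entry[of i y 0] ij dy by (smt (verit) less_one zero_less_power2)
  have "y = e - V * (V\<^sup>T * e)"
    unfolding y_def using d de by (simp add: mat_minus_mult mat_alg)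
  hence Vy: "V\<^sup>T * y = 0\<^sub>m k 1"
    using ortho_complement[OF V(2), of e] d de by simp
  define x where "x = (1 / mfro y) \<cdot>\<^sub>m y"
  have "mfro2 x = (1 / mfro y)\<^sup>2 * mfro2 y"
    unfolding x_def mfro2_def by (simp add: power_mult_distrib power_divide sum_distrib_left sum_divide_distrib)
  hence "mfro2 x = 1" using py by (simp add: power_divide mfro_sq)
  moreover have "V\<^sup>T * x = 0\<^sub>m k 1"
    unfolding x_def using d dy by (simp add: mat_mult_smult Vy)
  moreover have "x \<in> carrier_mat n 1" unfolding x_def using dy by auto
  ultimately show ?thesis by blast
qed

text \<open>Vectors of length n are encoded as functions on nat that vanish from n on, so
  compactness comes from Tychonoff's theorem.\<close>

lemma compact_function_box:
  "compact {f :: nat \<Rightarrow> real. (\<forall>i<n. f i \<in> {-1..1}) \<and> (\<forall>i\<ge>n. f i = 0)}"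
proof -
  have "compactin (product_topology (\<lambda>i. euclidean) UNIV)
     (PiE UNIV (\<lambda>i::nat. if i < n then {-1..1::real} else {0}))"
    unfolding compactin_PiE by (auto simp: compactin_euclidean_iff)
  moreover have "PiE UNIV (\<lambda>i::nat. if i < n then {-1..1::real} else {0}) =
     {f. (\<forall>i<n. f i \<in> {-1..1}) \<and> (\<forall>i\<ge>n. f i = 0)}"
    (is "?L = ?R")
  proof (intro equalityI subsetI)
    fix f assume "f \<in> ?L"
    hence *: "f i \<in> (if i < n then {-1..1::real} else {0})" for i
      unfolding PiE_iff by blast
    show "f \<in> ?R"
    proof (intro CollectI conjI allI impI)
      fix i show "f i \<in> {-1..1}" if "i < n" using *[of i] that by simp
      show "f i = 0" if "n \<le> i" using *[of i] that by simp
    qed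
  next
    fix f assume "f \<in> ?R"
    hence "f i \<in> (if i < n then {-1..1::real} else {0})" for i by (cases "i < n") auto
    thus "f \<in> ?L" by (simp add: PiE_iff)
  qed
  ultimately show ?thesis
    by (simp add: euclidean_product_topology compactin_euclidean_iff)
qed

text \<open>A continuous function attains its maximum on the compact unit sphere of the orthogonal
  complement of V; homogeneity of degree two extends the inequality from unit vectors to the whole
  complement.\<close>

lemma rayleigh_max:
  assumes A: "A \<in> carrier_mat n n" and V: "V \<in> carrier_mat n k" "orthocols V" "k < n"
  shows "\<exists>x\<in>carrier_mat n 1. V\<^sup>T * x = 0\<^sub>m k 1 \<and> mfro2 x = 1 \<and>
     (\<forall>y\<in>carrier_mat n 1. V\<^sup>T * y = 0\<^sub>m k 1 \<longrightarrow>
        mtr (y\<^sup>T * (A * y)) \<le> mtr (x\<^sup>T * (A * x)) * mfro2 y)"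
proof -
  have d: "dim_row V = n" "dim_col V = k" "dim_row A = n" "dim_col A = n" using V A by auto
  define \<phi> where "\<phi> f = Matrix.mat n 1 (\<lambda>(i, _). f i :: real)" for f
  define q where "q f = (\<Sum>i<n. f i * (\<Sum>j<n. A $$ (i, j) * f j))" for f :: "nat \<Rightarrow> real"
  have \<phi>d: "dim_row (\<phi> f) = n" "dim_col (\<phi> f) = 1" for f by (auto simp: \<phi>_def)
  have \<phi>q: "mtr ((\<phi> f)\<^sup>T * (A * \<phi> f)) = q f" for f
    unfolding mtr_def q_def using d \<phi>d
    by (auto simp: mult_mat_entry simp del: index_mult_mat(1) intro!: sum.cong) (auto simp: \<phi>_def)
  have \<phi>n: "mfro2 (\<phi> f) = (\<Sum>i<n. (f i)\<^sup>2)" for f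
    unfolding mfro2_def \<phi>d by (auto simp: \<phi>_def)
  have \<phi>V: "V\<^sup>T * \<phi> f = 0\<^sub>m k 1 \<longleftrightarrow> (\<forall>j<k. (\<Sum>i<n. V $$ (i, j) * f i) = 0)" for f
  proof -
    have "(V\<^sup>T * \<phi> f) $$ (j, 0) = (\<Sum>i<n. V $$ (i, j) * f i)" if "j < k" for j
      using that d \<phi>d by (auto simp: mult_mat_entry simp del: index_mult_mat(1) intro!: sum.cong) (auto simp: \<phi>_def)
    thus ?thesis using d \<phi>d by (auto simp: mat_eq_iff simp del: index_mult_mat(1))
  qed
  have \<phi>s: "\<phi> (\<lambda>i. if i < n then y $$ (i, 0) else 0) = y" if "y \<in> carrier_mat n 1" for y
    using that unfolding \<phi>_def by (intro eq_matI) auto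
  let ?B = "{f :: nat \<Rightarrow> real. (\<forall>i<n. f i \<in> {-1..1}) \<and> (\<forall>i\<ge>n. f i = 0)}"
  \<comment> \<open>These are closed conditions. The box only adds compactness, since a unit vector
    has its entries in [-1, 1].\<close>
  let ?S = "{f. (\<Sum>i<n. (f i)\<^sup>2) = 1} \<inter> (\<Inter>j\<in>{..<k}. {f. (\<Sum>i<n. V $$ (i, j) * f i) = 0})"
  have cl: "closed ?S"
    by (intro closed_Int closed_INT ballI closed_Collect_eq continuous_intros continuous_on_product_coordinates)
  have cS: "compact (?B \<inter> ?S)" by (rule compact_Int_closed[OF compact_function_box cl])
  have inS: "(\<lambda>i. if i < n then y $$ (i, 0) else 0) \<in> ?B \<inter> ?S"
    if y: "y \<in> carrier_mat n 1" "V\<^sup>T * y = 0\<^sub>m k 1" "mfro2 y = 1" for y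
  proof -
    let ?f = "\<lambda>i. if i < n then y $$ (i, 0) else 0"
    have "\<bar>y $$ (i, 0)\<bar> \<le> 1" if "i < n" for i
      using mfro2_entry[of i y 0] that y by (simp add: abs_square_le_1)
    hence "?f \<in> ?B" by (auto simp: abs_le_iff)
    moreover have "?f \<in> ?S"
    proof -
      have "(\<Sum>i<n. (?f i)\<^sup>2) = 1" using \<phi>n[of ?f] \<phi>s[OF y(1)] y(3) by simp
      moreover have "\<forall>j<k. (\<Sum>i<n. V $$ (i, j) * ?f i) = 0" using \<phi>V[of ?f] \<phi>s[OF y(1)] y(2) by simp
      ultimately show ?thesis by auto
    qed
    ultimately show ?thesis by blast
  qed
  obtain x0 where x0: "x0 \<in> carrier_mat n 1" "V\<^sup>T * x0 = 0\<^sub>m k 1" "mfro2 x0 = 1"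
    using exists_unit_orthogonal[OF V] by blast
  define S where "S = ?B \<inter> ?S"
  note cS = cS[folded S_def] and inS = inS[folded S_def]
  have "S \<noteq> {}" using inS[OF x0] by (metis emptyE)
  moreover have "continuous_on S q"
    unfolding q_def
    by (intro continuous_intros continuous_on_subset[OF continuous_on_product_coordinates subset_UNIV])
  ultimately obtain f where f: "f \<in> S" "\<And>g. g \<in> S \<Longrightarrow> q g \<le> q f"
    using continuous_attains_sup[OF cS] by metis
  have "(\<Sum>i<n. (f i)\<^sup>2) = 1" "\<forall>j<k. (\<Sum>i<n. V $$ (i, j) * f i) = 0"
    using f(1) unfolding S_def by auto
  hence x: "\<phi> f \<in> carrier_mat n 1" "V\<^sup>T * \<phi> f = 0\<^sub>m k 1" "mfro2 (\<phi> f) = 1"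
    unfolding \<phi>n \<phi>V using \<phi>d[of f] by (auto intro: carrier_matI)
  have "mtr (y\<^sup>T * (A * y)) \<le> q f * mfro2 y"
    if y: "y \<in> carrier_mat n 1" "V\<^sup>T * y = 0\<^sub>m k 1" for y
  proof (cases "mfro2 y = 0")
    case True
    hence "y = 0\<^sub>m n 1" using mfro2_eq_0[of y] y by auto
    thus ?thesis using True d by simp
  next
    case False
    hence py: "mfro2 y > 0" using mfro2_nonneg[of y] by linarith
    define z where "z = (1 / mfro y) \<cdot>\<^sub>m y"
    have dy: "dim_row y = n" "dim_col y = 1" using y by auto
    have "mfro2 z = (1 / mfro y)\<^sup>2 * mfro2 y"
      unfolding z_def mfro2_def by (simp add: power_mult_distrib power_divide sum_distrib_left sum_divide_distrib)
    hence z1: "mfro2 z = 1" using py by (simp add: power_divide mfro_sq)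
    have z2: "V\<^sup>T * z = 0\<^sub>m k 1"
      unfolding z_def using d dy by (simp add: mat_mult_smult y)
    have z3: "z \<in> carrier_mat n 1" unfolding z_def using dy by auto
    have "q (\<lambda>i. if i < n then z $$ (i, 0) else 0) \<le> q f"
      by (rule f(2)[OF inS[OF z3 z2 z1]])
    hence "mtr (z\<^sup>T * (A * z)) \<le> q f"
      using \<phi>q[of "\<lambda>i. if i < n then z $$ (i, 0) else 0"] by (simp add: \<phi>s[OF z3])
    moreover have "mtr (z\<^sup>T * (A * z)) = (1 / mfro y)\<^sup>2 * mtr (y\<^sup>T * (A * y))"
      unfolding z_def using d dy
      by (simp add: mat_transpose_smult mat_mult_smult mat_smult_mult mtr_smult power2_eq_square)
    ultimately show ?thesis using py by (simp add: power_divide mfro_sq field_simps)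
  qed
  thus ?thesis using x \<phi>q[of f] by auto
qed

text \<open>Moving the maximizer \<open>x\<close> in the direction of the residual \<open>z = \<mu> x - A x\<close> would increase the
  Rayleigh quotient to first order unless \<open>z = 0\<close>.\<close>

lemma rayleigh_max_eigen:
  assumes A: "A \<in> carrier_mat n n" "A\<^sup>T = A"
    and V: "V \<in> carrier_mat n k" "A * V = V * mdiag k l"
    and x: "x \<in> carrier_mat n 1" "V\<^sup>T * x = 0\<^sub>m k 1"
    and x1: "mfro2 x = 1"
    and max: "\<And>y. y \<in> carrier_mat n 1 \<Longrightarrow> V\<^sup>T * y = 0\<^sub>m k 1 \<Longrightarrow>
        mtr (y\<^sup>T * (A * y)) \<le> mtr (x\<^sup>T * (A * x)) * mfro2 y"
  shows "A * x = mtr (x\<^sup>T * (A * x)) \<cdot>\<^sub>m x"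
proof -
  let ?\<mu> = "mtr (x\<^sup>T * (A * x))"
  have d: "dim_row A = n" "dim_col A = n" "dim_row V = n" "dim_col V = k" "dim_row x = n" "dim_col x = 1"
    using A V x by auto
  define z where "z = ?\<mu> \<cdot>\<^sub>m x - A * x"
  have dz: "dim_row z = n" "dim_col z = 1" unfolding z_def using d by auto
  \<comment> \<open>The complement of a span of eigenvectors is invariant under the symmetric A, so
    z is an admissible direction.\<close>
  have "V\<^sup>T * (A * x) = (A * V)\<^sup>T * x"
    using d A(2) by (simp add: mat_alg)
  also have "\<dots> = mdiag k l * (V\<^sup>T * x)"
    unfolding V(2) using d by (simp add: mat_alg transpose_mdiag)
  also have "\<dots> = 0\<^sub>m k 1" by (simp add: x(2))
  finally have VAx: "V\<^sup>T * (A * x) = 0\<^sub>m k 1" .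
  have Vz: "V\<^sup>T * z = 0\<^sub>m k 1"
    unfolding z_def using d by (simp add: mat_distrib mat_mult_smult x(2) VAx)
  define w where "w = mfro2 z"
  define c where "c = ?\<mu> * mfro2 z - mtr (z\<^sup>T * (A * z))"
  have c: "c \<ge> 0" unfolding c_def using max[of z] dz Vz by auto
  \<comment> \<open>Maximality at x - t z, multiplied out: the constant terms cancel because x has
    norm 1, and the linear term is -2 t times the squared length w of z.\<close>
  have key: "0 \<le> - 2 * t * w + t\<^sup>2 * c" for t
  proof -
    let ?y = "x - t \<cdot>\<^sub>m z"
    have "V\<^sup>T * ?y = 0\<^sub>m k 1"
      using d dz by (simp add: mat_distrib mat_mult_smult x(2) Vz)
    hence 1: "mtr (?y\<^sup>T * (A * ?y)) \<le> ?\<mu> * mfro2 ?y"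
      by (intro max carrier_matI) (use d dz in simp_all)
    have zx: "mtr (z\<^sup>T * (A * x)) = mtr (x\<^sup>T * (A * z))"
    proof -
      have "mtr (z\<^sup>T * (A * x)) = mtr ((z\<^sup>T * (A * x))\<^sup>T)"
        using d dz by (subst mtr_transpose) auto
      thus ?thesis using d dz A(2) by (simp add: mat_alg)
    qed
    have zx': "mtr (z\<^sup>T * x) = mtr (x\<^sup>T * z)"
    proof -
      have "mtr (z\<^sup>T * x) = mtr ((z\<^sup>T * x)\<^sup>T)"
        using d dz by (subst mtr_transpose) auto
      thus ?thesis using d dz by (simp add: mat_transpose_mult)
    qed
    have "?y\<^sup>T * (A * ?y) = (x\<^sup>T * (A * x) - t \<cdot>\<^sub>m (z\<^sup>T * (A * x)))
        - t \<cdot>\<^sub>m (x\<^sup>T * (A * z) - t \<cdot>\<^sub>m (z\<^sup>T * (A * z)))"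
      using d dz by (simp add: mat_transpose_minus mat_transpose_smult mat_minus_mult mat_mult_minus mat_mult_smult mat_smult_mult)
    hence 2: "mtr (?y\<^sup>T * (A * ?y)) = ?\<mu> - 2 * t * mtr (z\<^sup>T * (A * x))
        + t\<^sup>2 * mtr (z\<^sup>T * (A * z))"
      using d dz by (simp add: mtr_minus mtr_smult zx power2_eq_square algebra_simps)
    have "?y\<^sup>T * ?y = (x\<^sup>T * x - t \<cdot>\<^sub>m (z\<^sup>T * x))
        - t \<cdot>\<^sub>m (x\<^sup>T * z - t \<cdot>\<^sub>m (z\<^sup>T * z))"
      using d dz by (simp add: mat_transpose_minus mat_transpose_smult mat_minus_mult mat_mult_minus mat_mult_smult mat_smult_mult)
    hence 3: "mfro2 ?y = 1 - 2 * t * mtr (z\<^sup>T * x) + t\<^sup>2 * mfro2 z"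
      using d dz x1 unfolding mfro2_mtr' by (simp add: mtr_minus mtr_smult zx' power2_eq_square algebra_simps)
    have 4: "w = ?\<mu> * mtr (z\<^sup>T * x) - mtr (z\<^sup>T * (A * x))"
    proof -
      have "z\<^sup>T * z = ?\<mu> \<cdot>\<^sub>m (z\<^sup>T * x) - z\<^sup>T * (A * x)"
        using d dz by (subst (2) z_def) (simp add: mat_mult_minus mat_mult_smult)
      thus ?thesis unfolding w_def mfro2_mtr' using d dz by (simp add: mtr_minus mtr_smult)
    qed
    have "?\<mu> - 2 * t * mtr (z\<^sup>T * (A * x)) + t\<^sup>2 * mtr (z\<^sup>T * (A * z))
       \<le> ?\<mu> * (1 - 2 * t * mtr (z\<^sup>T * x) + t\<^sup>2 * mfro2 z)"
      using 1 unfolding 2 3 .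
    thus ?thesis unfolding 4 c_def by (simp add: algebra_simps)
  qed
  have "w = 0"
  proof (rule ccontr)
    assume "w \<noteq> 0"
    hence w: "w > 0" unfolding w_def using mfro2_nonneg[of z] by linarith
    \<comment> \<open>A step so short that the linear term outweighs the quadratic one.\<close>
    define u where "u = w / (c + 1)"
    have u: "u > 0" "w = u * (c + 1)" using c w unfolding u_def by auto
    have "0 \<le> - 2 * u * w + u\<^sup>2 * c" by (rule key)
    also have "\<dots> = - (u\<^sup>2 * (c + 2))" unfolding u(2) by (simp add: power2_eq_square algebra_simps)
    also have "\<dots> < 0" using c u(1) by simp
    finally show False by simp
  qed
  hence "z = 0\<^sub>m n 1" using mfro2_eq_0[of z] dz unfolding w_def by auto
  hence e: "\<And>i. i < n \<Longrightarrow> z $$ (i, 0) = 0" by auto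
  show ?thesis
  proof (rule eq_matI)
    fix i j assume "i < dim_row (?\<mu> \<cdot>\<^sub>m x)" "j < dim_col (?\<mu> \<cdot>\<^sub>m x)"
    hence "i < n" "j = 0" using d by auto
    thus "(A * x) $$ (i, j) = (?\<mu> \<cdot>\<^sub>m x) $$ (i, j)"
      using e[of i] d unfolding z_def by (auto simp del: index_mult_mat(1))
  qed (use d in auto)
qed

definition append_col :: "real mat \<Rightarrow> real mat \<Rightarrow> real mat" where
  "append_col V x = Matrix.mat (dim_row V) (Suc (dim_col V))
     (\<lambda>(i, j). if j < dim_col V then V $$ (i, j) else x $$ (i, 0))"

lemma append_col_dim [simp]: "dim_row (append_col V x) = dim_row V" "dim_col (append_col V x) = Suc (dim_col V)"
  unfolding append_col_def by simp_all

lemma mult_append_col: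
  assumes "dim_col A = dim_row V" "dim_row x = dim_row V" "dim_col x = 1"
  shows "A * append_col V x = append_col (A * V) (A * x)"
proof (intro eq_matI)
  fix i j assume "i < dim_row (append_col (A * V) (A * x))" "j < dim_col (append_col (A * V) (A * x))"
  hence "i < dim_row A" "j < Suc (dim_col V)" by auto
  thus "(A * append_col V x) $$ (i, j) = append_col (A * V) (A * x) $$ (i, j)"
    using assms by (auto simp: mult_mat_entry append_col_def simp del: index_mult_mat(1) intro!: sum.cong)
qed auto

text \<open>Eigenvectors are added one at a time, each a maximizer on the complement of the earlier
  ones. The last conjunct bounds the Rayleigh quotient on the remaining complement by every
  eigenvalue found so far, which keeps \<open>l\<close> decreasing when the next one is
  appended.\<close>

lemma spectral_aux:
  assumes A: "A \<in> carrier_mat n n" "A\<^sup>T = A"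
  shows "k \<le> n \<Longrightarrow> \<exists>V l. V \<in> carrier_mat n k \<and> orthocols V \<and> A * V = V * mdiag k l \<and>
     (\<forall>i j. i \<le> j \<longrightarrow> j < k \<longrightarrow> l j \<le> l i) \<and>
     (\<forall>y\<in>carrier_mat n 1. V\<^sup>T * y = 0\<^sub>m k 1 \<longrightarrow>
        (\<forall>i<k. mtr (y\<^sup>T * (A * y)) \<le> l i * mfro2 y))"
proof (induction k)
  case 0
  have "orthocols (0\<^sub>m n 0)" unfolding orthocols_def by (intro eq_matI) auto
  moreover have "A * 0\<^sub>m n 0 = 0\<^sub>m n 0 * mdiag 0 (\<lambda>_. 0)" using A by (intro eq_matI) auto
  ultimately show ?case by (intro exI[of _ "0\<^sub>m n 0"] exI[of _ "\<lambda>_. 0"]) auto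
next
  case (Suc k)
  then obtain V l where V: "V \<in> carrier_mat n k" "orthocols V" "A * V = V * mdiag k l"
    and l: "\<And>i j. i \<le> j \<Longrightarrow> j < k \<Longrightarrow> l j \<le> l i"
    and m: "\<And>y i. y \<in> carrier_mat n 1 \<Longrightarrow> V\<^sup>T * y = 0\<^sub>m k 1 \<Longrightarrow> i < k \<Longrightarrow>
       mtr (y\<^sup>T * (A * y)) \<le> l i * mfro2 y"
    by auto
  obtain x where x: "x \<in> carrier_mat n 1" "V\<^sup>T * x = 0\<^sub>m k 1" "mfro2 x = 1"
    and mx: "\<And>y. y \<in> carrier_mat n 1 \<Longrightarrow> V\<^sup>T * y = 0\<^sub>m k 1 \<Longrightarrow>
        mtr (y\<^sup>T * (A * y)) \<le> mtr (x\<^sup>T * (A * x)) * mfro2 y"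
    using rayleigh_max[OF A(1) V(1,2)] Suc.prems by auto
  have d: "dim_row A = n" "dim_col A = n" "dim_row V = n" "dim_col V = k" "dim_row x = n" "dim_col x = 1"
    using A V x by auto
  define \<mu> where "\<mu> = mtr (x\<^sup>T * (A * x))"
  have Ax: "A * x = \<mu> \<cdot>\<^sub>m x"
    unfolding \<mu>_def by (rule rayleigh_max_eigen[OF A V(1,3) x(1,2,3) mx])
  define W where "W = append_col V x"
  define l' where "l' = l(k := \<mu>)"
  have dW: "dim_row W = n" "dim_col W = Suc k" unfolding W_def using d by auto
  have WT: "W\<^sup>T * y = 0\<^sub>m (Suc k) 1 \<Longrightarrow> V\<^sup>T * y = 0\<^sub>m k 1"
    if "dim_row y = n" "dim_col y = 1" for y
  proof -
    assume a: "W\<^sup>T * y = 0\<^sub>m (Suc k) 1"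
    show "V\<^sup>T * y = 0\<^sub>m k 1"
    proof (rule eq_matI)
      fix i j assume "i < dim_row (0\<^sub>m k 1 :: real mat)" "j < dim_col (0\<^sub>m k 1 :: real mat)"
      hence ij: "i < k" "j = 0" by auto
      have "(V\<^sup>T * y) $$ (i, j) = (W\<^sup>T * y) $$ (i, j)"
        using ij d dW that by (auto simp: mult_mat_entry W_def append_col_def simp del: index_mult_mat(1) intro!: sum.cong)
      thus "(V\<^sup>T * y) $$ (i, j) = 0\<^sub>m k 1 $$ (i, j)" unfolding a using ij by simp
    qed (use d that in auto)
  qed
  have "A * W = W * mdiag (Suc k) l'"
  proof (rule eq_matI)
    fix i j assume "i < dim_row (W * mdiag (Suc k) l')" "j < dim_col (W * mdiag (Suc k) l')"
    hence ij: "i < n" "j < Suc k" using dW by auto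
    have "(A * W) $$ (i, j) = append_col (V * mdiag k l) (\<mu> \<cdot>\<^sub>m x) $$ (i, j)"
      unfolding W_def using d by (subst mult_append_col) (auto simp: V(3) Ax)
    also have "\<dots> = (W * mdiag (Suc k) l') $$ (i, j)"
      using ij d dW by (subst mult_mdiag_entry)
        (auto simp: W_def append_col_def l'_def mult_mdiag_entry simp del: index_mult_mat(1))
    finally show "(A * W) $$ (i, j) = (W * mdiag (Suc k) l') $$ (i, j)" .
  qed (use d dW in auto)
  moreover have "orthocols W"
    unfolding orthocols_def
  proof (rule eq_matI)
    fix i j assume "i < dim_row (1\<^sub>m (dim_col W) :: real mat)" "j < dim_col (1\<^sub>m (dim_col W) :: real mat)"
    hence ij: "i < Suc k" "j < Suc k" using dW by auto
    have e: "(W\<^sup>T * W) $$ (i, j) = (\<Sum>a<n. W $$ (a, i) * W $$ (a, j))"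
      using ij dW by (auto simp: mult_mat_entry simp del: index_mult_mat(1))
    have Vx: "(\<Sum>a<n. V $$ (a, i) * x $$ (a, 0)) = 0" if "i < k" for i
    proof -
      have "(V\<^sup>T * x) $$ (i, 0) = (\<Sum>a<n. V $$ (a, i) * x $$ (a, 0))"
        using that d by (subst mult_mat_entry) auto
      thus ?thesis unfolding x(2) using that by simp
    qed
    have VV: "(\<Sum>a<n. V $$ (a, i) * V $$ (a, j)) = (if i = j then 1 else 0)" if "i < k" "j < k"
    proof -
      have "(V\<^sup>T * V) $$ (i, j) = (\<Sum>a<n. V $$ (a, i) * V $$ (a, j))"
        using that d by (subst mult_mat_entry) auto
      thus ?thesis using V(2) d that unfolding orthocols_def by simp
    qed
    have xx: "(\<Sum>a<n. x $$ (a, 0) * x $$ (a, 0)) = 1"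
      using x(3) d unfolding mfro2_def by (simp add: power2_eq_square)
    have vx: "(\<Sum>a<n. x $$ (a, 0) * V $$ (a, j)) = 0" if "j < k"
      using Vx[OF that] by (simp add: mult.commute)
    consider "i < k" "j < k" | "i < k" "j = k" | "i = k" "j < k" | "i = k" "j = k" using ij by linarith
    thus "(W\<^sup>T * W) $$ (i, j) = 1\<^sub>m (dim_col W) $$ (i, j)"
      unfolding e using ij dW
      by cases (use VV Vx xx vx d in \<open>simp_all add: W_def append_col_def\<close>)
  qed (use dW in auto)
  moreover have "\<forall>i j. i \<le> j \<longrightarrow> j < Suc k \<longrightarrow> l' j \<le> l' i"
  proof (intro allI impI)
    fix i j :: nat assume ij: "i \<le> j" "j < Suc k"
    have "\<mu> \<le> l i" if "i < k" using m[OF x(1,2) that] x(3) unfolding \<mu>_def by simp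
    thus "l' j \<le> l' i" using ij l[of i j] unfolding l'_def by (cases "j = k"; cases "i = k") auto
  qed
  moreover have "\<forall>y\<in>carrier_mat n 1. W\<^sup>T * y = 0\<^sub>m (Suc k) 1 \<longrightarrow>
        (\<forall>i<Suc k. mtr (y\<^sup>T * (A * y)) \<le> l' i * mfro2 y)"
  proof (intro ballI impI allI)
    fix y i assume y: "y \<in> carrier_mat n 1" "W\<^sup>T * y = 0\<^sub>m (Suc k) 1" "i < Suc k"
    have "V\<^sup>T * y = 0\<^sub>m k 1" using WT y by auto
    thus "mtr (y\<^sup>T * (A * y)) \<le> l' i * mfro2 y"
      using m[OF y(1), of i] mx[OF y(1)] y(3) unfolding l'_def \<mu>_def by (cases "i = k") auto
  qed
  ultimately show ?case using dW by (intro exI[of _ W] exI[of _ l']) auto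
qed

theorem spectral_theorem:
  assumes "A \<in> carrier_mat n n" "A\<^sup>T = A"
  obtains V l where "V \<in> carrier_mat n n" "orthocols V" "A * V = V * mdiag n l"
    "\<And>i j. i \<le> j \<Longrightarrow> j < n \<Longrightarrow> l j \<le> l i"
  using spectral_aux[OF assms, of n] by auto

section \<open>Pseudoinverse and its regularization\<close>

lemma smult_smult_mat: "a \<cdot>\<^sub>m (b \<cdot>\<^sub>m A) = (a * b) \<cdot>\<^sub>m (A :: 'a :: semigroup_mult mat)"
  by (intro eq_matI) (auto simp: mult.assoc)

lemma smult_one_mat: "1 \<cdot>\<^sub>m A = (A :: 'a :: monoid_mult mat)"
  by (intro eq_matI) auto

lemma mdiag_one: "(\<And>i. i < n \<Longrightarrow> f i = 1) \<Longrightarrow> mdiag n f = 1\<^sub>m n"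
  unfolding mdiag_def by (intro eq_matI) auto

lemma mtr_mdiag: "mtr (mdiag n f) = (\<Sum>i<n. f i)"
  unfolding mtr_def by (simp add: mdiag_def)

text \<open>A singular value decomposition without left singular vectors: the columns of
  \<open>C * V\<close> are orthogonal with squared lengths \<open>l\<close>. Zero eigenvalues are
  kept, so the rank need not be known.\<close>

lemma gram_spectral:
  fixes C :: "real mat"
  obtains V l where "V \<in> carrier_mat (dim_col C) (dim_col C)" "orthocols V"
    "C\<^sup>T * C * V = V * mdiag (dim_col C) l"
    "(C * V)\<^sup>T * (C * V) = mdiag (dim_col C) l"
    "\<And>i. i < dim_col C \<Longrightarrow> 0 \<le> l i" "\<And>i j. i \<le> j \<Longrightarrow> j < dim_col C \<Longrightarrow> l j \<le> l i"
    "\<And>j. j < dim_col C \<Longrightarrow> (\<Sum>i<dim_row C. ((C * V) $$ (i, j))\<^sup>2) = l j"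
proof -
  let ?n = "dim_col C"
  have "C\<^sup>T * C \<in> carrier_mat ?n ?n" "(C\<^sup>T * C)\<^sup>T = C\<^sup>T * C"
    by (auto simp: mat_alg)
  from spectral_theorem[OF this] obtain V l where V: "V \<in> carrier_mat ?n ?n" "orthocols V"
    "C\<^sup>T * C * V = V * mdiag ?n l" "\<And>i j. i \<le> j \<Longrightarrow> j < ?n \<Longrightarrow> l j \<le> l i" by blast
  have d: "dim_row V = ?n" "dim_col V = ?n" using V(1) by auto
  have "(C * V)\<^sup>T * (C * V) = V\<^sup>T * (C\<^sup>T * C * V)"
    using d by (simp add: mat_alg)
  also have "\<dots> = (V\<^sup>T * V) * mdiag ?n l" unfolding V(3) using d by (simp add: mat_alg)
  also have "\<dots> = mdiag ?n l" using V(2) d unfolding orthocols_def by (simp add: mat_alg)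
  finally have E: "(C * V)\<^sup>T * (C * V) = mdiag ?n l" .
  have s: "(\<Sum>i<dim_row C. ((C * V) $$ (i, j))\<^sup>2) = l j" if "j < ?n" for j
  proof -
    have "((C * V)\<^sup>T * (C * V)) $$ (j, j) = (\<Sum>i<dim_row C. ((C * V) $$ (i, j))\<^sup>2)"
      using that d by (subst mult_mat_entry) (auto simp: power2_eq_square simp del: index_mult_mat(1))
    thus ?thesis unfolding E using that by (simp add: mdiag_def)
  qed
  have "0 \<le> l i" if "i < ?n" for i unfolding s[OF that, symmetric] by (intro sum_nonneg) auto
  thus ?thesis by (intro that[OF V(1-3) E _ V(4) s])
qed

lemma firstcols_gram:
  assumes "E\<^sup>T * E = mdiag n l" "dim_col E = n" "q \<le> n"
  shows "(firstcols E q)\<^sup>T * firstcols E q = mdiag q l"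
proof (intro eq_matI)
  fix i j assume "i < dim_row (mdiag q l)" "j < dim_col (mdiag q l)"
  hence ij: "i < q" "j < q" by auto
  have "((firstcols E q)\<^sup>T * firstcols E q) $$ (i, j) = (E\<^sup>T * E) $$ (i, j)"
  proof -
    have "((firstcols E q)\<^sup>T * firstcols E q) $$ (i, j) = (\<Sum>k<dim_row E. E $$ (k, i) * E $$ (k, j))"
      using ij assms(2,3) by (subst mult_mat_entry) (auto simp: firstcols_entry)
    also have "\<dots> = (E\<^sup>T * E) $$ (i, j)"
      using ij assms(2,3) by (subst mult_mat_entry) auto
    finally show ?thesis .
  qed
  also have "\<dots> = mdiag q l $$ (i, j)" unfolding assms(1) using ij assms by (simp add: mdiag_def)
  finally show "((firstcols E q)\<^sup>T * firstcols E q) $$ (i, j) = mdiag q l $$ (i, j)" .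
qed auto

text \<open>Keep the columns of \<open>C * V\<close> of positive length and normalize them.
  \<open>R'\<close> is the pseudoinverse of \<open>R\<close>: besides \<open>R * R' = 1\<close> the
  symmetry of \<open>R' * R\<close> is recorded, for use in the Penrose equations.\<close>

lemma orthonormal_factorization:
  fixes C :: "real mat"
  obtains q Q R R' where "q \<le> dim_col C" "Q \<in> carrier_mat (dim_row C) q" "orthocols Q"
    "R \<in> carrier_mat q (dim_col C)" "R' \<in> carrier_mat (dim_col C) q"
    "C = Q * R" "R * R' = 1\<^sub>m q" "(R' * R)\<^sup>T = R' * R"
proof -
  let ?n = "dim_col C"
  obtain V l where V: "V \<in> carrier_mat ?n ?n" "orthocols V"
    "(C * V)\<^sup>T * (C * V) = mdiag ?n l"
    and l: "\<And>i. i < ?n \<Longrightarrow> 0 \<le> l i" "\<And>i j. i \<le> j \<Longrightarrow> j < ?n \<Longrightarrow> l j \<le> l i"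
    and s: "\<And>j. j < ?n \<Longrightarrow> (\<Sum>i<dim_row C. ((C * V) $$ (i, j))\<^sup>2) = l j"
    by (rule gram_spectral[of C]) blast
  have d: "dim_row V = ?n" "dim_col V = ?n" using V(1) by auto
  \<comment> \<open>Since \<open>l\<close> decreases, this counts the positive eigenvalues;
    \<open>q = ?n\<close> covers full column rank, as nothing is known about \<open>l\<close> from
    \<open>?n\<close> on.\<close>
  define q where "q = (LEAST q. q = ?n \<or> l q \<le> 0)"
  have qn: "q \<le> ?n" unfolding q_def by (rule Least_le) simp
  have q1: "l j > 0" if "j < q" for j using not_less_Least[OF that[unfolded q_def]] by auto
  have "q = ?n \<or> l q \<le> 0" unfolding q_def by (rule LeastI[of _ ?n]) simp
  hence q2: "l j = 0" if "q \<le> j" "j < ?n" for j using l(2)[OF that] l(1)[OF that(2)] that by auto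
  define E where "E = C * V"
  have dE: "dim_row E = dim_row C" "dim_col E = ?n" unfolding E_def using d by auto
  have E0: "E $$ (i, j) = 0" if "q \<le> j" "j < ?n" "i < dim_row C" for i j
  proof -
    have "(\<Sum>i<dim_row C. (E $$ (i, j))\<^sup>2) = 0" using s[OF that(2)] q2[OF that(1,2)] unfolding E_def by simp
    thus ?thesis using that by (subst (asm) sum_nonneg_eq_0_iff) auto
  qed
  define V1 where "V1 = firstcols V q"
  define E1 where "E1 = firstcols E q"
  have d1: "dim_row V1 = ?n" "dim_col V1 = q" "dim_row E1 = dim_row C" "dim_col E1 = q"
    unfolding V1_def E1_def using d dE by auto
  have V1o: "V1\<^sup>T * V1 = 1\<^sub>m q"
    using orthocols_firstcols[OF V(2), of q] qn d d1 unfolding orthocols_def V1_def by simp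
  have "C = C * (V * V\<^sup>T)" using orthocols_square[OF V(2,1)] by (simp add: mat_alg)
  also have "\<dots> = E * V\<^sup>T" unfolding E_def using d by (simp add: mat_alg)
  also have "\<dots> = E1 * V1\<^sup>T"
  proof (intro eq_matI)
    fix i j assume "i < dim_row (E1 * V1\<^sup>T)" "j < dim_col (E1 * V1\<^sup>T)"
    hence ij: "i < dim_row C" "j < ?n" using d1 by auto
    have "(E * V\<^sup>T) $$ (i, j) = (\<Sum>k<?n. E $$ (i, k) * V $$ (j, k))"
      using ij d dE by (subst mult_mat_entry) auto
    also have "\<dots> = (\<Sum>k<q. E $$ (i, k) * V $$ (j, k))"
      using ij qn E0 by (intro sum.mono_neutral_right) auto
    also have "\<dots> = (E1 * V1\<^sup>T) $$ (i, j)"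
      using ij d dE d1 qn by (subst mult_mat_entry) (auto simp: E1_def V1_def firstcols_entry)
    finally show "(E * V\<^sup>T) $$ (i, j) = (E1 * V1\<^sup>T) $$ (i, j)" .
  qed (use d dE d1 in auto)
  finally have C: "C = E1 * V1\<^sup>T" .
  have E1E1: "E1\<^sup>T * E1 = mdiag q l"
    unfolding E1_def by (rule firstcols_gram[OF V(3)[folded E_def] dE(2) qn])
  let ?Dm = "mdiag q (\<lambda>i. 1 / sqrt (l i))" and ?Dp = "mdiag q (\<lambda>i. sqrt (l i))"
  have D1: "?Dm * ?Dp = 1\<^sub>m q" "?Dp * ?Dm = 1\<^sub>m q"
    unfolding mdiag_mult by (rule mdiag_one, use q1 in force)+
  have D2: "?Dm * (mdiag q l * ?Dm) = 1\<^sub>m q"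
    unfolding mdiag_mult by (rule mdiag_one) (use q1 in \<open>force simp: field_simps\<close>)
  define Q where "Q = E1 * ?Dm"
  define R where "R = ?Dp * V1\<^sup>T"
  define R' where "R' = V1 * ?Dm"
  show ?thesis
  proof (rule that[of q Q R R'])
    show "q \<le> ?n" by fact
    show "Q \<in> carrier_mat (dim_row C) q" "R \<in> carrier_mat q ?n" "R' \<in> carrier_mat ?n q"
      unfolding Q_def R_def R'_def using d1 by (auto intro!: carrier_matI)
    have "Q\<^sup>T * Q = ?Dm * ((E1\<^sup>T * E1) * ?Dm)"
      unfolding Q_def using d1 by (simp add: mat_alg transpose_mdiag)
    thus "orthocols Q" unfolding orthocols_def E1E1 D2 using d1 by (simp add: Q_def)
    have "Q * R = E1 * ((?Dm * ?Dp) * V1\<^sup>T)"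
      unfolding Q_def R_def using d1 by (simp add: mat_alg)
    thus "C = Q * R" unfolding D1 C using d1 by (simp add: mat_alg)
    have "R * R' = ?Dp * ((V1\<^sup>T * V1) * ?Dm)"
      unfolding R_def R'_def using d1 by (simp add: mat_alg)
    thus "R * R' = 1\<^sub>m q" unfolding V1o using D1(2) by (simp add: mat_alg)
    have "R' * R = V1 * ((?Dm * ?Dp) * V1\<^sup>T)"
      unfolding R_def R'_def using d1 by (simp add: mat_alg)
    hence "R' * R = V1 * V1\<^sup>T" unfolding D1 using d1 by (simp add: mat_alg)
    thus "(R' * R)\<^sup>T = R' * R" using d1 by (simp add: mat_alg)
  qed
qed

lemma is_pinv_unique:
  assumes "is_pinv A B" "is_pinv A C"
  shows "B = C"
proof -
  note a = assms[unfolded is_pinv_def]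
  have d: "dim_row B = dim_col A" "dim_col B = dim_row A" "dim_row C = dim_col A" "dim_col C = dim_row A"
    using a by auto
  have AB: "A * B = A * C"
  proof -
    have "A * B = (A * B)\<^sup>T" using a by simp
    also have "\<dots> = ((A * C) * (A * B))\<^sup>T" using a d by (simp add: mat_assoc[symmetric])
    also have "\<dots> = (A * B)\<^sup>T * (A * C)\<^sup>T" using d by (intro mat_transpose_mult) auto
    also have "\<dots> = (A * B) * (A * C)" using a by simp
    also have "\<dots> = A * C" using a d by (simp add: mat_assoc[symmetric])
    finally show ?thesis .
  qed
  have BA: "B * A = C * A"
  proof -
    have "B * A = (B * A)\<^sup>T" using a by simp
    also have "\<dots> = ((B * A) * (C * A))\<^sup>T" using a d by (simp add: mat_assoc)
    also have "\<dots> = (C * A)\<^sup>T * (B * A)\<^sup>T" using d by (intro mat_transpose_mult) auto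
    also have "\<dots> = (C * A) * (B * A)" using a by simp
    also have "\<dots> = C * (A * B * A)" using d by (simp add: mat_assoc)
    also have "\<dots> = C * A" using a by simp
    finally show ?thesis .
  qed
  have "B = B * (A * B)" using a d by (simp add: mat_assoc)
  also have "\<dots> = (B * A) * C" unfolding AB using d by (simp add: mat_assoc)
  also have "\<dots> = C" unfolding BA using a by simp
  finally show ?thesis .
qed

lemma pinv_eqI: "is_pinv A B \<Longrightarrow> pinv A = B"
  unfolding pinv_def by (intro the_equality) (auto intro: is_pinv_unique)

text \<open>Existence for any rank, from A = Q R: the matrix R' Q^T satisfies the four Penrose
  equations. Together with uniqueness this gives the description by \<open>THE\<close> a
  meaning.\<close>

lemma is_pinv_pinv: "is_pinv A (pinv A)"
proof -
  obtain q Q R R' where *: "q \<le> dim_col A" "Q \<in> carrier_mat (dim_row A) q" "orthocols Q"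
    "R \<in> carrier_mat q (dim_col A)" "R' \<in> carrier_mat (dim_col A) q"
    "A = Q * R" "R * R' = 1\<^sub>m q" "(R' * R)\<^sup>T = R' * R"
    by (rule orthonormal_factorization)
  have d: "dim_row Q = dim_row A" "dim_col Q = q" "dim_row R = q" "dim_col R = dim_col A"
    "dim_row R' = dim_col A" "dim_col R' = q" using *(2,4,5) by auto
  have QQ: "Q\<^sup>T * Q = 1\<^sub>m q" using *(3) d unfolding orthocols_def by simp
  let ?B = "R' * Q\<^sup>T"
  have "A * ?B = Q * ((R * R') * Q\<^sup>T)" by (subst *(6)) (use d in \<open>simp add: mat_assoc\<close>)
  hence AB: "A * ?B = Q * Q\<^sup>T" unfolding *(7) using d by (simp add: mat_alg)
  have "?B * A = R' * ((Q\<^sup>T * Q) * R)" by (subst *(6)) (use d in \<open>simp add: mat_assoc\<close>)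
  hence BA: "?B * A = R' * R" unfolding QQ using d by (simp add: mat_alg)
  have "A * ?B * A = Q * ((Q\<^sup>T * Q) * R)" unfolding AB by (subst *(6)) (use d in \<open>simp add: mat_assoc\<close>)
  hence 1: "A * ?B * A = A" unfolding QQ using d *(6)[symmetric] by (simp add: mat_alg)
  have "?B * A * ?B = R' * ((R * R') * Q\<^sup>T)" unfolding BA using d by (simp add: mat_assoc)
  hence 2: "?B * A * ?B = ?B" unfolding *(7) using d by (simp add: mat_alg)
  have "is_pinv A ?B"
    unfolding is_pinv_def 1 2 unfolding AB BA *(8) using d by (auto simp: mat_transpose_mult)
  thus ?thesis using pinv_eqI by metis
qed

lemma pinv_dim [simp]: "dim_row (pinv A) = dim_col A" "dim_col (pinv A) = dim_row A"
  using is_pinv_pinv[of A] unfolding is_pinv_def by auto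

text \<open>The reverse order law fails for general products. Here G has a left inverse, and
  \<open>R'\<close> is a right inverse of \<open>R\<close> with \<open>R' * R\<close> symmetric, so
  the inner factors cancel in the Penrose equations.\<close>

lemma pinv_mult_right_invertible:
  assumes "dim_col G = dim_row R" "dim_row R' = dim_col R" "dim_col R' = dim_row R"
    and "pinv G * G = 1\<^sub>m (dim_col G)" "R * R' = 1\<^sub>m (dim_row R)" "(R' * R)\<^sup>T = R' * R"
  shows "pinv (G * R) = R' * pinv G"
proof (rule pinv_eqI)
  have p: "(G * pinv G)\<^sup>T = G * pinv G" using is_pinv_pinv[of G] unfolding is_pinv_def by simp
  note d = assms(1-3)
  have "(G * R) * (R' * pinv G) = G * ((R * R') * pinv G)" using d by (simp add: mat_assoc)
  hence 1: "(G * R) * (R' * pinv G) = G * pinv G" unfolding assms(5) using d by (simp add: mat_alg)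
  have "(R' * pinv G) * (G * R) = R' * ((pinv G * G) * R)" using d by (simp add: mat_assoc)
  hence 2: "(R' * pinv G) * (G * R) = R' * R" unfolding assms(4) using d by (simp add: mat_alg)
  have "G * pinv G * (G * R) = G * ((pinv G * G) * R)" using d by (simp add: mat_assoc)
  hence 3: "G * pinv G * (G * R) = G * R" unfolding assms(4) using d by (simp add: mat_alg)
  have "R' * R * (R' * pinv G) = R' * ((R * R') * pinv G)" using d by (simp add: mat_assoc)
  hence 4: "R' * R * (R' * pinv G) = R' * pinv G" unfolding assms(5) using d by (simp add: mat_alg)
  show "is_pinv (G * R) (R' * pinv G)"
    unfolding is_pinv_def 1 2 unfolding 3 4 using d p assms(6) by (auto intro: carrier_matI)
qed

text \<open>\<open>reg_inv e Z * Z\<^sup>T\<close> is rational in the entries of \<open>Z\<close>, bounded for fixed \<open>e > 0\<close>, and tends to the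
  pseudoinverse of \<open>Z\<close> for \<open>e \<rightarrow> 0\<close>, at every \<open>Z\<close>.\<close>

definition reg_gram :: "real \<Rightarrow> real mat \<Rightarrow> real mat" where
  "reg_gram e Z = Z\<^sup>T * Z + e \<cdot>\<^sub>m 1\<^sub>m (dim_col Z)"

definition reg_inv :: "real \<Rightarrow> real mat \<Rightarrow> real mat" where
  "reg_inv e Z = (1 / det (reg_gram e Z)) \<cdot>\<^sub>m adj_mat (reg_gram e Z)"

lemma reg_gram_carrier: "reg_gram e Z \<in> carrier_mat (dim_col Z) (dim_col Z)"
  unfolding reg_gram_def by (auto intro: carrier_matI)

lemma reg_gram_dim [simp]: "dim_row (reg_gram e Z) = dim_col Z" "dim_col (reg_gram e Z) = dim_col Z"
  unfolding reg_gram_def by auto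

lemma reg_inv_dim [simp]: "dim_row (reg_inv e Z) = dim_col Z" "dim_col (reg_inv e Z) = dim_col Z"
  unfolding reg_inv_def using adj_mat(1)[OF reg_gram_carrier] by auto

text \<open>The premise is \<open>l i + e \<noteq> 0\<close> rather than e > 0, as the formula is
  also applied with e = 0 to detect singular Gram matrices.\<close>

lemma reg_gram_spectral_inverse:
  assumes V: "V \<in> carrier_mat (dim_col Z) (dim_col Z)" "orthocols V"
    "Z\<^sup>T * Z * V = V * mdiag (dim_col Z) l"
    and l: "\<And>i. i < dim_col Z \<Longrightarrow> l i + e \<noteq> 0"
  shows "reg_gram e Z * (V * (mdiag (dim_col Z) (\<lambda>i. 1 / (l i + e)) * V\<^sup>T)) = 1\<^sub>m (dim_col Z)"
proof -
  let ?n = "dim_col Z" and ?D = "mdiag (dim_col Z) (\<lambda>i. 1 / (l i + e))"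
  have d: "dim_row V = ?n" "dim_col V = ?n" using V(1) by auto
  have "reg_gram e Z * V = V * mdiag ?n (\<lambda>i. l i + e)"
  proof -
    have "reg_gram e Z * V = V * mdiag ?n l + e \<cdot>\<^sub>m V"
      unfolding reg_gram_def using d V(3) by (simp add: mat_add_mult mat_smult_mult mat_left_one)
    also have "\<dots> = V * mdiag ?n (\<lambda>i. l i + e)"
      using d by (intro eq_matI) (auto simp: mult_mdiag_entry algebra_simps simp del: index_mult_mat(1))
    finally show ?thesis .
  qed
  hence "reg_gram e Z * (V * (?D * V\<^sup>T)) = V * ((mdiag ?n (\<lambda>i. l i + e) * ?D) * V\<^sup>T)"
    using d by (simp add: mat_assoc[symmetric])
  also have "mdiag ?n (\<lambda>i. l i + e) * ?D = 1\<^sub>m ?n"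
    unfolding mdiag_mult by (rule mdiag_one) (use l in auto)
  finally show ?thesis using d orthocols_square[OF V(2,1)] by (simp add: mat_alg)
qed

lemma det_reg_gram: "0 < e \<Longrightarrow> det (reg_gram e Z) \<noteq> 0"
proof -
  assume e: "0 < e"
  obtain V l where V: "V \<in> carrier_mat (dim_col Z) (dim_col Z)" "orthocols V"
    "Z\<^sup>T * Z * V = V * mdiag (dim_col Z) l"
    and l: "\<And>i. i < dim_col Z \<Longrightarrow> 0 \<le> l i"
    by (rule gram_spectral[of Z]) blast
  let ?K = "V * (mdiag (dim_col Z) (\<lambda>i. 1 / (l i + e)) * V\<^sup>T)"
  have "reg_gram e Z * ?K = 1\<^sub>m (dim_col Z)"
    by (rule reg_gram_spectral_inverse[OF V]) (use l e in force)
  moreover have "?K \<in> carrier_mat (dim_col Z) (dim_col Z)" using V by (auto intro: carrier_matI)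
  ultimately have "det (reg_gram e Z) * det ?K = 1"
    using det_mult[OF reg_gram_carrier] by (metis det_one)
  thus ?thesis by auto
qed

lemma reg_inv:
  assumes "0 < e"
  shows "reg_gram e Z * reg_inv e Z = 1\<^sub>m (dim_col Z)" "reg_inv e Z * reg_gram e Z = 1\<^sub>m (dim_col Z)"
  using det_reg_gram[OF assms, of Z] adj_mat[OF reg_gram_carrier, of e Z] unfolding reg_inv_def
  by (simp_all add: mat_mult_smult mat_smult_mult smult_smult_mat smult_one_mat)

lemma transpose_reg_gram: "(reg_gram e Z)\<^sup>T = reg_gram e Z"
  unfolding reg_gram_def by (simp add: mat_alg)

lemma reg_inv_unique:
  assumes "0 < e" "reg_gram e Z * K = 1\<^sub>m (dim_col Z)" "K \<in> carrier_mat (dim_col Z) (dim_col Z)"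
  shows "K = reg_inv e Z"
proof -
  have "K = (reg_inv e Z * reg_gram e Z) * K" using reg_inv(2)[OF assms(1), of Z] assms(3) by (simp add: mat_left_one)
  also have "\<dots> = reg_inv e Z" using assms by (simp add: mat_assoc mat_right_one)
  finally show ?thesis .
qed

lemma transpose_reg_inv: "0 < e \<Longrightarrow> (reg_inv e Z)\<^sup>T = reg_inv e Z"
proof (rule reg_inv_unique)
  assume e: "0 < e"
  have "reg_gram e Z * (reg_inv e Z)\<^sup>T = (reg_inv e Z * reg_gram e Z)\<^sup>T"
    by (simp add: mat_transpose_mult transpose_reg_gram)
  thus "reg_gram e Z * (reg_inv e Z)\<^sup>T = 1\<^sub>m (dim_col Z)" using reg_inv(2)[OF e] by simp
qed (auto intro: carrier_matI)

text \<open>Multiply the definition of \<open>reg_gram\<close> by the inverse. The norm and entry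
  estimates below rest on this identity.\<close>

lemma reg_inv_gram:
  assumes "0 < e"
  shows "reg_inv e Z * (Z\<^sup>T * Z) = 1\<^sub>m (dim_col Z) - e \<cdot>\<^sub>m reg_inv e Z"
proof -
  have "1\<^sub>m (dim_col Z) = reg_inv e Z * (Z\<^sup>T * Z) + e \<cdot>\<^sub>m reg_inv e Z"
    unfolding reg_inv(2)[OF assms, symmetric]
    by (simp add: reg_gram_def mat_mult_add mat_mult_smult mat_right_one)
  thus ?thesis by (intro eq_matI) (auto simp: mat_eq_iff simp del: index_mult_mat(1))
qed

lemma mtr_reg_inv_gram:
  assumes "0 < e"
  shows "mtr (reg_inv e Z * (Z\<^sup>T * Z)) = real (dim_col Z) - e * mtr (reg_inv e Z)"
  unfolding reg_inv_gram[OF assms] by (simp add: mtr_minus mtr_one mtr_smult)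

lemma mfro2_reg_pinv:
  assumes "0 < e"
  shows "mfro2 (reg_inv e Z * Z\<^sup>T) = mtr (reg_inv e Z) - e * mfro2 (reg_inv e Z)"
proof -
  have "mfro2 (reg_inv e Z * Z\<^sup>T) = mtr ((reg_inv e Z * (Z\<^sup>T * Z)) * reg_inv e Z)"
    unfolding mfro2_mtr using assms by (simp add: mat_alg transpose_reg_inv)
  also have "(reg_inv e Z * (Z\<^sup>T * Z)) * reg_inv e Z = reg_inv e Z - e \<cdot>\<^sub>m (reg_inv e Z * (reg_inv e Z)\<^sup>T)"
    unfolding reg_inv_gram[OF assms] transpose_reg_inv[OF assms] by (simp add: mat_minus_mult mat_alg)
  also have "mtr \<dots> = mtr (reg_inv e Z) - e * mfro2 (reg_inv e Z)"
    unfolding mfro2_mtr by (simp add: mtr_minus mtr_smult)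
  finally show ?thesis .
qed

text \<open>With K the regularized inverse, K - e K^2 equals (K Z^T)(K Z^T)^T, and a Gram matrix has
  a nonnegative diagonal.\<close>

lemma reg_inv_diag:
  assumes "0 < e" "i < dim_col Z"
  shows "e * (\<Sum>j<dim_col Z. (reg_inv e Z $$ (i, j))\<^sup>2) \<le> reg_inv e Z $$ (i, i)"
proof -
  let ?K = "reg_inv e Z"
  let ?A = "?K * Z\<^sup>T"
  have "?A * ?A\<^sup>T = (?K * (Z\<^sup>T * Z)) * ?K"
    using assms by (simp add: mat_alg transpose_reg_inv)
  also have "\<dots> = ?K - e \<cdot>\<^sub>m (?K * ?K\<^sup>T)"
    unfolding reg_inv_gram[OF assms(1)] transpose_reg_inv[OF assms(1)] by (simp add: mat_minus_mult mat_alg)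
  finally have "(?A * ?A\<^sup>T) $$ (i, i) = (?K - e \<cdot>\<^sub>m (?K * ?K\<^sup>T)) $$ (i, i)" by simp
  moreover have "(?A * ?A\<^sup>T) $$ (i, i) = (\<Sum>j<dim_row Z. (?A $$ (i, j))\<^sup>2)"
    using assms by (subst mult_mat_entry) (auto simp: power2_eq_square simp del: index_mult_mat(1))
  moreover have "(?K * ?K\<^sup>T) $$ (i, i) = (\<Sum>j<dim_col Z. (?K $$ (i, j))\<^sup>2)"
    using assms by (subst mult_mat_entry) (auto simp: power2_eq_square simp del: index_mult_mat(1))
  ultimately have "?K $$ (i, i) - e * (\<Sum>j<dim_col Z. (?K $$ (i, j))\<^sup>2) = (\<Sum>j<dim_row Z. (?A $$ (i, j))\<^sup>2)"
    using assms(2) by (simp del: index_mult_mat(1))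
  also have "\<dots> \<ge> 0" by (intro sum_nonneg) auto
  finally show ?thesis by simp
qed

text \<open>\<open>reg_inv_diag\<close> gives e K_ij^2 \<le> K_ii. For j = i this forces K_ii \<le>
  1 / e, and then the general case follows. The bound does not depend on Z, which makes K harmless
  in growth and continuity arguments.\<close>

lemma reg_inv_bound:
  assumes "0 < e" "i < dim_col Z" "j < dim_col Z"
  shows "\<bar>reg_inv e Z $$ (i, j)\<bar> \<le> 1 / e"
proof -
  let ?K = "reg_inv e Z"
  have s: "(?K $$ (i, j))\<^sup>2 \<le> (\<Sum>j<dim_col Z. (?K $$ (i, j))\<^sup>2)" if "j < dim_col Z" for j
    using that by (intro member_le_sum) auto
  have le: "e * (?K $$ (i, j))\<^sup>2 \<le> ?K $$ (i, i)" if "j < dim_col Z" for j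
    using reg_inv_diag[OF assms(1,2)] s[OF that] assms(1) by (meson mult_left_mono less_imp_le order_trans)
  have d: "?K $$ (i, i) \<le> 1 / e"
  proof (rule ccontr)
    assume "\<not> ?K $$ (i, i) \<le> 1 / e"
    hence g: "?K $$ (i, i) > 1 / e" by simp
    have "0 < ?K $$ (i, i)" using g assms(1) by (smt (verit) divide_pos_pos)
    moreover have "1 < e * ?K $$ (i, i)" using g assms(1) by (simp add: field_simps)
    ultimately have "1 * ?K $$ (i, i) < (e * ?K $$ (i, i)) * ?K $$ (i, i)" by (intro mult_strict_right_mono)
    thus False using le[OF assms(2)] by (simp add: power2_eq_square mult.assoc)
  qed
  have "(?K $$ (i, j))\<^sup>2 \<le> (1 / e)\<^sup>2"
    using order_trans[OF le[OF assms(3)] d] assms(1) by (simp add: field_simps power2_eq_square)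
  thus ?thesis using assms(1) by (intro power2_le_imp_le[of "\<bar>?K $$ (i, j)\<bar>"]) auto
qed

lemma mtr_reg_inv_nonneg:
  assumes "0 < e" shows "0 \<le> mtr (reg_inv e Z)"
proof -
  have "0 \<le> reg_inv e Z $$ (i, i)" if "i < dim_col Z" for i
  proof -
    have "0 \<le> e * (\<Sum>j<dim_col Z. (reg_inv e Z $$ (i, j))\<^sup>2)"
      using assms by (intro mult_nonneg_nonneg sum_nonneg) auto
    thus ?thesis using reg_inv_diag[OF assms that] by linarith
  qed
  thus ?thesis unfolding mtr_def by (intro sum_nonneg) auto
qed

lemma mfro2_reg_pinv_le:
  "0 < e \<Longrightarrow> mfro2 (reg_inv e Z * Z\<^sup>T) \<le> mtr (reg_inv e Z)"
  by (simp add: mfro2_reg_pinv)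

text \<open>A singular Gram matrix has the eigenvalue 0, which alone contributes 1 / e to the trace,
  and the other contributions are nonnegative. In this form a bound on the expected trace becomes a
  bound on the probability of singularity.\<close>

lemma mtr_reg_inv_singular:
  assumes "det (Z\<^sup>T * Z) = 0" "0 < e"
  shows "1 / e \<le> mtr (reg_inv e Z)"
proof -
  let ?n = "dim_col Z"
  obtain V l where V: "V \<in> carrier_mat ?n ?n" "orthocols V"
    "Z\<^sup>T * Z * V = V * mdiag ?n l"
    and l: "\<And>i. i < ?n \<Longrightarrow> 0 \<le> l i"
    by (rule gram_spectral[of Z]) blast
  have d: "dim_row V = ?n" "dim_col V = ?n" using V(1) by auto
  have g0: "reg_gram 0 Z = Z\<^sup>T * Z" unfolding reg_gram_def by (intro eq_matI) auto
  \<comment> \<open>Otherwise the spectral formula at e = 0 would invert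
    \<open>Z\<^sup>T * Z\<close>.\<close>
  obtain i where i: "i < ?n" "l i = 0"
  proof (rule ccontr)
    assume "\<not> thesis"
    hence "l i + 0 \<noteq> 0" if "i < ?n" for i using that \<open>\<And>i. \<lbrakk>i < ?n; l i = 0\<rbrakk> \<Longrightarrow> thesis\<close> by auto
    hence "reg_gram 0 Z * (V * (mdiag ?n (\<lambda>i. 1 / (l i + 0)) * V\<^sup>T)) = 1\<^sub>m ?n"
      by (rule reg_gram_spectral_inverse[OF V])
    moreover have "V * (mdiag ?n (\<lambda>i. 1 / (l i + 0)) * V\<^sup>T) \<in> carrier_mat ?n ?n"
      using d by (intro carrier_matI) auto
    ultimately have "det (reg_gram 0 Z) * det (V * (mdiag ?n (\<lambda>i. 1 / (l i + 0)) * V\<^sup>T)) = 1"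
      using det_mult[OF reg_gram_carrier] by (metis det_one)
    thus False using assms(1) g0 by auto
  qed
  have "V * (mdiag ?n (\<lambda>i. 1 / (l i + e)) * V\<^sup>T) = reg_inv e Z"
    by (rule reg_inv_unique[OF assms(2) reg_gram_spectral_inverse[OF V]])
      (use l assms(2) d in \<open>force intro: carrier_matI\<close>)+
  hence "mtr (reg_inv e Z) = mtr (V * (mdiag ?n (\<lambda>i. 1 / (l i + e)) * V\<^sup>T))" by simp
  also have "\<dots> = mtr (mdiag ?n (\<lambda>i. 1 / (l i + e)) * (V\<^sup>T * V))"
    using d by (subst mtr_comm) (auto simp: mat_assoc)
  also have "\<dots> = (\<Sum>i<?n. 1 / (l i + e))"
    using V(2) d unfolding orthocols_def by (simp add: mat_right_one mtr_mdiag)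
  also have "\<dots> \<ge> 1 / (l i + e)"
    using i(1) l assms(2) by (intro member_le_sum[of i "{..<?n}" "\<lambda>i. 1 / (l i + e)"]) (auto simp: add_nonneg_nonneg)
  finally show ?thesis using i(2) by simp
qed

text \<open>Multiply \<open>Z * pinv Z * Z = Z\<close> from the left by \<open>Z\<^sup>T\<close> and
  then by the inverse of \<open>Z\<^sup>T * Z\<close>.\<close>

lemma pinv_full_rank:
  assumes "det (Z\<^sup>T * Z) \<noteq> 0"
  shows "pinv Z * Z = 1\<^sub>m (dim_col Z)"
proof -
  let ?n = "dim_col Z" and ?N = "Z\<^sup>T * Z"
  have N: "?N \<in> carrier_mat ?n ?n" by (auto intro: carrier_matI)
  define K where "K = (1 / det ?N) \<cdot>\<^sub>m adj_mat ?N"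
  have dK: "dim_row K = ?n" "dim_col K = ?n" unfolding K_def using adj_mat(1)[OF N] by auto
  have KN: "K * ?N = 1\<^sub>m ?n"
    unfolding K_def using adj_mat[OF N] assms by (simp add: mat_smult_mult smult_smult_mat smult_one_mat)
  have p: "Z * pinv Z * Z = Z" using is_pinv_pinv[of Z] unfolding is_pinv_def by simp
  have "pinv Z * Z = (K * ?N) * (pinv Z * Z)" unfolding KN by (simp add: mat_left_one)
  also have "\<dots> = K * (Z\<^sup>T * (Z * pinv Z * Z))" using dK by (simp add: mat_assoc)
  also have "\<dots> = 1\<^sub>m ?n" unfolding p by (rule KN)
  finally show ?thesis .
qed

text \<open>The Penrose equations put the pseudoinverse B in the form Z^T Z W. Applying
  \<open>reg_inv_gram\<close> twice gives K Z^T = B - e (W - e K W), and e K stays bounded, so the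
  error is of order e even where Z is rank deficient.\<close>

lemma reg_pinv_tendsto:
  assumes "i < dim_col Z" "j < dim_row Z"
  shows "((\<lambda>e. (reg_inv e Z * Z\<^sup>T) $$ (i, j)) \<longlongrightarrow> pinv Z $$ (i, j)) (at_right 0)"
proof -
  let ?B = "pinv Z" and ?n = "dim_col Z"
  note p = is_pinv_pinv[of Z, unfolded is_pinv_def]
  define W where "W = ?B * (?B\<^sup>T * ?B)"
  have dW: "dim_row W = ?n" "dim_col W = dim_row Z" unfolding W_def by auto
  have ZT: "Z\<^sup>T = Z\<^sup>T * Z * ?B"
  proof -
    have "Z\<^sup>T = (Z * ?B * Z)\<^sup>T" using p by simp
    also have "\<dots> = Z\<^sup>T * (Z * ?B)\<^sup>T" by (rule mat_transpose_mult) simp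
    also have "\<dots> = Z\<^sup>T * Z * ?B" using p by (simp add: mat_assoc)
    finally show ?thesis .
  qed
  have B: "?B = Z\<^sup>T * Z * W"
  proof -
    have "?B = (?B * Z) * ?B" using p by simp
    also have "\<dots> = (?B * Z)\<^sup>T * ?B" using p by simp
    also have "\<dots> = Z\<^sup>T * (?B\<^sup>T * ?B)" by (simp add: mat_transpose_mult mat_assoc)
    also have "\<dots> = Z\<^sup>T * Z * ?B * (?B\<^sup>T * ?B)" using ZT by simp
    also have "\<dots> = Z\<^sup>T * Z * W" unfolding W_def by (simp add: mat_assoc)
    finally show ?thesis .
  qed
  define C where "C = (\<Sum>k<?n. \<bar>W $$ (k, j)\<bar>)"
  have "\<bar>(reg_inv e Z * Z\<^sup>T) $$ (i, j) - ?B $$ (i, j)\<bar> \<le> e * (\<bar>W $$ (i, j)\<bar> + C)" if e: "0 < e" for e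
  proof -
    let ?K = "reg_inv e Z"
    have KB: "?K * ?B = W - e \<cdot>\<^sub>m (?K * W)"
    proof -
      have "?K * ?B = (?K * (Z\<^sup>T * Z)) * W" by (subst B) (use dW in \<open>simp add: mat_assoc\<close>)
      thus ?thesis unfolding reg_inv_gram[OF e] using dW by (simp add: mat_minus_mult mat_alg)
    qed
    have "?K * Z\<^sup>T = (?K * (Z\<^sup>T * Z)) * ?B"
      by (subst ZT) (simp add: mat_assoc)
    also have "\<dots> = ?B - e \<cdot>\<^sub>m (?K * ?B)"
      unfolding reg_inv_gram[OF e] by (simp add: mat_minus_mult mat_alg)
    finally have "(?K * Z\<^sup>T) $$ (i, j) = ?B $$ (i, j) - e * (W $$ (i, j) - e * (?K * W) $$ (i, j))"
      unfolding KB using assms dW by (simp del: index_mult_mat(1))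
    moreover have "\<bar>e * (?K * W) $$ (i, j)\<bar> \<le> C"
    proof -
      have "\<bar>e * (?K * W) $$ (i, j)\<bar> = \<bar>\<Sum>k<?n. e * ?K $$ (i, k) * W $$ (k, j)\<bar>"
        using assms dW by (subst mult_mat_entry) (auto simp: sum_distrib_left mult.assoc)
      also have "\<dots> \<le> (\<Sum>k<?n. \<bar>e * ?K $$ (i, k) * W $$ (k, j)\<bar>)" by (rule sum_abs)
      also have "\<dots> \<le> (\<Sum>k<?n. 1 * \<bar>W $$ (k, j)\<bar>)"
        unfolding abs_mult
        using reg_inv_bound[OF e assms(1)] e
        by (intro sum_mono mult_right_mono) (auto simp: field_simps abs_mult)
      finally show ?thesis unfolding C_def by simp
    qed
    ultimately have "\<bar>(?K * Z\<^sup>T) $$ (i, j) - ?B $$ (i, j)\<bar> = e * \<bar>W $$ (i, j) - e * (?K * W) $$ (i, j)\<bar>"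
      using e by (simp add: abs_mult)
    also have "\<dots> \<le> e * (\<bar>W $$ (i, j)\<bar> + C)"
      using \<open>\<bar>e * (?K * W) $$ (i, j)\<bar> \<le> C\<close> e by (intro mult_left_mono) auto
    finally show ?thesis .
  qed
  hence "eventually (\<lambda>e. norm ((reg_inv e Z * Z\<^sup>T) $$ (i, j) - ?B $$ (i, j)) \<le> e * (\<bar>W $$ (i, j)\<bar> + C)) (at_right 0)"
    unfolding real_norm_def eventually_at_right_field by (intro exI[of _ 1]) auto
  moreover have "((\<lambda>e. e * (\<bar>W $$ (i, j)\<bar> + C)) \<longlongrightarrow> 0) (at_right 0)"
    by (auto intro!: tendsto_eq_intros)
  ultimately have "((\<lambda>e. (reg_inv e Z * Z\<^sup>T) $$ (i, j) - ?B $$ (i, j)) \<longlongrightarrow> 0) (at_right 0)"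
    by (rule Lim_null_comparison)
  thus ?thesis by (simp add: LIM_zero_iff)
qed

section \<open>Gaussian integration by parts\<close>

definition std_gauss :: "real measure" where
  "std_gauss = density lborel (\<lambda>x. ennreal (std_normal_density x))"

lemma sets_std_gauss [measurable_cong, simp]: "sets std_gauss = sets borel"
  unfolding std_gauss_def by simp

lemma space_std_gauss [simp]: "space std_gauss = UNIV"
  unfolding std_gauss_def by simp

lemma prob_space_std_gauss: "prob_space std_gauss"
  unfolding std_gauss_def by (rule prob_space_normal_density) simp

lemma integrable_std_gauss_iff:
  "f \<in> borel_measurable borel \<Longrightarrow> integrable std_gauss f \<longleftrightarrow> integrable lborel (\<lambda>x. std_normal_density x * f x)"
  for f :: "real \<Rightarrow> real"
  unfolding std_gauss_def by (subst integrable_density) auto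

lemma integral_std_gauss:
  "f \<in> borel_measurable borel \<Longrightarrow> integral\<^sup>L std_gauss f = (\<integral>x. std_normal_density x * f x \<partial>lborel)"
  for f :: "real \<Rightarrow> real"
  unfolding std_gauss_def by (subst integral_density) auto

lemma integrable_std_gauss_poly: "integrable std_gauss (\<lambda>x. (1 + \<bar>x\<bar>) ^ k)"
proof (subst integrable_std_gauss_iff)
  have "integrable lborel (\<lambda>x. 2 ^ k * (std_normal_density x * \<bar>x\<bar> ^ 0) + 2 ^ k * (std_normal_density x * \<bar>x\<bar> ^ k))"
    by (intro Bochner_Integration.integrable_add integrable_mult_right integrable_std_normal_moment_abs)
  thus "integrable lborel (\<lambda>x. std_normal_density x * (1 + \<bar>x\<bar>) ^ k)"
  proof (rule Bochner_Integration.integrable_bound)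
    show "AE x in lborel. norm (std_normal_density x * (1 + \<bar>x\<bar>) ^ k) \<le>
        norm (2 ^ k * (std_normal_density x * \<bar>x\<bar> ^ 0) + 2 ^ k * (std_normal_density x * \<bar>x\<bar> ^ k))"
    proof (rule AE_I2)
      fix x :: real
      have "(1 + \<bar>x\<bar>) ^ k \<le> 2 ^ k * (1 + \<bar>x\<bar> ^ k)"
      proof (cases "\<bar>x\<bar> \<le> 1")
        case True
        have "(1 + \<bar>x\<bar>) ^ k \<le> 2 ^ k" using True by (intro power_mono) auto
        also have "\<dots> \<le> 2 ^ k * (1 + \<bar>x\<bar> ^ k)" by (simp add: algebra_simps)
        finally show ?thesis .
      next
        case False
        have "(1 + \<bar>x\<bar>) ^ k \<le> (2 * \<bar>x\<bar>) ^ k" using False by (intro power_mono) auto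
        also have "\<dots> \<le> 2 ^ k * (1 + \<bar>x\<bar> ^ k)" by (simp add: power_mult_distrib algebra_simps)
        finally show ?thesis .
      qed
      hence "std_normal_density x * (1 + \<bar>x\<bar>) ^ k \<le> std_normal_density x * (2 ^ k * (1 + \<bar>x\<bar> ^ k))"
        by (intro mult_left_mono) auto
      thus "norm (std_normal_density x * (1 + \<bar>x\<bar>) ^ k) \<le>
        norm (2 ^ k * (std_normal_density x * \<bar>x\<bar> ^ 0) + 2 ^ k * (std_normal_density x * \<bar>x\<bar> ^ k))"
        by (simp add: abs_mult algebra_simps)
    qed
  qed simp
qed simp

lemma std_normal_density_poly_tendsto:
  "(\<lambda>n. std_normal_density (real n) * (1 + real n) ^ k) \<longlonglongrightarrow> 0"
proof (rule tendsto_sandwich[of "\<lambda>_. 0" _ _ "\<lambda>n. exp (3 / 2) * ((1 + real n) ^ k / exp (1 + real n))"])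
  have "filterlim (\<lambda>n. 1 + real n) at_top sequentially"
    by (intro filterlim_tendsto_add_at_top[OF tendsto_const] filterlim_real_sequentially)
  hence "(\<lambda>n. (1 + real n) ^ k / exp (1 + real n)) \<longlonglongrightarrow> 0"
    by (rule filterlim_compose[OF tendsto_power_div_exp_0])
  thus "(\<lambda>n. exp (3 / 2) * ((1 + real n) ^ k / exp (1 + real n))) \<longlonglongrightarrow> 0"
    by (rule tendsto_mult_right_zero)
  have "std_normal_density x * (1 + x) ^ k \<le> exp (3 / 2) * ((1 + x) ^ k / exp (1 + x))" if "0 \<le> x" for x :: real
  proof -
    have "1 \<le> sqrt (2 * pi)" using pi_gt3 by (intro real_le_rsqrt) auto
    hence "1 / sqrt (2 * pi) \<le> 1" by simp
    hence "std_normal_density x \<le> 1 * exp (- x\<^sup>2 / 2)"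
      unfolding std_normal_density_def by (intro mult_right_mono) auto
    \<comment> \<open>Completing the square replaces the Gaussian decay by an exponential one in 1 +
      x, to which the limit of powers over exponentials applies.\<close>
    also have "- x\<^sup>2 / 2 = 3 / 2 - (1 + x) - (x - 1)\<^sup>2 / 2" by (simp add: power2_eq_square field_simps)
    also have "1 * exp (3 / 2 - (1 + x) - (x - 1)\<^sup>2 / 2) \<le> exp (3 / 2 - (1 + x))" by simp
    also have "\<dots> = exp (3 / 2) / exp (1 + x)" by (rule exp_diff)
    finally have "std_normal_density x * (1 + x) ^ k \<le> exp (3 / 2) / exp (1 + x) * (1 + x) ^ k"
      using that by (intro mult_right_mono) auto
    thus ?thesis by simp
  qed
  thus "\<forall>\<^sub>F n in sequentially. std_normal_density (real n) * (1 + real n) ^ k \<le>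
      exp (3 / 2) * ((1 + real n) ^ k / exp (1 + real n))" by simp
qed auto

lemma std_normal_density_deriv:
  "(std_normal_density has_real_derivative - (x * std_normal_density x)) (at x)"
  unfolding std_normal_density_def[abs_def]
  by (auto intro!: derivative_eq_intros simp: field_simps)

text \<open>The density times f has as derivative the density times f' - x f. Its integral over
  [-n, n] is a difference of boundary values, which tend to 0 by polynomial growth; dominated
  convergence gives the integral over the line.\<close>

lemma gauss_integral_by_parts:
  fixes f f' :: "real \<Rightarrow> real"
  assumes der: "\<And>x. (f has_real_derivative f' x) (at x)"
    and [measurable]: "f' \<in> borel_measurable borel"
    and fb: "\<And>x. \<bar>f x\<bar> \<le> C * (1 + \<bar>x\<bar>) ^ k" and fb': "\<And>x. \<bar>f' x\<bar> \<le> C * (1 + \<bar>x\<bar>) ^ k"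
  shows "(\<integral>x. x * f x \<partial>std_gauss) = (\<integral>x. f' x \<partial>std_gauss)"
proof -
  let ?\<phi> = std_normal_density
  have "continuous_on UNIV f"
    by (rule DERIV_continuous_on[of _ _ f']) (use der in \<open>auto intro: has_field_derivative_at_within\<close>)
  hence fm [measurable]: "f \<in> borel_measurable borel" by (rule borel_measurable_continuous_onI)
  have C: "0 \<le> C" using fb[of 0] by auto
  have int': "integrable std_gauss f'"
    by (rule Bochner_Integration.integrable_bound[OF integrable_mult_right[OF integrable_std_gauss_poly[of k], of C]])
      (use fb' C in \<open>auto simp: abs_mult\<close>)
  have intx: "integrable std_gauss (\<lambda>x. x * f x)"
  proof (rule Bochner_Integration.integrable_bound[OF integrable_mult_right[OF integrable_std_gauss_poly[of "Suc k"], of C]])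
    have "\<bar>x * f x\<bar> \<le> C * (1 + \<bar>x\<bar>) ^ Suc k" for x
    proof -
      have "\<bar>x * f x\<bar> \<le> (1 + \<bar>x\<bar>) * (C * (1 + \<bar>x\<bar>) ^ k)"
        unfolding abs_mult by (intro mult_mono fb) auto
      thus ?thesis by (simp add: mult_ac)
    qed
    thus "AE x in std_gauss. norm (x * f x) \<le> norm (C * (1 + \<bar>x\<bar>) ^ Suc k)"
      using C by (auto simp: abs_mult)
  qed simp
  define h where "h = (\<lambda>x. ?\<phi> x * f x)"
  define h' where "h' = (\<lambda>x. ?\<phi> x * f' x - ?\<phi> x * (x * f x))"
  have [measurable]: "h' \<in> borel_measurable borel" unfolding h'_def by simp
  have hd: "(h has_real_derivative h' x) (at x)" for x
    unfolding h_def h'_def by (auto intro!: derivative_eq_intros der std_normal_density_deriv simp: algebra_simps)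
  have inth: "integrable lborel h'"
    unfolding h'_def using int' intx by (intro Bochner_Integration.integrable_diff) (simp_all add: integrable_std_gauss_iff)
  have "(\<lambda>n. \<integral>x. indicator {- real n..real n} x * h' x \<partial>lborel) \<longlonglongrightarrow> (\<integral>x. h' x \<partial>lborel)"
  proof (rule integral_dominated_convergence[where w = "\<lambda>x. \<bar>h' x\<bar>"])
    show "AE x in lborel. (\<lambda>n. indicator {- real n..real n} x * h' x) \<longlonglongrightarrow> h' x"
    proof (rule AE_I2)
      fix x :: real
      have "eventually (\<lambda>n. indicator {- real n..real n} x * h' x = h' x) sequentially"
        using eventually_ge_at_top[of "nat \<lceil>\<bar>x\<bar>\<rceil>"]
      proof eventually_elim
        case (elim n)
        hence "\<bar>x\<bar> \<le> real n" using real_nat_ceiling_ge[of "\<bar>x\<bar>"] by linarith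
        thus ?case by (simp add: indicator_def abs_le_iff)
      qed
      thus "(\<lambda>n. indicator {- real n..real n} x * h' x) \<longlonglongrightarrow> h' x" by (rule tendsto_eventually)
    qed
    show "AE x in lborel. norm (indicator {- real n..real n} x * h' x) \<le> \<bar>h' x\<bar>" for n
      by (rule AE_I2) (auto simp: indicator_def)
  qed (use inth in auto)
  moreover have "(\<integral>x. indicator {- real n..real n} x * h' x \<partial>lborel) = h (real n) - h (- real n)" for n
  proof -
    have "(h' has_integral (h (real n) - h (- real n))) {- real n..real n}"
      by (rule fundamental_theorem_of_calculus)
        (use hd in \<open>auto simp: has_real_derivative_iff_has_vector_derivative[symmetric] intro: has_field_derivative_at_within\<close>)
    hence "integral {- real n..real n} h' = h (real n) - h (- real n)" by (rule integral_unique)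
    moreover have "set_integrable lborel {- real n..real n} h'"
      unfolding set_integrable_def by (rule integrable_mult_indicator[OF _ inth]) simp
    ultimately show ?thesis using set_borel_integral_eq_integral(2)[of "{- real n..real n}" h']
      unfolding set_lebesgue_integral_def by simp
  qed
  ultimately have "(\<lambda>n. h (real n) - h (- real n)) \<longlonglongrightarrow> (\<integral>x. h' x \<partial>lborel)" by simp
  moreover have "(\<lambda>n. h (real n) - h (- real n)) \<longlonglongrightarrow> 0"
  proof (rule Lim_null_comparison)
    show "(\<lambda>n. 2 * C * (?\<phi> (real n) * (1 + real n) ^ k)) \<longlonglongrightarrow> 0"
      by (rule tendsto_mult_right_zero[OF std_normal_density_poly_tendsto])
    have hx: "\<bar>h x\<bar> \<le> C * (?\<phi> \<bar>x\<bar> * (1 + \<bar>x\<bar>) ^ k)" for x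
    proof -
      have "\<bar>h x\<bar> \<le> ?\<phi> \<bar>x\<bar> * (C * (1 + \<bar>x\<bar>) ^ k)"
        unfolding h_def abs_mult using fb[of x] by (intro mult_mono) (auto simp: std_normal_density_def)
      thus ?thesis by (simp add: mult_ac)
    qed
    have "\<bar>h (real n) - h (- real n)\<bar> \<le> 2 * C * (?\<phi> (real n) * (1 + real n) ^ k)" for n
      using hx[of "real n"] hx[of "- real n"] by (simp only: abs_minus_cancel abs_of_nat)
    thus "\<forall>\<^sub>F n in sequentially. norm (h (real n) - h (- real n)) \<le> 2 * C * (?\<phi> (real n) * (1 + real n) ^ k)"
      by simp
  qed
  ultimately have "(\<integral>x. h' x \<partial>lborel) = 0" using LIMSEQ_unique by blast
  moreover have "(\<integral>x. h' x \<partial>lborel) = (\<integral>x. f' x \<partial>std_gauss) - (\<integral>x. x * f x \<partial>std_gauss)"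
    unfolding h'_def using int' intx
    by (subst Bochner_Integration.integral_diff) (simp_all add: integrable_std_gauss_iff integral_std_gauss)
  ultimately show ?thesis by simp
qed

section \<open>Product Gaussian measures and integration by parts in one coordinate\<close>

definition gauss :: "'i set \<Rightarrow> ('i \<Rightarrow> real) measure" where
  "gauss I = PiM I (\<lambda>_. std_gauss)"

lemma sets_gauss: "sets (gauss I) = sets (PiM I (\<lambda>_. borel))"
  unfolding gauss_def by (rule sets_PiM_cong) auto

lemma measurable_gauss: "borel_measurable (gauss I) = borel_measurable (PiM I (\<lambda>_. borel))"
  by (rule measurable_cong_sets[OF sets_gauss refl])

lemma product_prob_space_std_gauss: "product_prob_space (\<lambda>_. std_gauss)"
proof -
  interpret prob_space std_gauss by (rule prob_space_std_gauss)
  show ?thesis by unfold_locales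
qed

lemma prob_space_gauss: "prob_space (gauss I)"
  unfolding gauss_def by (rule prob_space_PiM) (rule prob_space_std_gauss)

text \<open>A product of one-variable weights rather than a norm: it factors when a coordinate is
  split off, and its powers are integrable by Fubini.\<close>

definition wt :: "'i set \<Rightarrow> ('i \<Rightarrow> real) \<Rightarrow> real" where
  "wt I x = (\<Prod>i\<in>I. (1 + \<bar>x i\<bar>))"

text \<open>The growth bound is demanded at every function, also at those that are not extensional,
  so that it applies to the update \<open>x(i := s)\<close> of any \<open>x\<close>.\<close>

definition poly_bounded :: "'i set \<Rightarrow> (('i \<Rightarrow> real) \<Rightarrow> real) \<Rightarrow> bool" where
  "poly_bounded I F \<longleftrightarrow> F \<in> borel_measurable (PiM I (\<lambda>_. borel)) \<and>
     (\<exists>C k. 0 \<le> C \<and> (\<forall>x. \<bar>F x\<bar> \<le> C * wt I x ^ k))"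

lemma wt_ge_1: "1 \<le> wt I x"
  unfolding wt_def by (rule prod_ge_1) auto

lemma poly_bounded_const: "poly_bounded I (\<lambda>_. c)"
  unfolding poly_bounded_def by (intro conjI exI[of _ "\<bar>c\<bar>"] exI[of _ 0]) auto

lemma poly_bounded_coord:
  assumes "finite I" "i \<in> I" shows "poly_bounded I (\<lambda>x. x i)"
proof -
  have "\<bar>x i\<bar> \<le> 1 * wt I x ^ 1" for x :: "'a \<Rightarrow> real"
  proof -
    have "\<bar>x i\<bar> \<le> (1 + \<bar>x i\<bar>) * 1" by simp
    also have "\<dots> \<le> (1 + \<bar>x i\<bar>) * wt (I - {i}) x" by (intro mult_left_mono wt_ge_1) auto
    also have "\<dots> = wt I x" unfolding wt_def using assms by (simp add: prod.remove)
    finally show ?thesis by simp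
  qed
  thus ?thesis unfolding poly_bounded_def using assms zero_le_one by (intro conjI) (simp, blast)
qed

lemma poly_bounded_add:
  assumes "poly_bounded I F" "poly_bounded I G" shows "poly_bounded I (\<lambda>x. F x + G x)"
proof -
  obtain C k D l where C: "0 \<le> C" "\<And>x. \<bar>F x\<bar> \<le> C * wt I x ^ k" and D: "0 \<le> D" "\<And>x. \<bar>G x\<bar> \<le> D * wt I x ^ l"
    using assms unfolding poly_bounded_def by blast
  have "\<bar>F x + G x\<bar> \<le> (C + D) * wt I x ^ (k + l)" for x
  proof -
    have "wt I x ^ k \<le> wt I x ^ (k + l)" "wt I x ^ l \<le> wt I x ^ (k + l)"
      by (rule power_increasing, use wt_ge_1 in auto)+
    hence "C * wt I x ^ k + D * wt I x ^ l \<le> C * wt I x ^ (k + l) + D * wt I x ^ (k + l)"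
      using C(1) D(1) by (intro add_mono mult_left_mono) auto
    thus ?thesis using C(2)[of x] D(2)[of x] by (simp add: algebra_simps)
  qed
  moreover have "0 \<le> C + D" using C D by simp
  moreover have "(\<lambda>x. F x + G x) \<in> borel_measurable (PiM I (\<lambda>_. borel))"
    using assms unfolding poly_bounded_def by (intro borel_measurable_add) auto
  ultimately show ?thesis unfolding poly_bounded_def by blast
qed

lemma poly_bounded_mult:
  assumes "poly_bounded I F" "poly_bounded I G" shows "poly_bounded I (\<lambda>x. F x * G x)"
proof -
  obtain C k D l where C: "0 \<le> C" "\<And>x. \<bar>F x\<bar> \<le> C * wt I x ^ k" and D: "0 \<le> D" "\<And>x. \<bar>G x\<bar> \<le> D * wt I x ^ l"
    using assms unfolding poly_bounded_def by blast
  have "\<bar>F x * G x\<bar> \<le> (C * D) * wt I x ^ (k + l)" for x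
  proof -
    have "\<bar>F x\<bar> * \<bar>G x\<bar> \<le> (C * wt I x ^ k) * (D * wt I x ^ l)"
      using C D by (intro mult_mono) (auto intro: order_trans[OF abs_ge_zero])
    thus ?thesis by (simp add: abs_mult power_add mult_ac)
  qed
  moreover have "0 \<le> C * D" using C D by simp
  moreover have "(\<lambda>x. F x * G x) \<in> borel_measurable (PiM I (\<lambda>_. borel))"
    using assms unfolding poly_bounded_def by (intro borel_measurable_times) auto
  ultimately show ?thesis unfolding poly_bounded_def by blast
qed

lemma poly_bounded_sum:
  assumes "\<And>a. a \<in> A \<Longrightarrow> poly_bounded I (F a)" shows "poly_bounded I (\<lambda>x. \<Sum>a\<in>A. F a x)"
  using assms
  by (induction A rule: infinite_finite_induct) (auto intro: poly_bounded_const poly_bounded_add)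

lemma poly_bounded_uminus: "poly_bounded I F \<Longrightarrow> poly_bounded I (\<lambda>x. - F x)"
  using poly_bounded_mult[OF poly_bounded_const[of I "-1"]] by fastforce

lemma poly_bounded_bounded:
  assumes "F \<in> borel_measurable (PiM I (\<lambda>_. borel))" "\<And>x. \<bar>F x\<bar> \<le> C"
  shows "poly_bounded I F"
  unfolding poly_bounded_def using assms order_trans[OF abs_ge_zero assms(2)]
  by (intro conjI exI[of _ C] exI[of _ 0]) auto

lemma poly_bounded_integrable:
  assumes "finite I" "poly_bounded I F" shows "integrable (gauss I) F"
proof -
  obtain C k where C: "0 \<le> C" "\<And>x. \<bar>F x\<bar> \<le> C * wt I x ^ k" and m: "F \<in> borel_measurable (gauss I)"
    using assms unfolding poly_bounded_def measurable_gauss by blast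
  interpret product_prob_space "\<lambda>_. std_gauss" by (rule product_prob_space_std_gauss)
  have "integrable (gauss I) (\<lambda>x. \<Prod>i\<in>I. (1 + \<bar>x i\<bar>) ^ k)"
    unfolding gauss_def by (rule product_integrable_prod[OF assms(1) integrable_std_gauss_poly])
  hence "integrable (gauss I) (\<lambda>x. C * wt I x ^ k)"
    unfolding wt_def prod_power_distrib by (rule integrable_mult_right)
  thus ?thesis
    by (rule Bochner_Integration.integrable_bound[OF _ m]) (use C in \<open>auto intro!: AE_I2 order_trans[OF _ abs_ge_self]\<close>)
qed

text \<open>Fubini isolates the coordinate i. With the other coordinates frozen their weight is a
  constant, and the one-dimensional formula applies.\<close>

lemma gauss_integral_by_parts_coord:
  assumes I: "finite I" "i \<in> I" and F: "poly_bounded I F" and F': "poly_bounded I F'"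
    and der: "\<And>x t. ((\<lambda>s. F (x(i := s))) has_real_derivative F' (x(i := t))) (at t)"
  shows "(\<integral>x. x i * F x \<partial>gauss I) = (\<integral>x. F' x \<partial>gauss I)"
proof -
  interpret product_prob_space "\<lambda>_. std_gauss" by (rule product_prob_space_std_gauss)
  define J where "J = I - {i}"
  have J: "finite J" "i \<notin> J" "I = insert i J" using I unfolding J_def by auto
  obtain C k where C: "0 \<le> C" "\<And>x. \<bar>F x\<bar> \<le> C * wt I x ^ k"
    using F unfolding poly_bounded_def by blast
  obtain D l where D: "0 \<le> D" "\<And>x. \<bar>F' x\<bar> \<le> D * wt I x ^ l"
    using F' unfolding poly_bounded_def by blast
  have F'm: "F' \<in> borel_measurable (PiM (insert i J) (\<lambda>_. std_gauss))"
    using F' unfolding poly_bounded_def J(3)[symmetric] measurable_gauss[unfolded gauss_def] by blast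
  have wt: "wt I (x(i := s)) = (1 + \<bar>s\<bar>) * wt J x" for x s
  proof -
    have "(\<Prod>j\<in>J. 1 + \<bar>(x(i := s)) j\<bar>) = (\<Prod>j\<in>J. 1 + \<bar>x j\<bar>)"
      using J by (intro prod.cong) auto
    thus ?thesis unfolding wt_def J(3) using J by simp
  qed
  have "(\<integral>x. x i * F x \<partial>gauss I) = (\<integral>x. (\<integral>s. s * F (x(i := s)) \<partial>std_gauss) \<partial>PiM J (\<lambda>_. std_gauss))"
    using poly_bounded_integrable[OF I(1) poly_bounded_mult[OF poly_bounded_coord[OF I] F]]
    unfolding gauss_def J(3) by (subst product_integral_insert[OF J(1,2)]) auto
  also have "\<dots> = (\<integral>x. (\<integral>s. F' (x(i := s)) \<partial>std_gauss) \<partial>PiM J (\<lambda>_. std_gauss))"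
  proof (rule Bochner_Integration.integral_cong[OF refl])
    fix x assume x: "x \<in> space (PiM J (\<lambda>_. std_gauss))"
    let ?w = "wt J x"
    have w: "1 \<le> ?w" by (rule wt_ge_1)
    show "(\<integral>s. s * F (x(i := s)) \<partial>std_gauss) = (\<integral>s. F' (x(i := s)) \<partial>std_gauss)"
    proof (rule gauss_integral_by_parts)
      show "((\<lambda>s. F (x(i := s))) has_real_derivative F' (x(i := t))) (at t)" for t by (rule der)
      show "(\<lambda>s. F' (x(i := s))) \<in> borel_measurable borel"
        using measurable_compose[OF measurable_component_update[OF x J(2)] F'm] by simp
      \<comment> \<open>The one-dimensional formula wants the same constant and exponent for the
        function and its derivative, hence the sums in both places.\<close>
      show "\<bar>F (x(i := s))\<bar> \<le> (C * ?w ^ k + D * ?w ^ l) * (1 + \<bar>s\<bar>) ^ (k + l)" for s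
      proof -
        have "\<bar>F (x(i := s))\<bar> \<le> (C * ?w ^ k) * (1 + \<bar>s\<bar>) ^ k"
          using C(2)[of "x(i := s)"] by (simp add: wt power_mult_distrib mult_ac)
        also have "\<dots> \<le> (C * ?w ^ k + D * ?w ^ l) * (1 + \<bar>s\<bar>) ^ (k + l)"
          using C(1) D(1) w by (intro mult_mono power_increasing) auto
        finally show ?thesis .
      qed
      show "\<bar>F' (x(i := s))\<bar> \<le> (C * ?w ^ k + D * ?w ^ l) * (1 + \<bar>s\<bar>) ^ (k + l)" for s
      proof -
        have "\<bar>F' (x(i := s))\<bar> \<le> (D * ?w ^ l) * (1 + \<bar>s\<bar>) ^ l"
          using D(2)[of "x(i := s)"] by (simp add: wt power_mult_distrib mult_ac)
        also have "\<dots> \<le> (C * ?w ^ k + D * ?w ^ l) * (1 + \<bar>s\<bar>) ^ (k + l)"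
          using C(1) D(1) w by (intro mult_mono power_increasing) auto
        finally show ?thesis .
      qed
    qed
  qed
  also have "\<dots> = (\<integral>x. F' x \<partial>gauss I)"
    using poly_bounded_integrable[OF I(1) F']
    unfolding gauss_def J(3) by (subst product_integral_insert[OF J(1,2)]) auto
  finally show ?thesis .
qed

section \<open>Matrix-valued functions: measurability, growth, derivatives\<close>

text \<open>Entrywise, with sizes that are constant on the space: the type \<open>real mat\<close>
  has matrices of all sizes, and the formulas for products and determinants need fixed index
  ranges.\<close>

definition mat_meas :: "'w measure \<Rightarrow> nat \<Rightarrow> nat \<Rightarrow> ('w \<Rightarrow> real mat) \<Rightarrow> bool" where
  "mat_meas M a b F \<longleftrightarrow> (\<forall>x\<in>space M. F x \<in> carrier_mat a b) \<and>
     (\<forall>i<a. \<forall>j<b. (\<lambda>x. F x $$ (i, j)) \<in> borel_measurable M)"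

lemma mat_measD:
  assumes "mat_meas M a b F"
  shows "x \<in> space M \<Longrightarrow> F x \<in> carrier_mat a b" "x \<in> space M \<Longrightarrow> dim_row (F x) = a"
    "x \<in> space M \<Longrightarrow> dim_col (F x) = b"
    "i < a \<Longrightarrow> j < b \<Longrightarrow> (\<lambda>x. F x $$ (i, j)) \<in> borel_measurable M"
  using assms unfolding mat_meas_def by auto

lemma mat_meas_const: "A \<in> carrier_mat a b \<Longrightarrow> mat_meas M a b (\<lambda>_. A)"
  unfolding mat_meas_def by auto

lemma mat_meas_mult:
  assumes F: "mat_meas M a b F" and G: "mat_meas M b c G"
  shows "mat_meas M a c (\<lambda>x. F x * G x)"
  unfolding mat_meas_def
proof (intro conjI ballI allI impI)
  show "F x * G x \<in> carrier_mat a c" if "x \<in> space M" for x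
    using mat_measD[OF F] mat_measD[OF G] that by auto
  fix i j assume ij: "i < a" "j < c"
  have "(\<lambda>x. \<Sum>k<b. F x $$ (i, k) * G x $$ (k, j)) \<in> borel_measurable M"
    using mat_measD(4)[OF F ij(1)] mat_measD(4)[OF G _ ij(2)] by (intro borel_measurable_sum borel_measurable_times) auto
  moreover have "(F x * G x) $$ (i, j) = (\<Sum>k<b. F x $$ (i, k) * G x $$ (k, j))" if "x \<in> space M" for x
    using mat_measD(2,3)[OF F that] mat_measD(2,3)[OF G that] ij by (subst mult_mat_entry) auto
  ultimately show "(\<lambda>x. (F x * G x) $$ (i, j)) \<in> borel_measurable M"
    by (subst measurable_cong) auto
qed

lemma mat_meas_entrywise:
  assumes "\<And>x. x \<in> space M \<Longrightarrow> H x \<in> carrier_mat a b"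
    and "\<And>i j. i < a \<Longrightarrow> j < b \<Longrightarrow> f i j \<in> borel_measurable M"
    and "\<And>x i j. x \<in> space M \<Longrightarrow> i < a \<Longrightarrow> j < b \<Longrightarrow> H x $$ (i, j) = f i j x"
  shows "mat_meas M a b H"
  unfolding mat_meas_def
proof (intro conjI ballI allI impI)
  fix i j assume ij: "i < a" "j < b"
  show "(\<lambda>x. H x $$ (i, j)) \<in> borel_measurable M"
    using assms(2)[OF ij] assms(3)[OF _ ij] by (subst measurable_cong) auto
qed (use assms in auto)

lemma mat_meas_transpose:
  assumes F: "mat_meas M a b F" shows "mat_meas M b a (\<lambda>x. (F x)\<^sup>T)"
  by (rule mat_meas_entrywise[where f = "\<lambda>i j x. F x $$ (j, i)"]) (use mat_measD[OF F] in auto)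

lemma mat_meas_add:
  assumes F: "mat_meas M a b F" and G: "mat_meas M a b G" shows "mat_meas M a b (\<lambda>x. F x + G x)"
  by (rule mat_meas_entrywise[where f = "\<lambda>i j x. F x $$ (i, j) + G x $$ (i, j)"])
    (use mat_measD[OF F] mat_measD[OF G] in \<open>auto intro: borel_measurable_add\<close>)

lemma mat_meas_minus:
  assumes F: "mat_meas M a b F" and G: "mat_meas M a b G" shows "mat_meas M a b (\<lambda>x. F x - G x)"
proof (rule mat_meas_entrywise[where f = "\<lambda>i j x. F x $$ (i, j) - G x $$ (i, j)"])
  show "F x - G x \<in> carrier_mat a b" if "x \<in> space M" for x
    using mat_measD[OF F] mat_measD[OF G] that by (intro carrier_matI) auto
qed (use mat_measD[OF F] mat_measD[OF G] in \<open>auto intro: borel_measurable_diff\<close>)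

lemma mat_meas_smult:
  assumes "c \<in> borel_measurable M" and F: "mat_meas M a b F" shows "mat_meas M a b (\<lambda>x. c x \<cdot>\<^sub>m F x)"
  by (rule mat_meas_entrywise[where f = "\<lambda>i j x. c x * F x $$ (i, j)"])
    (use assms(1) mat_measD[OF F] in \<open>auto intro: borel_measurable_times\<close>)

lemma mat_meas_det:
  assumes F: "mat_meas M a a F" shows "(\<lambda>x. det (F x)) \<in> borel_measurable M"
proof -
  have "(\<lambda>x. \<Sum>p\<in>{p. p permutes {0..<a}}. signof p * (\<Prod>i = 0..<a. F x $$ (i, p i))) \<in> borel_measurable M"
    using mat_measD(4)[OF F] permutes_in_image
    by (intro borel_measurable_sum borel_measurable_times borel_measurable_prod borel_measurable_const) fastforce
  moreover have "det (F x) = (\<Sum>p\<in>{p. p permutes {0..<a}}. signof p * (\<Prod>i = 0..<a. F x $$ (i, p i)))"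
    if "x \<in> space M" for x
    using mat_measD(1)[OF F that] by (rule det_def')
  ultimately show ?thesis by (subst measurable_cong) auto
qed

lemma mat_meas_adj:
  assumes F: "mat_meas M a a F" shows "mat_meas M a a (\<lambda>x. adj_mat (F x))"
proof (rule mat_meas_entrywise[where f = "\<lambda>i j x. (-1) ^ (j + i) * det (mat_delete (F x) j i)"])
  show "adj_mat (F x) \<in> carrier_mat a a" if "x \<in> space M" for x
    by (rule adj_mat(1)) (use mat_measD(1)[OF F that] in auto)
  show "adj_mat (F x) $$ (i, j) = (-1) ^ (j + i) * det (mat_delete (F x) j i)"
    if "x \<in> space M" "i < a" "j < a" for x i j
    using mat_measD(2,3)[OF F that(1)] that unfolding adj_mat_def cofactor_def by simp
  show "(\<lambda>x. (-1) ^ (j + i) * det (mat_delete (F x) j i)) \<in> borel_measurable M" if ij: "i < a" "j < a" for i j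
  proof (intro borel_measurable_times borel_measurable_const mat_meas_det[where a = "a - 1"])
    show "mat_meas M (a - 1) (a - 1) (\<lambda>x. mat_delete (F x) j i)"
    proof (rule mat_meas_entrywise[where f = "\<lambda>k l x. F x $$ (if k < j then k else Suc k, if l < i then l else Suc l)"])
      fix x assume x: "x \<in> space M"
      show "mat_delete (F x) j i \<in> carrier_mat (a - 1) (a - 1)"
        using mat_measD(2,3)[OF F x] unfolding mat_delete_def by (intro carrier_matI) auto
      show "mat_delete (F x) j i $$ (k, l) = F x $$ (if k < j then k else Suc k, if l < i then l else Suc l)"
        if "k < a - 1" "l < a - 1" for k l
        using mat_measD(2,3)[OF F x] that unfolding mat_delete_def by simp
    qed (use mat_measD(4)[OF F] in auto)
  qed
qed

lemma mat_meas_reg_inv: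
  assumes F: "mat_meas M a b F" shows "mat_meas M b b (\<lambda>x. reg_inv e (F x))"
proof -
  have "mat_meas M b b (\<lambda>x. (F x)\<^sup>T * F x + e \<cdot>\<^sub>m 1\<^sub>m b)"
    by (intro mat_meas_add mat_meas_mult[OF mat_meas_transpose[OF F] F] mat_meas_const) auto
  hence g: "mat_meas M b b (\<lambda>x. reg_gram e (F x))"
    unfolding mat_meas_def reg_gram_def using mat_measD[OF F]
    by (auto cong: measurable_cong)
  show ?thesis unfolding reg_inv_def
    by (intro mat_meas_smult borel_measurable_divide borel_measurable_const mat_meas_det[OF g] mat_meas_adj[OF g])
qed

text \<open>The pseudoinverse is not continuous, but it is the pointwise limit of the
  regularizations with e = 1 / (k + 1), whatever the rank.\<close>

lemma mat_meas_pinv: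
  assumes F: "mat_meas M a b F" shows "mat_meas M b a (\<lambda>x. pinv (F x))"
  unfolding mat_meas_def
proof (intro conjI ballI allI impI)
  show "pinv (F x) \<in> carrier_mat b a" if "x \<in> space M" for x
    using mat_measD(2,3)[OF F that] by (intro carrier_matI) auto
  fix i j assume ij: "i < b" "j < a"
  show "(\<lambda>x. pinv (F x) $$ (i, j)) \<in> borel_measurable M"
  proof (rule borel_measurable_LIMSEQ_real)
    show "(\<lambda>x. (reg_inv (1 / real (Suc k)) (F x) * (F x)\<^sup>T) $$ (i, j)) \<in> borel_measurable M" for k
      by (rule mat_measD(4)[OF mat_meas_mult[OF mat_meas_reg_inv[OF F] mat_meas_transpose[OF F]] ij])
    fix x assume x: "x \<in> space M"
    have "filterlim (\<lambda>k. 1 / real (Suc k)) (at_right 0) sequentially"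
      unfolding filterlim_at using LIMSEQ_Suc[OF lim_1_over_n[where 'a = real]] by simp
    from filterlim_compose[OF reg_pinv_tendsto this]
    show "(\<lambda>k. (reg_inv (1 / real (Suc k)) (F x) * (F x)\<^sup>T) $$ (i, j)) \<longlonglongrightarrow> pinv (F x) $$ (i, j)"
      using mat_measD(2,3)[OF F x] ij by simp
  qed
qed

lemma mat_meas_mfro2:
  assumes F: "mat_meas M a b F" shows "(\<lambda>x. mfro2 (F x)) \<in> borel_measurable M"
proof -
  have "(\<lambda>x. \<Sum>i<a. \<Sum>j<b. (F x $$ (i, j))\<^sup>2) \<in> borel_measurable M"
    using mat_measD(4)[OF F] by (intro borel_measurable_sum borel_measurable_power) auto
  moreover have "mfro2 (F x) = (\<Sum>i<a. \<Sum>j<b. (F x $$ (i, j))\<^sup>2)" if "x \<in> space M" for x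
    unfolding mfro2_def using mat_measD(2,3)[OF F that] by simp
  ultimately show ?thesis by (subst measurable_cong) auto
qed

lemma mat_meas_mfro:
  assumes F: "mat_meas M a b F" shows "(\<lambda>x. mfro (F x)) \<in> borel_measurable M"
  unfolding mfro_def using mat_meas_mfro2[OF F] by measurable

section \<open>Polynomial growth of matrix-valued functions\<close>

definition mat_pb :: "'i set \<Rightarrow> nat \<Rightarrow> nat \<Rightarrow> (('i \<Rightarrow> real) \<Rightarrow> real mat) \<Rightarrow> bool" where
  "mat_pb I a b F \<longleftrightarrow> (\<forall>x. F x \<in> carrier_mat a b) \<and>
     (\<forall>i<a. \<forall>j<b. poly_bounded I (\<lambda>x. F x $$ (i, j)))"

lemma mat_pbD:
  assumes "mat_pb I a b F"
  shows "F x \<in> carrier_mat a b" "dim_row (F x) = a" "dim_col (F x) = b"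
    "i < a \<Longrightarrow> j < b \<Longrightarrow> poly_bounded I (\<lambda>x. F x $$ (i, j))"
  using assms unfolding mat_pb_def by auto

lemma mat_pb_meas: "mat_pb I a b F \<Longrightarrow> mat_meas (PiM I (\<lambda>_. borel)) a b F"
  unfolding mat_pb_def mat_meas_def poly_bounded_def by auto

lemma mat_pb_entrywise:
  assumes "\<And>x. H x \<in> carrier_mat a b"
    and "\<And>i j. i < a \<Longrightarrow> j < b \<Longrightarrow> poly_bounded I (f i j)"
    and "\<And>x i j. i < a \<Longrightarrow> j < b \<Longrightarrow> H x $$ (i, j) = f i j x"
  shows "mat_pb I a b H"
proof -
  have "(\<lambda>x. H x $$ (i, j)) = f i j" if "i < a" "j < b" for i j using assms(3)[OF that] by auto
  thus ?thesis unfolding mat_pb_def using assms(1,2) by simp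
qed

lemma mat_pb_const: "A \<in> carrier_mat a b \<Longrightarrow> mat_pb I a b (\<lambda>_. A)"
  unfolding mat_pb_def by (auto intro: poly_bounded_const)

lemma mat_pb_mult:
  assumes F: "mat_pb I a b F" and G: "mat_pb I b c G"
  shows "mat_pb I a c (\<lambda>x. F x * G x)"
proof (rule mat_pb_entrywise[where f = "\<lambda>i j x. \<Sum>k<b. F x $$ (i, k) * G x $$ (k, j)"])
  show "F x * G x \<in> carrier_mat a c" for x
    using mat_pbD[OF F] mat_pbD[OF G] by (intro carrier_matI) auto
  show "poly_bounded I (\<lambda>x. \<Sum>k<b. F x $$ (i, k) * G x $$ (k, j))" if "i < a" "j < c" for i j
    using mat_pbD(4)[OF F] mat_pbD(4)[OF G] that by (intro poly_bounded_sum poly_bounded_mult) auto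
  show "(F x * G x) $$ (i, j) = (\<Sum>k<b. F x $$ (i, k) * G x $$ (k, j))" if "i < a" "j < c" for x i j
    using mat_pbD(2,3)[OF F] mat_pbD(2,3)[OF G] that by (subst mult_mat_entry) auto
qed

lemma mat_pb_transpose:
  assumes F: "mat_pb I a b F" shows "mat_pb I b a (\<lambda>x. (F x)\<^sup>T)"
  by (rule mat_pb_entrywise[where f = "\<lambda>i j x. F x $$ (j, i)"]) (use mat_pbD[OF F] in auto)

lemma mat_pb_add:
  assumes F: "mat_pb I a b F" and G: "mat_pb I a b G" shows "mat_pb I a b (\<lambda>x. F x + G x)"
  by (rule mat_pb_entrywise[where f = "\<lambda>i j x. F x $$ (i, j) + G x $$ (i, j)"])
    (use mat_pbD[OF F] mat_pbD[OF G] in \<open>auto intro: poly_bounded_add\<close>)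

lemma mat_pb_uminus:
  assumes F: "mat_pb I a b F" shows "mat_pb I a b (\<lambda>x. - F x)"
  by (rule mat_pb_entrywise[where f = "\<lambda>i j x. - F x $$ (i, j)"])
    (use mat_pbD[OF F] in \<open>auto intro: poly_bounded_uminus\<close>)

text \<open>The entries are bounded by 1 / e however fast F grows, so only measurability is left to
  check.\<close>

lemma mat_pb_reg_inv:
  assumes F: "mat_pb I a b F" and e: "0 < e" shows "mat_pb I b b (\<lambda>x. reg_inv e (F x))"
  unfolding mat_pb_def
proof (intro conjI allI impI)
  show "reg_inv e (F x) \<in> carrier_mat b b" for x
    using mat_pbD[OF F] by (intro carrier_matI) auto
  show "poly_bounded I (\<lambda>x. reg_inv e (F x) $$ (i, j))" if "i < b" "j < b" for i j
    by (rule poly_bounded_bounded[where C = "1 / e"])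
      (use mat_measD(4)[OF mat_meas_reg_inv[OF mat_pb_meas[OF F]] that] reg_inv_bound[OF e] mat_pbD(3)[OF F] that in auto)
qed

section \<open>Derivatives along a real parameter, including that of the regularized inverse\<close>

definition mat_deriv :: "nat \<Rightarrow> nat \<Rightarrow> (real \<Rightarrow> real mat) \<Rightarrow> real mat \<Rightarrow> real \<Rightarrow> bool" where
  "mat_deriv a b F D t \<longleftrightarrow> (\<forall>s. F s \<in> carrier_mat a b) \<and> D \<in> carrier_mat a b \<and>
     (\<forall>i<a. \<forall>j<b. ((\<lambda>s. F s $$ (i, j)) has_real_derivative D $$ (i, j)) (at t))"

lemma mat_derivD:
  assumes "mat_deriv a b F D t"
  shows "dim_row (F s) = a" "dim_col (F s) = b" "dim_row D = a" "dim_col D = b"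
    "i < a \<Longrightarrow> j < b \<Longrightarrow> ((\<lambda>s. F s $$ (i, j)) has_real_derivative D $$ (i, j)) (at t)"
  using assms unfolding mat_deriv_def by auto

lemma mat_derivI:
  assumes "\<And>s. dim_row (F s) = a" "\<And>s. dim_col (F s) = b" "dim_row D = a" "dim_col D = b"
    "\<And>i j. i < a \<Longrightarrow> j < b \<Longrightarrow> ((\<lambda>s. F s $$ (i, j)) has_real_derivative D $$ (i, j)) (at t)"
  shows "mat_deriv a b F D t"
  using assms unfolding mat_deriv_def by (auto intro: carrier_matI)

lemma mat_deriv_const: "A \<in> carrier_mat a b \<Longrightarrow> mat_deriv a b (\<lambda>_. A) (0\<^sub>m a b) t"
  unfolding mat_deriv_def by auto

lemma mat_deriv_transpose:
  assumes F: "mat_deriv a b F D t" shows "mat_deriv b a (\<lambda>s. (F s)\<^sup>T) (D\<^sup>T) t"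
  by (rule mat_derivI) (use mat_derivD[OF F] in auto)

lemma mat_deriv_add:
  assumes F: "mat_deriv a b F D t" and G: "mat_deriv a b G E t"
  shows "mat_deriv a b (\<lambda>s. F s + G s) (D + E) t"
  by (rule mat_derivI) (use mat_derivD[OF F] mat_derivD[OF G] in \<open>auto intro: DERIV_add\<close>)

lemma mat_deriv_mult:
  assumes F: "mat_deriv a b F D t" and G: "mat_deriv b c G E t"
  shows "mat_deriv a c (\<lambda>s. F s * G s) (D * G t + F t * E) t"
proof (rule mat_derivI)
  note d = mat_derivD(1-4)[OF F] mat_derivD(1-4)[OF G]
  fix i j assume ij: "i < a" "j < c"
  have "((\<lambda>s. \<Sum>k<b. F s $$ (i, k) * G s $$ (k, j)) has_real_derivative
     (\<Sum>k<b. F t $$ (i, k) * E $$ (k, j) + D $$ (i, k) * G t $$ (k, j))) (at t)"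
    by (intro DERIV_sum DERIV_mult') (use mat_derivD(5)[OF F] mat_derivD(5)[OF G] ij in auto)
  moreover have "(\<lambda>s. (F s * G s) $$ (i, j)) = (\<lambda>s. \<Sum>k<b. F s $$ (i, k) * G s $$ (k, j))"
    using d ij by (auto simp: mult_mat_entry simp del: index_mult_mat(1))
  moreover have "(D * G t + F t * E) $$ (i, j) = (\<Sum>k<b. F t $$ (i, k) * E $$ (k, j) + D $$ (i, k) * G t $$ (k, j))"
    using d ij by (simp add: mult_mat_entry sum.distrib del: index_mult_mat(1))
  ultimately show "((\<lambda>s. (F s * G s) $$ (i, j)) has_real_derivative (D * G t + F t * E) $$ (i, j)) (at t)" by simp
qed (use mat_derivD(1-4)[OF F] mat_derivD(1-4)[OF G] in auto)

text \<open>The resolvent identity.\<close>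

lemma reg_inv_diff:
  assumes "0 < e" "dim_col Z = dim_col Z'"
  shows "reg_inv e Z - reg_inv e Z' = - (reg_inv e Z * ((reg_gram e Z - reg_gram e Z') * reg_inv e Z'))"
proof -
  let ?n = "dim_col Z'"
  have "reg_inv e Z * ((reg_gram e Z - reg_gram e Z') * reg_inv e Z') =
     (reg_inv e Z * reg_gram e Z) * reg_inv e Z' - reg_inv e Z * (reg_gram e Z' * reg_inv e Z')"
    using assms(2) by (simp add: mat_minus_mult mat_mult_minus mat_assoc)
  also have "\<dots> = reg_inv e Z' - reg_inv e Z"
    unfolding reg_inv[OF assms(1)] using assms(2) by (simp add: mat_alg)
  finally show ?thesis using assms(2) by (intro eq_matI) (auto simp del: index_mult_mat(1))
qed

text \<open>The resolvent identity expresses increments of the inverse by increments of the Gram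
  matrix, between one inverse at s and one at t. It remains to know that the inverse is continuous,
  and the uniform bound 1 / e gives that from the same identity.\<close>

lemma mat_deriv_reg_inv:
  assumes Z: "mat_deriv m q Z D t" and e: "0 < e"
  shows "mat_deriv q q (\<lambda>s. reg_inv e (Z s))
     (- (reg_inv e (Z t) * ((D\<^sup>T * Z t + (Z t)\<^sup>T * D) * reg_inv e (Z t)))) t"
proof -
  note d = mat_derivD(1-4)[OF Z]
  let ?K = "\<lambda>s. reg_inv e (Z s)" and ?N = "\<lambda>s. reg_gram e (Z s)"
  let ?dN = "D\<^sup>T * Z t + (Z t)\<^sup>T * D"
  have "mat_deriv q q (\<lambda>s. (Z s)\<^sup>T * Z s + e \<cdot>\<^sub>m 1\<^sub>m q) (?dN + 0\<^sub>m q q) t"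
    by (intro mat_deriv_add mat_deriv_mult[OF mat_deriv_transpose[OF Z] Z] mat_deriv_const) auto
  moreover have "?dN + 0\<^sub>m q q = ?dN" using d by (intro eq_matI) (auto simp del: index_mult_mat(1))
  ultimately have N: "mat_deriv q q ?N ?dN t" unfolding reg_gram_def d by simp
  have diff: "?K s $$ (i, j) - ?K t $$ (i, j) =
     - (\<Sum>a<q. \<Sum>b<q. ?K s $$ (i, a) * (?N s $$ (a, b) - ?N t $$ (a, b)) * ?K t $$ (b, j))"
    if "i < q" "j < q" for i j s
  proof -
    have "(?K s - ?K t) $$ (i, j) = - (\<Sum>a<q. ?K s $$ (i, a) * (\<Sum>b<q. (?N s $$ (a, b) - ?N t $$ (a, b)) * ?K t $$ (b, j)))"
      using that d by (subst reg_inv_diff[OF e]) (auto simp: mult_mat_entry simp del: index_mult_mat(1))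
    thus ?thesis using that d by (simp add: sum_distrib_left mult.assoc)
  qed
  have bK: "\<bar>?K s $$ (i, j)\<bar> \<le> 1 / e" if "i < q" "j < q" for i j s
    using reg_inv_bound[OF e] that d by simp
  have cont: "isCont (\<lambda>s. ?K s $$ (i, j)) t" if ij: "i < q" "j < q" for i j
  proof -
    have N0: "((\<lambda>s. ?N s $$ (a, b) - ?N t $$ (a, b)) \<longlongrightarrow> 0) (at t)" if "a < q" "b < q" for a b
      using DERIV_isCont[OF mat_derivD(5)[OF N that]] unfolding isCont_def by (simp add: LIM_zero)
    have lim: "((\<lambda>s. \<Sum>a<q. \<Sum>b<q. 1 / e * \<bar>?N s $$ (a, b) - ?N t $$ (a, b)\<bar> * (1 / e)) \<longlongrightarrow> 0) (at t)"
      by (intro tendsto_null_sum tendsto_mult_left_zero tendsto_mult_right_zero tendsto_rabs_zero N0) auto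
    have b: "norm (?K s $$ (i, j) - ?K t $$ (i, j)) \<le>
       (\<Sum>a<q. \<Sum>b<q. 1 / e * \<bar>?N s $$ (a, b) - ?N t $$ (a, b)\<bar> * (1 / e))" for s
      unfolding diff[OF ij] norm_minus_cancel
      by (intro order_trans[OF norm_sum] sum_mono, unfold real_norm_def abs_mult)
        (intro mult_mono bK, use ij e in auto)
    have "((\<lambda>s. ?K s $$ (i, j) - ?K t $$ (i, j)) \<longlongrightarrow> 0) (at t)"
      by (rule Lim_null_comparison[OF _ lim]) (intro always_eventually allI b)
    thus ?thesis unfolding isCont_def by (simp add: LIM_zero_iff)
  qed
  \<comment> \<open>Caratheodory's form of differentiability: the increments of the Gram matrix are
    g (s - t) with g continuous at t, so the products can be formed without division.\<close>
  have "\<exists>g. a < q \<longrightarrow> b < q \<longrightarrow> (\<forall>s. ?N s $$ (a, b) - ?N t $$ (a, b) = g s * (s - t)) \<and> isCont g t \<and> g t = ?dN $$ (a, b)" for a b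
    using mat_derivD(5)[OF N, of a b] unfolding CARAT_DERIV by (cases "a < q \<and> b < q") blast+
  then obtain g where g: "\<And>a b s. a < q \<Longrightarrow> b < q \<Longrightarrow> ?N s $$ (a, b) - ?N t $$ (a, b) = g a b s * (s - t)"
    "\<And>a b. a < q \<Longrightarrow> b < q \<Longrightarrow> isCont (g a b) t" "\<And>a b. a < q \<Longrightarrow> b < q \<Longrightarrow> g a b t = ?dN $$ (a, b)"
    by metis
  show ?thesis
  proof (rule mat_derivI)
    fix i j assume ij: "i < q" "j < q"
    let ?h = "\<lambda>s. - (\<Sum>a<q. \<Sum>b<q. ?K s $$ (i, a) * g a b s * ?K t $$ (b, j))"
    have 1: "?K s $$ (i, j) - ?K t $$ (i, j) = ?h s * (s - t)" for s
    proof -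
      have "(\<Sum>a<q. \<Sum>b<q. ?K s $$ (i, a) * (?N s $$ (a, b) - ?N t $$ (a, b)) * ?K t $$ (b, j)) =
        (\<Sum>a<q. \<Sum>b<q. ?K s $$ (i, a) * g a b s * ?K t $$ (b, j) * (s - t))"
        by (intro sum.cong refl) (simp add: g(1))
      thus ?thesis unfolding diff[OF ij] by (simp add: sum_distrib_right)
    qed
    have 2: "isCont ?h t"
      using cont g(2) ij by (intro continuous_intros) auto
    have 3: "?h t = (- (?K t * (?dN * ?K t))) $$ (i, j)"
    proof -
      have "(- (?K t * (?dN * ?K t))) $$ (i, j) = - (\<Sum>a<q. ?K t $$ (i, a) * (\<Sum>b<q. ?dN $$ (a, b) * ?K t $$ (b, j)))"
        using d ij by (simp add: mult_mat_entry del: index_mult_mat(1) index_add_mat(1))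
      also have "\<dots> = ?h t" by (simp add: sum_distrib_left mult.assoc g(3) del: index_mult_mat(1) index_add_mat(1))
      finally show ?thesis by simp
    qed
    show "((\<lambda>s. ?K s $$ (i, j)) has_real_derivative (- (?K t * (?dN * ?K t))) $$ (i, j)) (at t)"
      unfolding CARAT_DERIV using 1 2 3 by (intro exI[of _ ?h]) auto
  qed (use d in auto)
qed

section \<open>Sketched pseudoinverses of Gaussian matrices\<close>

definition entry_mat :: "nat \<Rightarrow> nat \<Rightarrow> (nat \<times> nat \<Rightarrow> real) \<Rightarrow> real mat" where
  "entry_mat n m x = Matrix.mat n m x"

lemma entry_mat_dim [simp]: "dim_row (entry_mat n m x) = n" "dim_col (entry_mat n m x) = m"
  unfolding entry_mat_def by simp_all

definition unit_mat :: "nat \<Rightarrow> nat \<Rightarrow> nat \<Rightarrow> nat \<Rightarrow> real mat" where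
  "unit_mat n m i j = Matrix.mat n m (\<lambda>(a, b). if a = i \<and> b = j then 1 else 0)"

lemma unit_mat_dim [simp]: "dim_row (unit_mat n m i j) = n" "dim_col (unit_mat n m i j) = m"
  unfolding unit_mat_def by simp_all

lemma transpose_unit_mat: "(unit_mat n m i j)\<^sup>T = unit_mat m n j i"
  unfolding unit_mat_def by (intro eq_matI) auto

lemma mult_unit_mult_entry:
  assumes "dim_col A = n" "dim_row B = m" "k < dim_row A" "l < dim_col B" "i < n" "j < m"
  shows "(A * (unit_mat n m i j * B)) $$ (k, l) = A $$ (k, i) * B $$ (j, l)"
proof -
  have 1: "(unit_mat n m i j * B) $$ (a, l) = (if a = i then B $$ (j, l) else 0)" if "a < n" for a
  proof -
    have "(unit_mat n m i j * B) $$ (a, l) = (\<Sum>b<m. if b = j then (if a = i then B $$ (j, l) else 0) else 0)"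
      using assms that
      by (subst mult_mat_entry) (auto simp: unit_mat_def if_distrib[of "\<lambda>x. x * _"] cong: if_cong)
    thus ?thesis using assms by simp
  qed
  have "(A * (unit_mat n m i j * B)) $$ (k, l) = (\<Sum>a<n. if a = i then A $$ (k, i) * B $$ (j, l) else 0)"
    using assms 1
    by (subst mult_mat_entry) (auto simp: if_distrib[of "\<lambda>x. _ * x"] simp del: index_mult_mat(1) cong: if_cong)
  thus ?thesis using assms by simp
qed

text \<open>The sum is the divergence of the linear field that sends Y to A Y B.\<close>

lemma sum_unit_trace_trace:
  assumes "dim_row A = n" "dim_col A = n" "dim_row B = m" "dim_col B = m"
  shows "(\<Sum>i<n. \<Sum>j<m. (A * (unit_mat n m i j * B)) $$ (i, j)) = mtr A * mtr B"
proof -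
  have "(\<Sum>i<n. \<Sum>j<m. (A * (unit_mat n m i j * B)) $$ (i, j)) = (\<Sum>i<n. \<Sum>j<m. A $$ (i, i) * B $$ (j, j))"
    using assms by (intro sum.cong refl) (auto simp: mult_unit_mult_entry simp del: index_mult_mat(1))
  thus ?thesis unfolding mtr_def using assms by (simp add: sum_product)
qed

lemma sum_unit_trace:
  assumes "dim_row A = n" "dim_col A = n"
  shows "(\<Sum>i<n. \<Sum>j<m. (A * unit_mat n m i j) $$ (i, j)) = mtr A * real m"
  using sum_unit_trace_trace[OF assms, of "1\<^sub>m m" m] by (simp add: mat_right_one mtr_one)

text \<open>The divergence of the field that sends Y to A Y^T B. It produces one trace where
  \<open>sum_unit_trace_trace\<close> produces a product of two.\<close>

lemma sum_unit_transpose_trace: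
  assumes "dim_row A = n" "dim_col A = m" "dim_row B = n" "dim_col B = m"
  shows "(\<Sum>i<n. \<Sum>j<m. (A * ((unit_mat n m i j)\<^sup>T * B)) $$ (i, j)) = mtr (A\<^sup>T * B)"
proof -
  have "(\<Sum>i<n. \<Sum>j<m. (A * ((unit_mat n m i j)\<^sup>T * B)) $$ (i, j)) = (\<Sum>i<n. \<Sum>j<m. A $$ (i, j) * B $$ (i, j))"
    using assms by (intro sum.cong refl) (auto simp: transpose_unit_mat mult_unit_mult_entry simp del: index_mult_mat(1))
  also have "\<dots> = (\<Sum>j<m. \<Sum>i<n. A $$ (i, j) * B $$ (i, j))" by (rule sum.swap)
  also have "\<dots> = mtr (A\<^sup>T * B)"
    unfolding mtr_def using assms by (intro sum.cong) (auto simp: mult_mat_entry simp del: index_mult_mat(1))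
  finally show ?thesis .
qed

lemma mat_pb_entry_mat: "mat_pb ({0..<n} \<times> {0..<m}) n m (entry_mat n m)"
  by (rule mat_pb_entrywise[where f = "\<lambda>i j x. x (i, j)"])
    (auto simp: entry_mat_def intro!: poly_bounded_coord)

lemma mat_deriv_entry_mat:
  assumes "i < n" "j < m"
  shows "mat_deriv n m (\<lambda>s. entry_mat n m (x((i, j) := s))) (unit_mat n m i j) t"
proof (rule mat_derivI)
  fix a b assume "a < n" "b < m"
  thus "((\<lambda>s. entry_mat n m (x((i, j) := s)) $$ (a, b)) has_real_derivative unit_mat n m i j $$ (a, b)) (at t)"
    by (auto simp: entry_mat_def unit_mat_def)
qed auto

lemma mat_deriv_mult_right:
  assumes F: "mat_deriv a b F D t" and B: "B \<in> carrier_mat b c"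
  shows "mat_deriv a c (\<lambda>s. F s * B) (D * B) t"
proof -
  have "D * B + F t * 0\<^sub>m b c = D * B" using mat_derivD(1-4)[OF F] B by (intro eq_matI) auto
  thus ?thesis using mat_deriv_mult[OF F mat_deriv_const[OF B]] by simp
qed

lemma mat_deriv_mult_left:
  assumes F: "mat_deriv b c F D t" and A: "A \<in> carrier_mat a b"
  shows "mat_deriv a c (\<lambda>s. A * F s) (A * D) t"
proof -
  have "0\<^sub>m a b * F t + A * D = A * D" using mat_derivD(1-4)[OF F] A by (intro eq_matI) auto
  thus ?thesis using mat_deriv_mult[OF mat_deriv_const[OF A] F] by simp
qed

lemma mat_pb_mtr:
  assumes "mat_pb I a b F" "a \<le> b" shows "poly_bounded I (\<lambda>x. mtr (F x))"
proof -
  have "(\<lambda>x. mtr (F x)) = (\<lambda>x. \<Sum>i<a. F x $$ (i, i))"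
    unfolding mtr_def using mat_pbD(2)[OF assms(1)] by simp
  thus ?thesis using mat_pbD(4)[OF assms(1)] assms(2) by (auto intro!: poly_bounded_sum)
qed

lemma integral_sum_sum:
  fixes f :: "nat \<Rightarrow> nat \<Rightarrow> 'a \<Rightarrow> real"
  assumes "\<And>i j. i < n \<Longrightarrow> j < m \<Longrightarrow> integrable M (f i j)"
  shows "(\<integral>x. (\<Sum>i<n. \<Sum>j<m. f i j x) \<partial>M) = (\<Sum>i<n. \<Sum>j<m. \<integral>x. f i j x \<partial>M)"
proof -
  have "(\<integral>x. (\<Sum>i<n. \<Sum>j<m. f i j x) \<partial>M) = (\<Sum>i<n. \<integral>x. (\<Sum>j<m. f i j x) \<partial>M)"
    using assms by (intro Bochner_Integration.integral_sum Bochner_Integration.integrable_sum) auto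
  also have "\<dots> = (\<Sum>i<n. \<Sum>j<m. \<integral>x. f i j x \<partial>M)"
    using assms by (intro sum.cong refl Bochner_Integration.integral_sum) auto
  finally show ?thesis .
qed

text \<open>Stein's identity for matrices, obtained by summing the coordinate formula over all
  entries: the right-hand side integrates the divergence of F.\<close>

lemma mat_gauss_integral_by_parts:
  fixes n m
  defines "I \<equiv> {0..<n} \<times> {0..<m}"
  assumes F: "mat_pb I n m F"
    and D: "\<And>i j. i < n \<Longrightarrow> j < m \<Longrightarrow> mat_pb I n m (D i j)"
    and der: "\<And>i j x t. i < n \<Longrightarrow> j < m \<Longrightarrow>
       mat_deriv n m (\<lambda>s. F (x((i, j) := s))) (D i j (x((i, j) := t))) t"
  shows "(\<integral>x. mtr ((entry_mat n m x)\<^sup>T * F x) \<partial>gauss I) =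
     (\<integral>x. (\<Sum>i<n. \<Sum>j<m. D i j x $$ (i, j)) \<partial>gauss I)"
proof -
  have fI: "finite I" unfolding I_def by simp
  have c: "poly_bounded I (\<lambda>x. x (i, j))" if "i < n" "j < m" for i j
    by (rule poly_bounded_coord[OF fI]) (use that in \<open>auto simp: I_def\<close>)
  have xF: "integrable (gauss I) (\<lambda>x. x (i, j) * F x $$ (i, j))" if "i < n" "j < m" for i j
    by (intro poly_bounded_integrable[OF fI] poly_bounded_mult c mat_pbD(4)[OF F] that)
  have iD: "integrable (gauss I) (\<lambda>x. D i j x $$ (i, j))" if "i < n" "j < m" for i j
    by (intro poly_bounded_integrable[OF fI] mat_pbD(4)[OF D] that)
  have "mtr ((entry_mat n m x)\<^sup>T * F x) = (\<Sum>i<n. \<Sum>j<m. x (i, j) * F x $$ (i, j))" for x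
  proof -
    have "mtr ((entry_mat n m x)\<^sup>T * F x) = (\<Sum>j<m. \<Sum>i<n. x (i, j) * F x $$ (i, j))"
      unfolding mtr_def using mat_pbD(2,3)[OF F, of x]
      by (intro sum.cong) (auto simp: mult_mat_entry entry_mat_def simp del: index_mult_mat(1))
    thus ?thesis by (subst sum.swap) simp
  qed
  hence "(\<integral>x. mtr ((entry_mat n m x)\<^sup>T * F x) \<partial>gauss I) =
      (\<Sum>i<n. \<Sum>j<m. \<integral>x. x (i, j) * F x $$ (i, j) \<partial>gauss I)"
    using integral_sum_sum[OF xF] by simp
  also have "\<dots> = (\<Sum>i<n. \<Sum>j<m. \<integral>x. D i j x $$ (i, j) \<partial>gauss I)"
  proof (intro sum.cong refl)
    fix i j assume "i \<in> {..<n}" "j \<in> {..<m}"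
    hence ij: "i < n" "j < m" by auto
    show "(\<integral>x. x (i, j) * F x $$ (i, j) \<partial>gauss I) = (\<integral>x. D i j x $$ (i, j) \<partial>gauss I)"
      by (rule gauss_integral_by_parts_coord[OF fI _ mat_pbD(4)[OF F ij] mat_pbD(4)[OF D[OF ij] ij] mat_derivD(5)[OF der[OF ij] ij]])
        (use ij in \<open>auto simp: I_def\<close>)
  qed
  also have "\<dots> = (\<integral>x. (\<Sum>i<n. \<Sum>j<m. D i j x $$ (i, j)) \<partial>gauss I)"
    using integral_sum_sum[OF iD] by simp
  finally show ?thesis .
qed

lemma mat_uminus_mult: "dim_col A = dim_row B \<Longrightarrow> (- A) * B = - (A * (B :: real mat))"
  by (intro eq_matI) (auto simp: mult_mat_entry sum_negf simp del: index_mult_mat(1))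

lemma mat_mult_uminus: "dim_col A = dim_row B \<Longrightarrow> A * (- B) = - (A * (B :: real mat))"
  by (intro eq_matI) (auto simp: mult_mat_entry sum_negf simp del: index_mult_mat(1))

section \<open>First field: the expected trace of the regularized inverse\<close>

context
  fixes n m q :: nat and Q :: "real mat" and e :: real
  assumes Q: "Q \<in> carrier_mat n q" "orthocols Q" and e: "0 < e"
begin

private lemma Qd [simp]: "dim_row Q = n" "dim_col Q = q" using Q by auto

private definition I where "I = {0..<n} \<times> {0..<m}"
private definition Y where "Y x = entry_mat n m x"
private definition G where "G x = (Y x)\<^sup>T * Q"
private definition K where "K x = reg_inv e (G x)"
private definition E where "E i j = unit_mat n m i j"
private definition dG where "dG i j = (E i j)\<^sup>T * Q"
private definition dK where "dK i j x =
  - (K x * (((dG i j)\<^sup>T * G x + (G x)\<^sup>T * dG i j) * K x))"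

private lemma dims [simp]: "dim_row (Y x) = n" "dim_col (Y x) = m" "dim_row (G x) = m" "dim_col (G x) = q"
  "dim_row (K x) = q" "dim_col (K x) = q" "dim_row (E i j) = n" "dim_col (E i j) = m"
  "dim_row (dG i j) = m" "dim_col (dG i j) = q" "dim_row (dK i j x) = q" "dim_col (dK i j x) = q"
  unfolding Y_def G_def K_def E_def dG_def dK_def by auto

private lemma pb_Y: "mat_pb I n m Y"
  unfolding I_def Y_def[abs_def] by (rule mat_pb_entry_mat)

private lemma pb_G: "mat_pb I m q G"
  unfolding G_def[abs_def] by (rule mat_pb_mult[OF mat_pb_transpose[OF pb_Y] mat_pb_const[OF Q(1)]])

private lemma pb_K: "mat_pb I q q K"
  unfolding K_def[abs_def] by (rule mat_pb_reg_inv[OF pb_G e])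

private lemma pb_dG: "mat_pb I m q (\<lambda>_. dG i j)"
  by (rule mat_pb_const) (auto intro: carrier_matI)

private lemma pb_E: "mat_pb I n m (\<lambda>_. E i j)"
  by (rule mat_pb_const) (auto intro: carrier_matI)

private lemma pb_dK: "mat_pb I q q (dK i j)"
  unfolding dK_def[abs_def]
  by (intro mat_pb_uminus mat_pb_mult[OF pb_K] mat_pb_mult[OF _ pb_K] mat_pb_add
      mat_pb_mult[OF mat_pb_transpose[OF pb_dG] pb_G] mat_pb_mult[OF mat_pb_transpose[OF pb_G] pb_dG])

private lemma der_Y: "i < n \<Longrightarrow> j < m \<Longrightarrow> mat_deriv n m (\<lambda>s. Y (x((i, j) := s))) (E i j) t"
  unfolding Y_def E_def by (rule mat_deriv_entry_mat)

private lemma der_G: "i < n \<Longrightarrow> j < m \<Longrightarrow> mat_deriv m q (\<lambda>s. G (x((i, j) := s))) (dG i j) t"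
  unfolding G_def dG_def by (intro mat_deriv_mult_right[OF mat_deriv_transpose[OF der_Y] Q(1)])

private lemma der_K: "i < n \<Longrightarrow> j < m \<Longrightarrow> mat_deriv q q (\<lambda>s. K (x((i, j) := s))) (dK i j (x((i, j) := t))) t"
  unfolding K_def dK_def by (rule mat_deriv_reg_inv[OF der_G e])

private lemma QQ: "Q\<^sup>T * Q = 1\<^sub>m q"
  using Q(2) unfolding orthocols_def by simp

private lemma K_sym: "(K x)\<^sup>T = K x"
  unfolding K_def by (rule transpose_reg_inv[OF e])

private lemma tr_KGG: "mtr (G x * (K x * (G x)\<^sup>T)) = real q - e * mtr (K x)"
proof -
  have "mtr (G x * (K x * (G x)\<^sup>T)) = mtr (K x * ((G x)\<^sup>T * G x))"
    by (subst mtr_comm) (simp_all add: mat_assoc)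
  thus ?thesis unfolding K_def by (simp add: mtr_reg_inv_gram[OF e])
qed

private lemma mtr_K_nonneg: "0 \<le> mtr (K x)"
  unfolding K_def by (rule mtr_reg_inv_nonneg[OF e])

private lemma integrable_mtr_K: "integrable (gauss I) (\<lambda>x. mtr (K x))"
  by (intro poly_bounded_integrable mat_pb_mtr[OF pb_K]) (auto simp: I_def)

private definition F1 where "F1 x = Q * (K x * (G x)\<^sup>T)"
private definition D1 where "D1 i j x = Q * (dK i j x * (G x)\<^sup>T + K x * (dG i j)\<^sup>T)"

text \<open>The product rule is sorted so that every term reads A E B or A E^T B, the shapes whose
  divergence is known; the factor \<open>1\<^sub>m m\<close> completes the pattern.\<close>

private lemma D1_eq: "D1 i j x = (- (Q * (K x * Q\<^sup>T) * (E i j * (G x * (K x * (G x)\<^sup>T))))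
   - F1 x * ((E i j)\<^sup>T * F1 x)) + Q * (K x * Q\<^sup>T) * (E i j * 1\<^sub>m m)"
proof -
  let ?A = "Q * (K x * (Q\<^sup>T * (E i j * (G x * (K x * (G x)\<^sup>T)))))"
  let ?B = "Q * (K x * ((G x)\<^sup>T * ((E i j)\<^sup>T * (Q * (K x * (G x)\<^sup>T)))))"
  let ?C = "Q * (K x * (Q\<^sup>T * E i j))"
  have "D1 i j x = - (?A + ?B) + ?C"
    unfolding D1_def dK_def dG_def
    by (simp add: mat_alg mat_add_mult mat_mult_add mat_uminus_mult mat_mult_uminus)
  also have "\<dots> = (- ?A - ?B) + ?C" by (intro eq_matI) (auto simp del: index_mult_mat(1))
  also have "\<dots> = (- (Q * (K x * Q\<^sup>T) * (E i j * (G x * (K x * (G x)\<^sup>T))))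
   - F1 x * ((E i j)\<^sup>T * F1 x)) + Q * (K x * Q\<^sup>T) * (E i j * 1\<^sub>m m)"
    unfolding F1_def by (simp add: mat_alg)
  finally show ?thesis .
qed

text \<open>With H = Q K Q^T and L = G K G^T the three terms give - tr H tr L, - (tr K - e |K|^2)
  and m tr H, where tr H = tr K and tr L = q - e tr K. The terms with a factor e are nonnegative and
  are dropped later.\<close>

private lemma div1: "(\<Sum>i<n. \<Sum>j<m. D1 i j x $$ (i, j)) =
   (real m - real q - 1) * mtr (K x) + e * (mtr (K x))\<^sup>2 + e * mfro2 (K x)"
proof -
  let ?H = "Q * (K x * Q\<^sup>T)" and ?L = "G x * (K x * (G x)\<^sup>T)"
  have dF: "dim_row (F1 x) = n" "dim_col (F1 x) = m" unfolding F1_def by auto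
  have H: "mtr ?H = mtr (K x)"
    by (subst mtr_comm) (simp_all add: mat_assoc QQ mat_alg)
  have F: "mtr ((F1 x)\<^sup>T * F1 x) = mtr (K x) - e * mfro2 (K x)"
  proof -
    have "mfro2 (F1 x) = mfro2 (K x * (G x)\<^sup>T)"
      unfolding F1_def by (rule mfro2_orthocols_mult[OF Q(2)]) simp
    thus ?thesis unfolding mfro2_mtr'[symmetric] K_def using mfro2_reg_pinv[OF e, of "G x"] by simp
  qed
  have "(\<Sum>i<n. \<Sum>j<m. D1 i j x $$ (i, j)) =
     (\<Sum>i<n. \<Sum>j<m. - (?H * (unit_mat n m i j * ?L)) $$ (i, j)
        - (F1 x * ((unit_mat n m i j)\<^sup>T * F1 x)) $$ (i, j)
        + (?H * (unit_mat n m i j * 1\<^sub>m m)) $$ (i, j))"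
    unfolding D1_eq using dF by (intro sum.cong refl) (auto simp: E_def simp del: index_mult_mat(1))
  also have "\<dots> = - (mtr ?H * mtr ?L) - mtr ((F1 x)\<^sup>T * F1 x) + mtr ?H * mtr (1\<^sub>m m)"
    using dF by (simp add: sum.distrib sum_subtractf sum_negf sum_unit_trace_trace sum_unit_transpose_trace sum_unit_trace mat_right_one mtr_one del: index_mult_mat(1))
  also have "\<dots> = (real m - real q - 1) * mtr (K x) + e * (mtr (K x))\<^sup>2 + e * mfro2 (K x)"
    unfolding H F tr_KGG mtr_one by (simp add: algebra_simps power2_eq_square)
  finally show ?thesis .
qed

private lemma mtr_K_bound: "(real m - real q - 1) * (\<integral>x. mtr (K x) \<partial>gauss I) \<le> real q"
proof -
  interpret prob_space "gauss I" by (rule prob_space_gauss)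
  have pbF: "mat_pb I n m F1"
    unfolding F1_def[abs_def] by (intro mat_pb_mult[OF mat_pb_const[OF Q(1)]] mat_pb_mult[OF pb_K mat_pb_transpose[OF pb_G]])
  have pbD: "mat_pb I n m (D1 i j)" for i j
    unfolding D1_def[abs_def]
    by (intro mat_pb_mult[OF mat_pb_const[OF Q(1)]] mat_pb_add mat_pb_mult[OF pb_dK mat_pb_transpose[OF pb_G]]
        mat_pb_mult[OF pb_K mat_pb_transpose[OF pb_dG]])
  have der: "mat_deriv n m (\<lambda>s. F1 (x((i, j) := s))) (D1 i j (x((i, j) := t))) t" if "i < n" "j < m" for i j x t
    unfolding F1_def D1_def
    by (intro mat_deriv_mult_left[OF _ Q(1)] mat_deriv_mult[OF der_K mat_deriv_transpose[OF der_G]] that)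
  have 1: "(\<integral>x. mtr ((Y x)\<^sup>T * F1 x) \<partial>gauss I) = (\<integral>x. (\<Sum>i<n. \<Sum>j<m. D1 i j x $$ (i, j)) \<partial>gauss I)"
    unfolding I_def Y_def by (rule mat_gauss_integral_by_parts) (use pbF pbD der in \<open>auto simp: I_def\<close>)
  \<comment> \<open>Since Y^T Q = G, the pairing is the trace of G K G^T; the correction - e tr K
    has the right sign to be dropped.\<close>
  have 2: "mtr ((Y x)\<^sup>T * F1 x) = real q - e * mtr (K x)" for x
    unfolding tr_KGG[symmetric] F1_def by (subst (2) G_def) (simp add: mat_assoc)
  have iD: "integrable (gauss I) (\<lambda>x. \<Sum>i<n. \<Sum>j<m. D1 i j x $$ (i, j))"
    by (intro poly_bounded_integrable poly_bounded_sum mat_pbD(4)[OF pbD]) (auto simp: I_def)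
  have "(real m - real q - 1) * (\<integral>x. mtr (K x) \<partial>gauss I) = (\<integral>x. (real m - real q - 1) * mtr (K x) \<partial>gauss I)" by simp
  also have "\<dots> \<le> (\<integral>x. (\<Sum>i<n. \<Sum>j<m. D1 i j x $$ (i, j)) \<partial>gauss I)"
    by (intro integral_mono iD integrable_mult_right integrable_mtr_K) (use e in \<open>simp add: div1\<close>)
  also have "\<dots> = (\<integral>x. real q - e * mtr (K x) \<partial>gauss I)" unfolding 1[symmetric] 2 ..
  also have "\<dots> \<le> (\<integral>x. real q \<partial>gauss I)"
    by (intro integral_mono Bochner_Integration.integrable_diff integrable_mult_right integrable_mtr_K)
      (use e mtr_K_nonneg in auto)
  also have "\<dots> = real q" by (simp add: prob_space)
  finally show ?thesis .
qed

lemma gauss_reg_inv_trace_bound: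
  "(real m - real q - 1) *
     (\<integral>x. mtr (reg_inv e ((entry_mat n m x)\<^sup>T * Q)) \<partial>gauss ({0..<n} \<times> {0..<m})) \<le> real q"
  "integrable (gauss ({0..<n} \<times> {0..<m})) (\<lambda>x. mtr (reg_inv e ((entry_mat n m x)\<^sup>T * Q)))"
  using mtr_K_bound integrable_mtr_K unfolding K_def G_def Y_def I_def .

section \<open>Second field: the part of the sketch that sees W, orthogonal to Q\<close>

context
  fixes W :: "real mat" and w :: nat
  assumes W: "W \<in> carrier_mat n w" "Q\<^sup>T * W = 0\<^sub>m q w"
begin

private lemma Wd [simp]: "dim_row W = n" "dim_col W = w" using W by auto

private definition S where "S = W * W\<^sup>T"
private definition P where "P x = G x * (K x * (K x * (G x)\<^sup>T))"
private definition F2 where "F2 x = S * (Y x * P x)"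
private definition dP where "dP i j x = dG i j * (K x * (K x * (G x)\<^sup>T))
   + G x * (dK i j x * (K x * (G x)\<^sup>T)
      + K x * (dK i j x * (G x)\<^sup>T + K x * (dG i j)\<^sup>T))"
private definition D2 where "D2 i j x = S * (E i j * P x + Y x * dP i j x)"

private lemma dims2 [simp]: "dim_row S = n" "dim_col S = n" "dim_row (P x) = m" "dim_col (P x) = m"
  "dim_row (dP i j x) = m" "dim_col (dP i j x) = m" "dim_row (F2 x) = n" "dim_col (F2 x) = m"
  unfolding S_def P_def dP_def F2_def by auto

private lemma QS: "Q\<^sup>T * S = 0\<^sub>m q n"
proof -
  have "Q\<^sup>T * S = (Q\<^sup>T * W) * W\<^sup>T" unfolding S_def by (simp add: mat_assoc)
  thus ?thesis unfolding W(2) by simp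
qed

text \<open>The derivative of \<open>F2\<close> in the entry \<open>(i, j)\<close> of \<open>Y\<close> consists of \<open>S E P\<close> and of six terms in which \<open>E\<close> or
  its transpose is multiplied by \<open>Q\<close>. The latter contribute nothing to the divergence, as \<open>Q\<^sup>T S = 0\<close>.\<close>

private lemma zero1:
  assumes "dim_row A = n" "dim_col A = q"
  shows "mtr (S * (A * Q\<^sup>T)) = 0"
proof -
  have "mtr (S * (A * Q\<^sup>T)) = mtr ((S * A) * Q\<^sup>T)"
    using assms by (simp add: mat_assoc)
  also have "\<dots> = mtr ((Q\<^sup>T * S) * A)"
    using assms by (subst mtr_comm) (simp_all add: mat_assoc)
  also have "\<dots> = 0" unfolding QS using assms by simp
  finally show ?thesis .
qed

private lemma zero2:
  assumes "dim_row A = n" "dim_col A = m" "dim_row B = q" "dim_col B = m"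
  shows "mtr ((S * A)\<^sup>T * (Q * B)) = 0"
proof -
  have "(Q\<^sup>T * S)\<^sup>T = 0\<^sub>m n q" unfolding QS by simp
  hence SQ: "S\<^sup>T * Q = 0\<^sub>m n q" by (simp add: mat_transpose_mult)
  have "(S * A)\<^sup>T * (Q * B) = A\<^sup>T * ((S\<^sup>T * Q) * B)"
    using assms by (simp add: mat_transpose_mult mat_assoc)
  thus ?thesis unfolding SQ using assms by simp
qed

text \<open>Term \<open>?t1\<close> comes from differentiating Y, \<open>?t2\<close> from the first
  G in \<open>P\<close>, \<open>?t3\<close> and \<open>?t4\<close> from the first K,
  \<open>?t5\<close> and \<open>?t6\<close> from the second K, and \<open>?t7\<close> from the last
  factor.\<close>

private lemma D2_eq: "D2 i j x = S * (E i j * P x)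
   + S * Y x * ((E i j)\<^sup>T * (Q * (K x * (K x * (G x)\<^sup>T))))
   - S * (Y x * (G x * K x) * Q\<^sup>T) * (E i j * (G x * (K x * (K x * (G x)\<^sup>T))))
   - S * (Y x * (G x * (K x * (G x)\<^sup>T))) * ((E i j)\<^sup>T * (Q * (K x * (K x * (G x)\<^sup>T))))
   - S * (Y x * (G x * (K x * K x)) * Q\<^sup>T) * (E i j * (G x * (K x * (G x)\<^sup>T)))
   - S * (Y x * (G x * (K x * (K x * (G x)\<^sup>T)))) * ((E i j)\<^sup>T * (Q * (K x * (G x)\<^sup>T)))
   + S * (Y x * (G x * (K x * K x)) * Q\<^sup>T) * (E i j * 1\<^sub>m m)"
  (is "_ = ?t1 + ?t2 - ?t3 - ?t4 - ?t5 - ?t6 + ?t7")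
proof -
  have "D2 i j x = ?t1 + (?t2 + (- (?t3 + ?t4) + (- (?t5 + ?t6) + ?t7)))"
    unfolding D2_def dP_def dK_def dG_def
    by (simp add: mat_alg mat_add_mult mat_mult_add mat_uminus_mult mat_mult_uminus)
  thus ?thesis by (intro eq_matI) (auto simp del: index_mult_mat(1))
qed

private lemma div2: "(\<Sum>i<n. \<Sum>j<m. D2 i j x $$ (i, j)) = mtr S * mtr (P x)"
proof -
  let ?t2 = "S * Y x" and ?u2 = "Q * (K x * (K x * (G x)\<^sup>T))"
  let ?t3 = "S * (Y x * (G x * K x) * Q\<^sup>T)"
  let ?t4 = "S * (Y x * (G x * (K x * (G x)\<^sup>T)))"
  let ?t5 = "S * (Y x * (G x * (K x * K x)) * Q\<^sup>T)" and ?u5 = "G x * (K x * (G x)\<^sup>T)"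
  let ?t6 = "S * (Y x * (G x * (K x * (K x * (G x)\<^sup>T))))" and ?u6 = "Q * (K x * (G x)\<^sup>T)"
  have "(\<Sum>i<n. \<Sum>j<m. D2 i j x $$ (i, j)) =
     (\<Sum>i<n. \<Sum>j<m. (S * (unit_mat n m i j * P x)) $$ (i, j)
        + (?t2 * ((unit_mat n m i j)\<^sup>T * ?u2)) $$ (i, j)
        - (?t3 * (unit_mat n m i j * (G x * (K x * (K x * (G x)\<^sup>T))))) $$ (i, j)
        - (?t4 * ((unit_mat n m i j)\<^sup>T * ?u2)) $$ (i, j)
        - (?t5 * (unit_mat n m i j * ?u5)) $$ (i, j)
        - (?t6 * ((unit_mat n m i j)\<^sup>T * ?u6)) $$ (i, j)
        + (?t5 * (unit_mat n m i j * 1\<^sub>m m)) $$ (i, j))"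
    unfolding D2_eq by (intro sum.cong refl) (auto simp: E_def simp del: index_mult_mat(1))
  also have "\<dots> = mtr S * mtr (P x) + mtr (?t2\<^sup>T * ?u2)
     - mtr ?t3 * mtr (G x * (K x * (K x * (G x)\<^sup>T))) - mtr (?t4\<^sup>T * ?u2)
     - mtr ?t5 * mtr ?u5 - mtr (?t6\<^sup>T * ?u6) + mtr ?t5 * mtr (1\<^sub>m m)"
    by (simp add: sum.distrib sum_subtractf sum_unit_trace_trace sum_unit_transpose_trace sum_unit_trace mat_right_one mtr_one del: index_mult_mat(1))
  also have "\<dots> = mtr S * mtr (P x)"
    by (simp add: zero1 zero2)
  finally show ?thesis .
qed

text \<open>Cyclicity of the trace turns the pairing into the very quantity to be estimated, which
  explains the choice of \<open>F2\<close>.\<close>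

private lemma mfro2_KGYW: "mtr ((Y x)\<^sup>T * F2 x) = mfro2 (K x * (G x)\<^sup>T * ((Y x)\<^sup>T * W))"
proof -
  have "mfro2 (K x * (G x)\<^sup>T * ((Y x)\<^sup>T * W)) =
     mtr ((K x * (G x)\<^sup>T) * ((Y x)\<^sup>T * (S * (Y x * (G x * K x)))))"
    unfolding mfro2_mtr S_def by (simp add: mat_alg K_sym)
  also have "\<dots> = mtr (((Y x)\<^sup>T * (S * (Y x * (G x * K x)))) * (K x * (G x)\<^sup>T))"
    by (rule mtr_comm) auto
  also have "\<dots> = mtr ((Y x)\<^sup>T * F2 x)"
    unfolding F2_def P_def by (simp add: mat_assoc)
  finally show ?thesis ..
qed

text \<open>As Q^T W = 0, the matrices Y^T Q and Y^T W are independent, and conditioning on the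
  first would replace Y^T W by |W|^2 in the mean. The divergence of \<open>F2\<close> yields the
  same identity without any conditioning.\<close>

lemma gauss_reg_pinv_cross_bound:
  "(\<integral>x. mfro2 (reg_inv e ((entry_mat n m x)\<^sup>T * Q) * ((entry_mat n m x)\<^sup>T * Q)\<^sup>T
        * ((entry_mat n m x)\<^sup>T * W)) \<partial>gauss ({0..<n} \<times> {0..<m}))
   \<le> mfro2 W * (\<integral>x. mtr (reg_inv e ((entry_mat n m x)\<^sup>T * Q)) \<partial>gauss ({0..<n} \<times> {0..<m}))"
  "integrable (gauss ({0..<n} \<times> {0..<m}))
     (\<lambda>x. mfro2 (reg_inv e ((entry_mat n m x)\<^sup>T * Q) * ((entry_mat n m x)\<^sup>T * Q)\<^sup>T
        * ((entry_mat n m x)\<^sup>T * W)))"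
proof -
  have SC: "S \<in> carrier_mat n n" by (auto intro: carrier_matI)
  have pbP: "mat_pb I m m P"
    unfolding P_def[abs_def]
    by (intro mat_pb_mult[OF pb_G] mat_pb_mult[OF pb_K] mat_pb_mult[OF pb_K mat_pb_transpose[OF pb_G]])
  have pbF: "mat_pb I n m F2"
    unfolding F2_def[abs_def] by (intro mat_pb_mult[OF mat_pb_const[OF SC]] mat_pb_mult[OF pb_Y pbP])
  have pbdP: "mat_pb I m m (dP i j)" for i j
    unfolding dP_def[abs_def]
    by (intro mat_pb_add mat_pb_mult[OF pb_dG] mat_pb_mult[OF pb_G] mat_pb_mult[OF pb_dK] mat_pb_mult[OF pb_K]
        mat_pb_transpose[OF pb_G] mat_pb_transpose[OF pb_dG])
  have pbD: "mat_pb I n m (D2 i j)" for i j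
    unfolding D2_def[abs_def]
    by (intro mat_pb_mult[OF mat_pb_const[OF SC]] mat_pb_add mat_pb_mult[OF pb_E pbP] mat_pb_mult[OF pb_Y pbdP])
  have der: "mat_deriv n m (\<lambda>s. F2 (x((i, j) := s))) (D2 i j (x((i, j) := t))) t" if "i < n" "j < m" for i j x t
    unfolding F2_def D2_def P_def dP_def
    by (intro mat_deriv_mult_left[OF _ SC] mat_deriv_mult[OF der_Y] mat_deriv_mult[OF der_G]
        mat_deriv_mult[OF der_K] mat_deriv_transpose[OF der_G] that)
  have 1: "(\<integral>x. mtr ((Y x)\<^sup>T * F2 x) \<partial>gauss I) = (\<integral>x. (\<Sum>i<n. \<Sum>j<m. D2 i j x $$ (i, j)) \<partial>gauss I)"
    unfolding I_def Y_def by (rule mat_gauss_integral_by_parts) (use pbF pbD der in \<open>auto simp: I_def\<close>)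
  have PK: "mtr (P x) \<le> mtr (K x)" for x
  proof -
    have "mtr (P x) = mtr ((K x * (G x)\<^sup>T) * (G x * K x))"
      unfolding P_def by (subst mtr_comm) (simp_all add: mat_assoc, subst mtr_comm, simp_all add: mat_assoc)
    also have "\<dots> = mfro2 (K x * (G x)\<^sup>T)" unfolding mfro2_mtr by (simp add: mat_alg K_sym)
    also have "\<dots> \<le> mtr (K x)" unfolding K_def by (rule mfro2_reg_pinv_le[OF e])
    finally show ?thesis .
  qed
  have iP: "integrable (gauss I) (\<lambda>x. mtr (P x))"
    by (intro poly_bounded_integrable mat_pb_mtr[OF pbP]) (auto simp: I_def)
  have "(\<integral>x. mfro2 (K x * (G x)\<^sup>T * ((Y x)\<^sup>T * W)) \<partial>gauss I) = mtr S * (\<integral>x. mtr (P x) \<partial>gauss I)"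
    unfolding mfro2_KGYW[symmetric] 1 div2 by simp
  also have "\<dots> \<le> mtr S * (\<integral>x. mtr (K x) \<partial>gauss I)"
    by (intro mult_left_mono integral_mono iP integrable_mtr_K PK) (simp add: S_def mfro2_mtr[symmetric])
  also have "mtr S = mfro2 W" unfolding S_def mfro2_mtr ..
  finally show "(\<integral>x. mfro2 (reg_inv e ((entry_mat n m x)\<^sup>T * Q) * ((entry_mat n m x)\<^sup>T * Q)\<^sup>T
        * ((entry_mat n m x)\<^sup>T * W)) \<partial>gauss ({0..<n} \<times> {0..<m}))
   \<le> mfro2 W * (\<integral>x. mtr (reg_inv e ((entry_mat n m x)\<^sup>T * Q)) \<partial>gauss ({0..<n} \<times> {0..<m}))"
    unfolding K_def G_def Y_def I_def .
  have "integrable (gauss I) (\<lambda>x. mtr ((Y x)\<^sup>T * F2 x))"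
    by (intro poly_bounded_integrable mat_pb_mtr[OF mat_pb_mult[OF mat_pb_transpose[OF pb_Y] pbF]]) (auto simp: I_def)
  thus "integrable (gauss ({0..<n} \<times> {0..<m}))
     (\<lambda>x. mfro2 (reg_inv e ((entry_mat n m x)\<^sup>T * Q) * ((entry_mat n m x)\<^sup>T * Q)\<^sup>T
        * ((entry_mat n m x)\<^sup>T * W)))"
    unfolding mfro2_KGYW unfolding K_def G_def Y_def I_def .
qed

end

end

lemma mat_meas_entry_mat: "mat_meas (gauss ({0..<n} \<times> {0..<m})) n m (entry_mat n m)"
  using mat_pb_meas[OF mat_pb_entry_mat] unfolding mat_meas_def measurable_gauss
  by (simp add: gauss_def space_PiM)

text \<open>Markov's inequality: on the singular set the trace is at least 1 / e, while its
  expectation stays below c for all e. So the probability is at most e c for every e > 0.\<close>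

lemma gauss_full_rank:
  assumes Q: "Q \<in> carrier_mat n q" "orthocols Q" and qm: "q + 2 \<le> m"
  defines "G \<equiv> \<lambda>x. (entry_mat n m x)\<^sup>T * Q"
  shows "AE x in gauss ({0..<n} \<times> {0..<m}). det ((G x)\<^sup>T * G x) \<noteq> 0"
proof -
  let ?g = "gauss ({0..<n} \<times> {0..<m})"
  interpret prob_space ?g by (rule prob_space_gauss)
  have G: "mat_meas ?g m q G"
    unfolding G_def by (intro mat_meas_mult[OF mat_meas_transpose[OF mat_meas_entry_mat]] mat_meas_const Q)
  have dm [measurable]: "(\<lambda>x. det ((G x)\<^sup>T * G x)) \<in> borel_measurable ?g"
    by (rule mat_meas_det[OF mat_meas_mult[OF mat_meas_transpose[OF G] G]])
  define A where "A = {x \<in> space ?g. det ((G x)\<^sup>T * G x) = 0}"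
  have A [measurable]: "A \<in> events" unfolding A_def by measurable
  define c where "c = real q / (real m - real q - 1)"
  have pA: "prob A \<le> e * c" if e: "0 < e" for e
  proof -
    have "1 / e * prob A = (\<integral>x. 1 / e * indicator A x \<partial>?g)" by simp
    also have "\<dots> \<le> (\<integral>x. mtr (reg_inv e (G x)) \<partial>?g)"
    proof (rule integral_mono)
      show "integrable ?g (\<lambda>x. mtr (reg_inv e (G x)))"
        unfolding G_def by (rule gauss_reg_inv_trace_bound(2)[OF Q e])
      show "1 / e * indicator A x \<le> mtr (reg_inv e (G x))" for x
        using mtr_reg_inv_singular[OF _ e, of "G x"] mtr_reg_inv_nonneg[OF e, of "G x"]
        by (auto simp: indicator_def A_def)
    qed (simp add: less_top[symmetric])
    also have "\<dots> \<le> c"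
      using gauss_reg_inv_trace_bound(1)[OF Q e, of m] qm unfolding G_def c_def by (simp add: field_simps)
    finally show ?thesis using e by (simp add: field_simps)
  qed
  have "prob A \<le> 0 + e" if "0 < e" for e :: real
  proof -
    have c: "c \<ge> 0" unfolding c_def using qm by simp
    have "prob A \<le> (e / (c + 1)) * c" by (rule pA) (use that c in auto)
    also have "\<dots> \<le> e" using that c by (simp add: field_simps)
    finally show ?thesis by simp
  qed
  hence "prob A \<le> 0" by (rule field_le_epsilon)
  hence "emeasure ?g A = 0" by (simp add: emeasure_eq_measure measure_le_0_iff)
  thus ?thesis
    by (subst AE_iff_measurable[OF A]) (auto simp: A_def)
qed

text \<open>Fatou's lemma along e = 1 / (k + 1): the regularized integrals obey a bound independent
  of e, and the integrands converge at every point. This avoids the search for an integrable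
  majorant.\<close>

theorem gauss_pinv_bound:
  assumes Q: "Q \<in> carrier_mat n q" "orthocols Q" and qm: "q + 2 \<le> m"
    and W: "W \<in> carrier_mat n w" "Q\<^sup>T * W = 0\<^sub>m q w"
  shows "(\<integral>\<^sup>+x. ennreal (mfro2 (pinv ((entry_mat n m x)\<^sup>T * Q) * ((entry_mat n m x)\<^sup>T * W)))
     \<partial>gauss ({0..<n} \<times> {0..<m})) \<le> ennreal (real q / (real m - real q - 1) * mfro2 W)"
proof -
  let ?g = "gauss ({0..<n} \<times> {0..<m})"
  define c where "c = real q / (real m - real q - 1)"
  define G where "G = (\<lambda>x. (entry_mat n m x)\<^sup>T * Q)"
  define H where "H = (\<lambda>x. (entry_mat n m x)\<^sup>T * W)"
  define \<epsilon> where "\<epsilon> k = 1 / real (Suc k)" for k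
  have \<epsilon>: "0 < \<epsilon> k" for k unfolding \<epsilon>_def by simp
  have G: "mat_meas ?g m q G"
    unfolding G_def by (intro mat_meas_mult[OF mat_meas_transpose[OF mat_meas_entry_mat]] mat_meas_const Q)
  have H: "mat_meas ?g m w H"
    unfolding H_def by (intro mat_meas_mult[OF mat_meas_transpose[OF mat_meas_entry_mat]] mat_meas_const W)
  have Gd: "dim_row (G x) = m" "dim_col (G x) = q" "dim_row (H x) = m" "dim_col (H x) = w" for x
    unfolding G_def H_def using Q W by auto
  define R where "R k x = reg_inv (\<epsilon> k) (G x) * (G x)\<^sup>T * H x" for k x
  have Rm: "mat_meas ?g q w (R k)" for k
    unfolding R_def by (intro mat_meas_mult[OF mat_meas_mult[OF mat_meas_reg_inv[OF G] mat_meas_transpose[OF G]] H])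
  have Rd: "dim_row (R k x) = q" "dim_col (R k x) = w" for k x unfolding R_def using Gd by auto
  have \<epsilon>lim: "filterlim \<epsilon> (at_right 0) sequentially"
    unfolding filterlim_at \<epsilon>_def using LIMSEQ_Suc[OF lim_1_over_n[where 'a = real]] by simp
  have lim: "(\<lambda>k. mfro2 (R k x)) \<longlonglongrightarrow> mfro2 (pinv (G x) * H x)" for x
  proof -
    have e: "(\<lambda>k. R k x $$ (i, j)) \<longlonglongrightarrow> (pinv (G x) * H x) $$ (i, j)" if ij: "i < q" "j < w" for i j
    proof -
      have "(\<lambda>k. \<Sum>l<m. (reg_inv (\<epsilon> k) (G x) * (G x)\<^sup>T) $$ (i, l) * H x $$ (l, j))
        \<longlonglongrightarrow> (\<Sum>l<m. pinv (G x) $$ (i, l) * H x $$ (l, j))"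
        by (intro tendsto_sum tendsto_mult_right filterlim_compose[OF reg_pinv_tendsto \<epsilon>lim]) (use Gd ij in auto)
      moreover have "R k x $$ (i, j) = (\<Sum>l<m. (reg_inv (\<epsilon> k) (G x) * (G x)\<^sup>T) $$ (i, l) * H x $$ (l, j))" for k
        unfolding R_def using Gd ij by (subst mult_mat_entry) auto
      moreover have "(pinv (G x) * H x) $$ (i, j) = (\<Sum>l<m. pinv (G x) $$ (i, l) * H x $$ (l, j))"
        using Gd ij by (subst mult_mat_entry) auto
      ultimately show ?thesis by simp
    qed
    have "(\<lambda>k. \<Sum>i<q. \<Sum>j<w. (R k x $$ (i, j))\<^sup>2) \<longlonglongrightarrow> (\<Sum>i<q. \<Sum>j<w. ((pinv (G x) * H x) $$ (i, j))\<^sup>2)"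
      by (intro tendsto_sum tendsto_power e) auto
    thus ?thesis unfolding mfro2_def using Rd Gd by simp
  qed
  have bound: "(\<integral>\<^sup>+x. ennreal (mfro2 (R k x)) \<partial>?g) \<le> ennreal (c * mfro2 W)" for k
  proof -
    have i: "integrable ?g (\<lambda>x. mfro2 (R k x))"
      unfolding R_def G_def H_def by (rule gauss_reg_pinv_cross_bound(2)[OF Q \<epsilon> W])
    have "(\<integral>x. mfro2 (R k x) \<partial>?g) \<le> mfro2 W * (\<integral>x. mtr (reg_inv (\<epsilon> k) (G x)) \<partial>?g)"
      unfolding R_def G_def H_def by (rule gauss_reg_pinv_cross_bound(1)[OF Q \<epsilon> W])
    also have "\<dots> \<le> mfro2 W * c"
    proof (rule mult_left_mono)
      show "(\<integral>x. mtr (reg_inv (\<epsilon> k) (G x)) \<partial>?g) \<le> c"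
        using gauss_reg_inv_trace_bound(1)[OF Q \<epsilon>, of m] qm unfolding G_def c_def by (simp add: field_simps)
    qed simp
    finally have "(\<integral>x. mfro2 (R k x) \<partial>?g) \<le> c * mfro2 W" by (simp add: mult.commute)
    thus ?thesis by (subst nn_integral_eq_integral[OF i]) (auto intro: ennreal_leI)
  qed
  have "(\<integral>\<^sup>+x. ennreal (mfro2 (pinv (G x) * H x)) \<partial>?g) = (\<integral>\<^sup>+x. liminf (\<lambda>k. ennreal (mfro2 (R k x))) \<partial>?g)"
    by (intro nn_integral_cong lim_imp_Liminf[symmetric] tendsto_ennrealI lim) simp
  also have "\<dots> \<le> liminf (\<lambda>k. \<integral>\<^sup>+x. ennreal (mfro2 (R k x)) \<partial>?g)"
    by (intro nn_integral_liminf measurable_compose[OF mat_meas_mfro2[OF Rm] measurable_ennreal])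
  also have "\<dots> \<le> ennreal (c * mfro2 W)"
    using bound by (intro Liminf_le) auto
  finally show ?thesis unfolding G_def H_def c_def .
qed

section \<open>Error of a single sketched projection\<close>

text \<open>Jensen's inequality from f \<le> f^2 / (2 s) + s / 2. The choice s = c would give the
  claim at once but fails for c = 0, so s = c + e is used with arbitrary e > 0.\<close>

lemma nn_integral_le_of_square:
  assumes "prob_space M" and [measurable]: "f \<in> borel_measurable M" and f: "\<And>x. x \<in> space M \<Longrightarrow> 0 \<le> f x"
    and c: "0 \<le> c" and le: "(\<integral>\<^sup>+x. ennreal ((f x)\<^sup>2) \<partial>M) \<le> ennreal (c\<^sup>2)"
  shows "(\<integral>\<^sup>+x. ennreal (f x) \<partial>M) \<le> ennreal c"
proof (rule ennreal_le_epsilon)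
  fix e :: real assume e: "0 < e"
  interpret prob_space M by fact
  define s where "s = c + e"
  have s: "0 < s" unfolding s_def using c e by simp
  have "(\<integral>\<^sup>+x. ennreal (f x) \<partial>M) \<le> (\<integral>\<^sup>+x. ennreal (1 / (2 * s)) * ennreal ((f x)\<^sup>2) + ennreal (s / 2) \<partial>M)"
  proof (rule nn_integral_mono)
    fix x assume x: "x \<in> space M"
    have "0 \<le> (f x - s)\<^sup>2" by simp
    hence "2 * s * f x \<le> (f x)\<^sup>2 + s\<^sup>2" by (simp add: power2_eq_square algebra_simps)
    hence "f x \<le> 1 / (2 * s) * (f x)\<^sup>2 + s / 2" using s by (simp add: field_simps power2_eq_square)
    hence "ennreal (f x) \<le> ennreal (1 / (2 * s) * (f x)\<^sup>2 + s / 2)" by (rule ennreal_leI)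
    also have "\<dots> = ennreal (1 / (2 * s)) * ennreal ((f x)\<^sup>2) + ennreal (s / 2)"
      using s by (simp only: ennreal_mult[symmetric] ennreal_plus[symmetric] zero_le_power2 divide_nonneg_pos
          mult_nonneg_nonneg mult_pos_pos zero_less_numeral less_imp_le zero_le_one)
    finally show "ennreal (f x) \<le> ennreal (1 / (2 * s)) * ennreal ((f x)\<^sup>2) + ennreal (s / 2)" .
  qed
  also have "\<dots> = ennreal (1 / (2 * s)) * (\<integral>\<^sup>+x. ennreal ((f x)\<^sup>2) \<partial>M) + ennreal (s / 2)"
    by (subst nn_integral_add) (auto simp: nn_integral_cmult emeasure_space_1)
  also have "\<dots> \<le> ennreal (1 / (2 * s)) * ennreal (c\<^sup>2) + ennreal (s / 2)"
    using le by (intro add_mono mult_left_mono) auto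
  also have "\<dots> = ennreal (1 / (2 * s) * c\<^sup>2 + s / 2)"
    using s by (simp only: ennreal_mult[symmetric] ennreal_plus[symmetric] zero_le_power2 divide_nonneg_pos
        mult_nonneg_nonneg mult_pos_pos zero_less_numeral less_imp_le zero_le_one)
  also have "\<dots> \<le> ennreal (c + e)"
  proof (rule ennreal_leI)
    have "c\<^sup>2 \<le> s\<^sup>2" using c e unfolding s_def by (intro power_mono) auto
    hence "1 / (2 * s) * c\<^sup>2 \<le> 1 / (2 * s) * s\<^sup>2" using s by (intro mult_left_mono) auto
    also have "\<dots> = s / 2" using s by (simp add: power2_eq_square)
    finally have "1 / (2 * s) * c\<^sup>2 + s / 2 \<le> s" by simp
    thus "1 / (2 * s) * c\<^sup>2 + s / 2 \<le> c + e" by (simp only: s_def)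
  qed
  also have "\<dots> = ennreal c + ennreal e" using c e by simp
  finally show "(\<integral>\<^sup>+x. ennreal (f x) \<partial>M) \<le> ennreal c + ennreal e" .
qed

definition sketch_proj :: "real mat \<Rightarrow> real mat \<Rightarrow> real mat \<Rightarrow> real mat" where
  "sketch_proj A X Y = A * X * pinv (Y\<^sup>T * A * X) * Y\<^sup>T"

text \<open>The projection depends on A X only through its range: with A X = Q R the pseudoinverse
  contributes the factor \<open>R'\<close>, and R R' cancels.\<close>

lemma sketch_proj_eq:
  assumes "dim_row X = dim_col A" "dim_row Y = dim_row A"
    and "A * X = Q * R" "dim_row Q = dim_row A" "dim_col Q = dim_row R" "dim_col R = dim_col X"
    and "dim_row R' = dim_col R" "dim_col R' = dim_row R"
    and "R * R' = 1\<^sub>m (dim_row R)" "(R' * R)\<^sup>T = R' * R"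
    and "det ((Y\<^sup>T * Q)\<^sup>T * (Y\<^sup>T * Q)) \<noteq> 0"
  shows "sketch_proj A X Y = Q * (pinv (Y\<^sup>T * Q) * Y\<^sup>T)"
proof -
  let ?G = "Y\<^sup>T * Q"
  note d = assms(1,2,4-8)
  have "pinv ?G * ?G = 1\<^sub>m (dim_col ?G)" by (rule pinv_full_rank[OF assms(11)])
  hence p: "pinv (?G * R) = R' * pinv ?G"
    using d assms(9,10) by (intro pinv_mult_right_invertible) auto
  have "Y\<^sup>T * A * X = Y\<^sup>T * (A * X)" using d by (simp add: mat_assoc)
  also have "\<dots> = ?G * R" unfolding assms(3) using d by (simp add: mat_assoc)
  finally have "sketch_proj A X Y = (Q * R) * (R' * pinv ?G) * Y\<^sup>T"
    unfolding sketch_proj_def assms(3) p[symmetric] by simp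
  also have "\<dots> = Q * ((R * R') * (pinv ?G * Y\<^sup>T))"
    using d by (simp add: mat_assoc)
  finally show ?thesis unfolding assms(9) using d by (simp add: mat_alg)
qed

lemma mat_uminus_zero: "- 0\<^sub>m a b = (0\<^sub>m a b :: real mat)"
  by (intro eq_matI) auto

text \<open>The rank q of A X may be below r. The Gaussian bound grows with q, and at q = r its
  denominator is p - 1.\<close>

lemma sketch_ratio_mono:
  assumes "q \<le> r" "1 < p"
  shows "real q / (real (r + p) - real q - 1) \<le> real r / (real p - 1)"
  using assms by (intro frac_le) auto

text \<open>Since G^+ G = 1, the projection fixes the range of Q. It therefore reproduces Q Q^T S,
  and only its action on the orthogonal remainder depends on \<open>y\<close>; \<open>N\<close>
  holds the coordinates of that part with respect to Q.\<close>

lemma sketch_proj_split: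
  fixes A X S :: "real mat"
  assumes A: "A \<in> carrier_mat a b" and X: "X \<in> carrier_mat b r" and S: "S \<in> carrier_mat a c" and p: "1 < p"
  defines "g \<equiv> gauss ({0..<a} \<times> {0..<r + p})"
  obtains q Q R N where "Q \<in> carrier_mat a q" "orthocols Q" "R \<in> carrier_mat q r" "A * X = Q * R"
    "\<And>y. N y \<in> carrier_mat q c" "(\<lambda>y. mfro2 (N y)) \<in> borel_measurable g"
    "AE y in g. sketch_proj A X (entry_mat a (r + p) y) * S = Q * (Q\<^sup>T * S) + Q * N y"
    "(\<integral>\<^sup>+y. ennreal (mfro2 (N y)) \<partial>g) \<le> ennreal (real r / (real p - 1) * mfro2 (S - Q * (Q\<^sup>T * S)))"
proof -
  let ?Y = "entry_mat a (r + p)"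
  obtain q Q R R' where *: "q \<le> dim_col (A * X)" "Q \<in> carrier_mat (dim_row (A * X)) q" "orthocols Q"
    "R \<in> carrier_mat q (dim_col (A * X))" "R' \<in> carrier_mat (dim_col (A * X)) q"
    "A * X = Q * R" "R * R' = 1\<^sub>m q" "(R' * R)\<^sup>T = R' * R"
    by (rule orthonormal_factorization)
  have d: "dim_row A = a" "dim_col A = b" "dim_row X = b" "dim_col X = r" "dim_row S = a" "dim_col S = c"
    using A X S by auto
  have dQ: "q \<le> r" "dim_row Q = a" "dim_col Q = q" "dim_row R = q" "dim_col R = r" "dim_row R' = r" "dim_col R' = q"
    using *(1,2,4,5) d by auto
  have QC: "Q \<in> carrier_mat a q" "R \<in> carrier_mat q r" using dQ by (auto intro: carrier_matI)
  define W where "W = S - Q * (Q\<^sup>T * S)"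
  have W: "W \<in> carrier_mat a c" unfolding W_def using d dQ by (intro carrier_matI) auto
  have QW: "Q\<^sup>T * W = 0\<^sub>m q c" unfolding W_def using ortho_complement[OF *(3), of S] d dQ by simp
  have S_eq: "S = Q * (Q\<^sup>T * S) + W" unfolding W_def using d dQ by (intro eq_matI) auto
  let ?G = "\<lambda>y. (?Y y)\<^sup>T * Q"
  let ?N = "\<lambda>y. pinv (?G y) * ((?Y y)\<^sup>T * W)"
  have mG: "mat_meas g (r + p) q ?G"
    unfolding g_def by (intro mat_meas_mult[OF mat_meas_transpose[OF mat_meas_entry_mat]] mat_meas_const QC)
  have mN: "mat_meas g q c ?N"
    unfolding g_def
    by (intro mat_meas_mult[OF mat_meas_pinv[OF mG[unfolded g_def]]]
        mat_meas_mult[OF mat_meas_transpose[OF mat_meas_entry_mat]] mat_meas_const W)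
  have pt: "sketch_proj A X (?Y y) * S = Q * (Q\<^sup>T * S) + Q * ?N y"
    if nz: "det ((?G y)\<^sup>T * ?G y) \<noteq> 0" for y
  proof -
    have PG: "pinv (?G y) * ?G y = 1\<^sub>m q" using pinv_full_rank[OF nz] dQ by simp
    have "sketch_proj A X (?Y y) = Q * (pinv (?G y) * (?Y y)\<^sup>T)"
      using d dQ nz *(7,8) by (intro sketch_proj_eq[OF _ _ *(6)]) auto
    hence "sketch_proj A X (?Y y) * S = Q * (pinv (?G y) * ((?Y y)\<^sup>T * (Q * (Q\<^sup>T * S) + W)))"
      using d dQ S_eq[symmetric] by (simp add: mat_assoc)
    also have "\<dots> = Q * ((pinv (?G y) * ?G y) * (Q\<^sup>T * S)) + Q * ?N y"
      using d dQ W by (simp add: mat_mult_add mat_assoc)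
    finally show ?thesis unfolding PG using d dQ by (simp add: mat_left_one)
  qed
  have "AE y in g. det ((?G y)\<^sup>T * ?G y) \<noteq> 0"
    unfolding g_def by (rule gauss_full_rank[OF QC(1) *(3)]) (use dQ p in auto)
  hence AE: "AE y in g. sketch_proj A X (?Y y) * S = Q * (Q\<^sup>T * S) + Q * ?N y"
    by eventually_elim (rule pt)
  have "(\<integral>\<^sup>+y. ennreal (mfro2 (?N y)) \<partial>g) \<le> ennreal (real q / (real (r + p) - real q - 1) * mfro2 W)"
    unfolding g_def by (rule gauss_pinv_bound[OF QC(1) *(3) _ W QW]) (use dQ p in auto)
  also have "\<dots> \<le> ennreal (real r / (real p - 1) * mfro2 W)"
    by (intro ennreal_leI mult_right_mono sketch_ratio_mono) (use dQ p in auto)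
  finally have N: "(\<integral>\<^sup>+y. ennreal (mfro2 (?N y)) \<partial>g) \<le> ennreal (real r / (real p - 1) * mfro2 W)" .
  have NC: "?N y \<in> carrier_mat q c" for y using dQ W by (intro carrier_matI) auto
  show ?thesis
  proof (rule that[OF QC(1) *(3) QC(2) *(6) NC mat_meas_mfro2[OF mN] AE])
    show "(\<integral>\<^sup>+y. ennreal (mfro2 (?N y)) \<partial>g) \<le> ennreal (real r / (real p - 1) * mfro2 (S - Q * (Q\<^sup>T * S)))"
      using N unfolding W_def .
  qed
qed

text \<open>Both parts of the split lie in the range of Q and need not be orthogonal, so the
  triangle inequality is applied first and Jensen's inequality only to the random part. This is the
  source of the sum in \<open>c_const\<close>.\<close>

lemma sketch_proj_apply_bound:
  assumes A: "A \<in> carrier_mat a b" and X: "X \<in> carrier_mat b r" and S: "S \<in> carrier_mat a c" and p: "1 < p"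
  shows "(\<integral>\<^sup>+y. ennreal (mfro (sketch_proj A X (entry_mat a (r + p) y) * S)) \<partial>gauss ({0..<a} \<times> {0..<r + p}))
    \<le> ennreal (c_const r p * mfro S)"
proof -
  let ?g = "gauss ({0..<a} \<times> {0..<r + p})" and ?P = "\<lambda>y. sketch_proj A X (entry_mat a (r + p) y)"
  interpret prob_space ?g by (rule prob_space_gauss)
  obtain q Q R N where Q: "Q \<in> carrier_mat a q" "orthocols Q"
    and NC: "\<And>y. N y \<in> carrier_mat q c" and mN [measurable]: "(\<lambda>y. mfro2 (N y)) \<in> borel_measurable ?g"
    and AE: "AE y in ?g. ?P y * S = Q * (Q\<^sup>T * S) + Q * N y"
    and N: "(\<integral>\<^sup>+y. ennreal (mfro2 (N y)) \<partial>?g) \<le> ennreal (real r / (real p - 1) * mfro2 (S - Q * (Q\<^sup>T * S)))"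
    by (rule sketch_proj_split[OF A X S p]) (rule that; assumption)
  have d: "dim_row Q = a" "dim_col Q = q" "dim_row S = a" "dim_col S = c" "\<And>y. dim_row (N y) = q" "\<And>y. dim_col (N y) = c"
    using Q S NC by auto
  have WS: "mfro2 (S - Q * (Q\<^sup>T * S)) \<le> mfro2 S" and QS: "mfro2 (Q\<^sup>T * S) \<le> mfro2 S"
    using mfro2_ortho_split[OF Q(2), of S] d mfro2_nonneg[of "Q\<^sup>T * S"] mfro2_nonneg[of "S - Q * (Q\<^sup>T * S)"] by auto
  have mN' [measurable]: "(\<lambda>y. mfro (N y)) \<in> borel_measurable ?g" unfolding mfro_def by measurable
  have rp: "0 \<le> real r / (real p - 1)" using p by simp
  have "(\<integral>\<^sup>+y. ennreal (mfro (N y)) \<partial>?g) \<le> ennreal (sqrt (real r / (real p - 1)) * mfro S)"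
  proof (rule nn_integral_le_of_square[OF prob_space_gauss mN'])
    have "(\<integral>\<^sup>+y. ennreal (mfro2 (N y)) \<partial>?g) \<le> ennreal (real r / (real p - 1) * mfro2 S)"
      by (rule order_trans[OF N]) (intro ennreal_leI mult_left_mono WS rp)
    thus "(\<integral>\<^sup>+y. ennreal ((mfro (N y))\<^sup>2) \<partial>?g) \<le> ennreal ((sqrt (real r / (real p - 1)) * mfro S)\<^sup>2)"
      using rp by (simp add: mfro_sq power_mult_distrib)
  qed (use rp in auto)
  hence le: "ennreal (mfro S) + (\<integral>\<^sup>+y. ennreal (mfro (N y)) \<partial>?g) \<le> ennreal (c_const r p * mfro S)"
    unfolding c_const_def distrib_right mult_1 using rp
    by (subst ennreal_plus) (auto intro: add_left_mono)
  have mono: "(\<integral>\<^sup>+y. ennreal (mfro (?P y * S)) \<partial>?g) \<le> (\<integral>\<^sup>+y. ennreal (mfro S) + ennreal (mfro (N y)) \<partial>?g)"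
  proof (rule nn_integral_mono_AE)
    show "AE y in ?g. ennreal (mfro (?P y * S)) \<le> ennreal (mfro S) + ennreal (mfro (N y))"
      using AE
    proof eventually_elim
      case (elim y)
      have "mfro (?P y * S) \<le> mfro (Q * (Q\<^sup>T * S)) + mfro (Q * N y)"
        unfolding elim using d by (intro mfro_triangle) auto
      also have "\<dots> = mfro (Q\<^sup>T * S) + mfro (N y)"
        unfolding mfro_def using d Q(2) by (simp add: mfro2_orthocols_mult)
      also have "\<dots> \<le> mfro S + mfro (N y)" unfolding mfro_def using QS by simp
      finally show ?case by (simp only: ennreal_plus[symmetric] mfro_nonneg ennreal_leI)
    qed
  qed
  have eq: "(\<integral>\<^sup>+y. ennreal (mfro S) + ennreal (mfro (N y)) \<partial>?g) = ennreal (mfro S) + (\<integral>\<^sup>+y. ennreal (mfro (N y)) \<partial>?g)"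
    by (subst nn_integral_add) (auto simp: emeasure_space_1)
  show ?thesis by (rule order_trans[OF mono[unfolded eq] le])
qed

text \<open>The remainder W is orthogonal to the range of Q, which contains Q N, so squared norms
  add. Moreover A X Z has its columns in the range of Q for every Z, and none of these matrices is
  closer to A than the orthogonal projection.\<close>

lemma sketch_proj_residual_bound:
  assumes A: "A \<in> carrier_mat a b" and X: "X \<in> carrier_mat b r" and Z: "Z \<in> carrier_mat r b" and p: "1 < p"
  shows "(\<integral>\<^sup>+y. ennreal (mfro2 (A - sketch_proj A X (entry_mat a (r + p) y) * A)) \<partial>gauss ({0..<a} \<times> {0..<r + p}))
    \<le> ennreal ((1 + real r / (real p - 1)) * mfro2 (A - A * (X * Z)))"
proof -
  let ?g = "gauss ({0..<a} \<times> {0..<r + p})" and ?P = "\<lambda>y. sketch_proj A X (entry_mat a (r + p) y)"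
  interpret prob_space ?g by (rule prob_space_gauss)
  obtain q Q R N where Q: "Q \<in> carrier_mat a q" "orthocols Q" and R: "R \<in> carrier_mat q r" "A * X = Q * R"
    and NC: "\<And>y. N y \<in> carrier_mat q b" and mN [measurable]: "(\<lambda>y. mfro2 (N y)) \<in> borel_measurable ?g"
    and AE: "AE y in ?g. ?P y * A = Q * (Q\<^sup>T * A) + Q * N y"
    and N: "(\<integral>\<^sup>+y. ennreal (mfro2 (N y)) \<partial>?g) \<le> ennreal (real r / (real p - 1) * mfro2 (A - Q * (Q\<^sup>T * A)))"
    by (rule sketch_proj_split[OF A X A p]) (rule that; assumption)
  have d: "dim_row Q = a" "dim_col Q = q" "dim_row A = a" "dim_col A = b" "dim_row X = b" "dim_col X = r"
    "dim_row R = q" "dim_col R = r" "dim_row Z = r" "dim_col Z = b" "\<And>y. dim_row (N y) = q" "\<And>y. dim_col (N y) = b"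
    using Q R(1) A X Z NC by auto
  have QQ: "Q\<^sup>T * Q = 1\<^sub>m q" using Q d unfolding orthocols_def by simp
  define W where "W = A - Q * (Q\<^sup>T * A)"
  have dW: "dim_row W = a" "dim_col W = b" unfolding W_def using d by auto
  have "(Q\<^sup>T * W)\<^sup>T = 0\<^sub>m b q" unfolding W_def using ortho_complement[OF Q(2), of A] d by simp
  hence WQ: "W\<^sup>T * Q = 0\<^sub>m b q" using dW d by (simp add: mat_transpose_mult)
  have pt: "mfro2 (A - ?P y * A) = mfro2 W + mfro2 (N y)" if "?P y * A = Q * (Q\<^sup>T * A) + Q * N y" for y
  proof -
    have "A - ?P y * A = W + - (Q * N y)"
      unfolding that W_def using d by (intro eq_matI) (auto simp del: index_mult_mat(1))
    also have "\<dots> = W + Q * (- N y)" using d by (subst mat_mult_uminus) auto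
    also have "mfro2 \<dots> = mfro2 W + mfro2 (Q * (- N y))"
    proof (rule mfro2_pythagoras)
      have "W\<^sup>T * (Q * (- N y)) = (W\<^sup>T * Q) * (- N y)"
        by (rule mat_assoc[symmetric]) (use dW d in auto)
      thus "W\<^sup>T * (Q * (- N y)) = 0\<^sub>m (dim_col (Q * (- N y))) (dim_col (Q * (- N y)))"
        unfolding WQ using d by (simp add: mat_uminus_zero)
    qed (use dW d in auto)
    also have "mfro2 (Q * (- N y)) = mfro2 (- N y)" using Q(2) d by (intro mfro2_orthocols_mult) auto
    also have "mfro2 (- N y) = mfro2 (N y)" unfolding mfro2_def by simp
    finally show ?thesis .
  qed
  have rp: "0 \<le> real r / (real p - 1)" using p by simp
  have "(\<integral>\<^sup>+y. ennreal (mfro2 (A - ?P y * A)) \<partial>?g) = (\<integral>\<^sup>+y. ennreal (mfro2 W) + ennreal (mfro2 (N y)) \<partial>?g)"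
  proof (rule nn_integral_cong_AE)
    show "AE y in ?g. ennreal (mfro2 (A - ?P y * A)) = ennreal (mfro2 W) + ennreal (mfro2 (N y))"
      using AE
    proof eventually_elim
      case (elim y)
      show ?case unfolding pt[OF elim] by (simp only: ennreal_plus[symmetric] mfro2_nonneg)
    qed
  qed
  also have "\<dots> = ennreal (mfro2 W) + (\<integral>\<^sup>+y. ennreal (mfro2 (N y)) \<partial>?g)"
    by (subst nn_integral_add) (auto simp: emeasure_space_1)
  also have "\<dots> \<le> ennreal (mfro2 W) + ennreal (real r / (real p - 1) * mfro2 W)"
    using N unfolding W_def by (rule add_left_mono)
  also have "\<dots> = ennreal ((1 + real r / (real p - 1)) * mfro2 W)"
    unfolding distrib_right mult_1 using rp
    by (intro ennreal_plus[symmetric] mult_nonneg_nonneg) auto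
  also have "\<dots> \<le> ennreal ((1 + real r / (real p - 1)) * mfro2 (A - A * (X * Z)))"
  proof (intro ennreal_leI mult_left_mono)
    let ?M = "A - A * (X * Z)"
    have AXZ: "A * (X * Z) = Q * (R * Z)"
    proof -
      have "A * (X * Z) = (A * X) * Z" using d by (simp add: mat_assoc)
      thus ?thesis unfolding R(2) using d by (simp add: mat_assoc)
    qed
    have "Q\<^sup>T * ?M = Q\<^sup>T * A - (Q\<^sup>T * Q) * (R * Z)"
      unfolding AXZ using d by (simp add: mat_mult_minus mat_assoc)
    also have "\<dots> = Q\<^sup>T * A - R * Z" unfolding QQ using d by (simp add: mat_left_one)
    finally have "Q * (Q\<^sup>T * ?M) = Q * (Q\<^sup>T * A) - Q * (R * Z)"
      using d by (simp add: mat_mult_minus)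
    hence "?M - Q * (Q\<^sup>T * ?M) = W"
      unfolding W_def AXZ using d by (intro eq_matI) (auto simp del: index_mult_mat(1))
    thus "mfro2 W \<le> mfro2 ?M"
      using mfro2_ortho_split[OF Q(2), of ?M] d mfro2_nonneg[of "Q\<^sup>T * ?M"] by simp
  qed (use rp in auto)
  finally show ?thesis .
qed

section \<open>Singular values, truncation and the Eckart-Young bound\<close>

lemma gram_eigenvalue_zero:
  assumes E: "E\<^sup>T * E = mdiag n l" "dim_col E = n"
    and l: "\<And>i. i < n \<Longrightarrow> 0 \<le> l i" "\<And>i j. i \<le> j \<Longrightarrow> j < n \<Longrightarrow> l j \<le> l i"
    and j: "dim_row E \<le> j" "j < n"
  shows "l j = 0"
proof (rule ccontr)
  assume "l j \<noteq> 0"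
  hence lj: "0 < l j" using l(1)[OF j(2)] by simp
  have pos: "0 < l i" if "i < Suc j" for i using l(2)[of i j] that j lj by simp
  let ?E = "firstcols E (Suc j)" and ?D = "mdiag (Suc j) (\<lambda>i. 1 / sqrt (l i))"
  have "(?E * ?D)\<^sup>T * (?E * ?D) = ?D * ((?E\<^sup>T * ?E) * ?D)"
    by (simp add: mat_alg transpose_mdiag)
  also have "?E\<^sup>T * ?E = mdiag (Suc j) l" by (rule firstcols_gram[OF E]) (use j in simp)
  also have "?D * (mdiag (Suc j) l * ?D) = 1\<^sub>m (Suc j)"
    unfolding mdiag_mult by (rule mdiag_one) (use pos in \<open>force simp: field_simps\<close>)
  \<comment> \<open>These are j + 1 orthonormal columns in a space of dimension at most j.\<close>
  finally have "orthocols (?E * ?D)" unfolding orthocols_def by simp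
  from orthocols_dim_le[OF this] j show False by simp
qed

lemma proots_prod_linear: "proots (\<Prod>a\<leftarrow>as. [:- a, 1:]) = mset (as :: real list)"
proof (induction as)
  case (Cons a as)
  have "(\<Prod>a\<leftarrow>as. [:- a, 1:]) \<noteq> (0 :: real poly)" by (auto simp: prod_list_zero_iff)
  moreover have "proots [:- a, 1:] = {#a#}" for a :: real
    using proots_linear_factor[of a] by simp
  ultimately have "proots ([:- a, 1:] * (\<Prod>a\<leftarrow>as. [:- a, 1:])) = {#a#} + mset as"
    using Cons by (subst proots_mult) auto
  thus ?case by (simp del: mult_pCons_left)
qed auto

text \<open>A^T A is similar to the diagonal matrix of \<open>l\<close>, so the roots of its
  characteristic polynomial are the \<open>l i\<close> with multiplicity. The index shift is due to
  the numbering of singular values from 1.\<close>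

lemma sing_val_eq:
  assumes V: "V \<in> carrier_mat (dim_col A) (dim_col A)" "orthocols V"
    "A\<^sup>T * A * V = V * mdiag (dim_col A) l"
    and l: "\<And>i. i < dim_col A \<Longrightarrow> 0 \<le> l i" "\<And>i j. i \<le> j \<Longrightarrow> j < dim_col A \<Longrightarrow> l j \<le> l i"
    and i: "1 \<le> i" "i \<le> min (dim_row A) (dim_col A)"
  shows "(sing_val A i)\<^sup>2 = l (i - 1)"
proof -
  let ?n = "dim_col A"
  have d: "dim_row V = ?n" "dim_col V = ?n" using V by auto
  have VV: "V * V\<^sup>T = 1\<^sub>m ?n" "V\<^sup>T * V = 1\<^sub>m ?n"
    using orthocols_square[OF V(2,1)] V(2) d unfolding orthocols_def by auto
  have "A\<^sup>T * A = A\<^sup>T * A * (V * V\<^sup>T)" unfolding VV by (simp add: mat_right_one)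
  also have "\<dots> = (A\<^sup>T * A * V) * V\<^sup>T" using d by (simp add: mat_assoc)
  also have "\<dots> = V * mdiag ?n l * V\<^sup>T" unfolding V(3) ..
  finally have "similar_mat_wit (A\<^sup>T * A) (mdiag ?n l) V (V\<^sup>T)"
    unfolding similar_mat_wit_def Let_def using VV d by (auto intro: carrier_matI)
  hence "char_poly (A\<^sup>T * A) = char_poly (mdiag ?n l)"
    by (intro char_poly_similar) (auto simp: similar_mat_def)
  also have "\<dots> = (\<Prod>a\<leftarrow>diag_mat (mdiag ?n l). [:- a, 1:])"
    by (rule char_poly_upper_triangular[of _ ?n]) (auto simp: mdiag_def)
  also have "diag_mat (mdiag ?n l) = map l [0..<?n]" unfolding diag_mat_def by (auto simp: mdiag_def)
  finally have "proots (char_poly (A\<^sup>T * A)) = mset (map l [0..<?n])"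
    by (simp only: proots_prod_linear)
  hence im: "image_mset sqrt (proots (char_poly (A\<^sup>T * A))) = mset (map (\<lambda>i. sqrt (l i)) [0..<?n])"
    by (simp add: multiset.map_comp comp_def)
  have "sort (map (\<lambda>i. sqrt (l i)) [0..<?n]) = rev (map (\<lambda>i. sqrt (l i)) [0..<?n])"
    by (rule properties_for_sort) (auto simp: sorted_rev_iff_nth_mono intro!: l(2))
  hence sv: "singular_values A = take (min (dim_row A) ?n) (map (\<lambda>i. sqrt (l i)) [0..<?n])"
    unfolding singular_values_def im sorted_list_of_multiset_mset by simp
  have "sing_val A i = sqrt (l (i - 1))"
  proof -
    have "i - 1 < min (dim_row A) ?n" "i - 1 < ?n" using i by auto
    thus ?thesis unfolding sing_val_def sv using i by (simp add: nth_take del: min_less_iff_conj)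
  qed
  moreover have "0 \<le> l (i - 1)" using i by (intro l(1)) auto
  ultimately show ?thesis by simp
qed

text \<open>Singular values stop at the smaller dimension, while \<open>l\<close> has one entry per
  column; the surplus entries vanish by \<open>gram_eigenvalue_zero\<close>.\<close>

lemma gram_tail:
  assumes V: "V \<in> carrier_mat (dim_col A) (dim_col A)" "orthocols V"
    "A\<^sup>T * A * V = V * mdiag (dim_col A) l"
    "(A * V)\<^sup>T * (A * V) = mdiag (dim_col A) l"
    and l: "\<And>i. i < dim_col A \<Longrightarrow> 0 \<le> l i" "\<And>i j. i \<le> j \<Longrightarrow> j < dim_col A \<Longrightarrow> l j \<le> l i"
  shows "(sv_tail A k)\<^sup>2 = (\<Sum>i\<in>{min k (dim_col A)..<dim_col A}. l i)"
proof -
  let ?n = "dim_col A" and ?m = "min (dim_row A) (dim_col A)"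
  have z: "l j = 0" if "dim_row A \<le> j" "j < ?n" for j
    by (rule gram_eigenvalue_zero[OF V(4) _ l]) (use that V in auto)
  have "(sv_tail A k)\<^sup>2 = (\<Sum>i\<in>{k<..?m}. (sing_val A i)\<^sup>2)"
    unfolding sv_tail_def by (simp add: sum_nonneg)
  also have "\<dots> = (\<Sum>i\<in>{k<..?m}. l (i - 1))"
    by (intro sum.cong refl sing_val_eq[OF V(1-3) l]) auto
  also have "\<dots> = (\<Sum>i\<in>{k..<?m}. l i)"
    by (rule sum.reindex_bij_witness[of _ Suc "\<lambda>i. i - 1"]) auto
  also have "\<dots> = (\<Sum>i\<in>{min k ?n..<?n}. l i)"
    by (rule sum.mono_neutral_left) (auto intro!: z)
  finally show ?thesis .
qed

lemma mfro2_cols: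
  assumes "\<And>j. j < dim_col E \<Longrightarrow> (\<Sum>i<dim_row E. (E $$ (i, j))\<^sup>2) = l j"
  shows "mfro2 E = (\<Sum>j<dim_col E. l j)"
  unfolding mfro2_def using assms by (subst sum.swap) simp

lemma mfro2_ortho_split_right:
  assumes "orthocols Q" "dim_row Q = dim_col A"
  shows "mfro2 A = mfro2 (A * Q) + mfro2 (A - A * Q * Q\<^sup>T)"
proof -
  let ?B = "A\<^sup>T"
  have 1: "mfro2 (Q\<^sup>T * ?B) = mfro2 (A * Q)"
    using mfro2_transpose[of "A * Q"] assms by (simp add: mat_transpose_mult)
  have "(A - A * Q * Q\<^sup>T)\<^sup>T = ?B - Q * (Q\<^sup>T * ?B)"
    using assms by (simp add: mat_alg)
  hence 2: "mfro2 (?B - Q * (Q\<^sup>T * ?B)) = mfro2 (A - A * Q * Q\<^sup>T)"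
    using mfro2_transpose[of "A - A * Q * Q\<^sup>T"] by simp
  show ?thesis using mfro2_ortho_split[OF assms(1), of ?B] assms unfolding 1 2 by (simp add: mfro2_transpose)
qed

text \<open>V consists of the leading right singular vectors. Their images under A have squared
  lengths \<open>l\<close>, so splitting off the first ones leaves exactly the tail of the
  sum.\<close>

lemma truncation_error:
  fixes A :: "real mat"
  obtains V where "V \<in> carrier_mat (dim_col A) (min k (dim_col A))" "orthocols V"
    "mfro2 (A - A * V * V\<^sup>T) = (sv_tail A k)\<^sup>2"
proof -
  let ?n = "dim_col A"
  obtain V l where V: "V \<in> carrier_mat ?n ?n" "orthocols V"
    "A\<^sup>T * A * V = V * mdiag ?n l" "(A * V)\<^sup>T * (A * V) = mdiag ?n l"
    and l: "\<And>i. i < ?n \<Longrightarrow> 0 \<le> l i" "\<And>i j. i \<le> j \<Longrightarrow> j < ?n \<Longrightarrow> l j \<le> l i"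
    and s: "\<And>j. j < ?n \<Longrightarrow> (\<Sum>i<dim_row A. ((A * V) $$ (i, j))\<^sup>2) = l j"
    by (rule gram_spectral[of A]) blast
  have d: "dim_row V = ?n" "dim_col V = ?n" using V by auto
  let ?q = "min k ?n"
  let ?V = "firstcols V ?q"
  have o: "orthocols ?V" by (rule orthocols_firstcols[OF V(2)]) (use d in simp)
  have "mfro2 (A * V) = (\<Sum>j<?n. l j)" using mfro2_cols[of "A * V" l] s d by simp
  moreover have "mfro2 (A * V) \<le> mfro2 A" "mfro2 A \<le> mfro2 (A * V)"
  proof -
    show "mfro2 (A * V) \<le> mfro2 A" by (rule mfro2_mult_ortho_le[OF V(2)]) (use d in simp)
    have "mfro2 A = mfro2 (A * (V * V\<^sup>T))" unfolding orthocols_square[OF V(2,1)] by (simp add: mat_right_one)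
    also have "\<dots> = mfro2 (V * (A * V)\<^sup>T)"
      using d mfro2_transpose[of "A * (V * V\<^sup>T)"] by (simp add: mat_alg)
    also have "\<dots> = mfro2 ((A * V)\<^sup>T)" by (rule mfro2_orthocols_mult[OF V(2)]) (use d in simp)
    finally show "mfro2 A \<le> mfro2 (A * V)" by (simp add: mfro2_transpose)
  qed
  ultimately have mA: "mfro2 A = (\<Sum>j<?n. l j)" by linarith
  have "A * ?V = firstcols (A * V) ?q" using d by (intro mult_firstcols) auto
  hence "mfro2 (A * ?V) = (\<Sum>j<?q. l j)"
    using mfro2_cols[of "firstcols (A * V) ?q" l] s d by (simp add: firstcols_entry del: index_mult_mat(1))
  hence "mfro2 (A - A * ?V * ?V\<^sup>T) = (\<Sum>j<?n. l j) - (\<Sum>j<?q. l j)"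
    using mfro2_ortho_split_right[OF o, of A] d mA by simp
  also have "\<dots> = (\<Sum>j\<in>{?q..<?n}. l j)"
    using sum.atLeastLessThan_concat[of 0 ?q ?n l] by (simp add: lessThan_atLeast0)
  also have "\<dots> = (sv_tail A k)\<^sup>2" by (rule gram_tail[OF V l, symmetric])
  finally show ?thesis using o d by (intro that[of ?V]) (auto intro: carrier_matI)
qed

text \<open>Weights in [0, 1] of total mass q do best when they sit on the q largest values.
  Subtracting the threshold t = \<open>l q\<close> decides the sign of each term separately; for q =
  n there is no such value, and t = 0 will do.\<close>

lemma weighted_sum_le_leading:
  fixes l w :: "nat \<Rightarrow> real"
  assumes l: "\<And>i. i < n \<Longrightarrow> 0 \<le> l i" "\<And>i j. i \<le> j \<Longrightarrow> j < n \<Longrightarrow> l j \<le> l i"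
    and w: "\<And>i. i < n \<Longrightarrow> 0 \<le> w i" "\<And>i. i < n \<Longrightarrow> w i \<le> 1" "(\<Sum>i<n. w i) = real q" and q: "q \<le> n"
  shows "(\<Sum>i<n. l i * w i) \<le> (\<Sum>i<q. l i)"
proof -
  define t where "t = (if q < n then l q else 0)"
  have "(\<Sum>i<n. l i * w i) = (\<Sum>i<n. (l i - t) * w i) + t * real q"
    unfolding w(3)[symmetric] by (simp add: sum_distrib_left sum.distrib[symmetric] algebra_simps)
  also have "(\<Sum>i<n. (l i - t) * w i) \<le> (\<Sum>i<n. if i < q then l i - t else 0)"
  proof (rule sum_mono)
    fix i assume "i \<in> {..<n}"
    hence i: "i < n" by simp
    show "(l i - t) * w i \<le> (if i < q then l i - t else 0)"
    proof (cases "i < q")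
      case True
      hence "0 \<le> l i - t" unfolding t_def using l(1)[OF i] l(2)[of i q] by auto
      thus ?thesis using True w(2)[OF i] by (simp add: mult_left_le)
    next
      case False
      hence "l i - t \<le> 0" unfolding t_def using l(2)[of q i] i by auto
      thus ?thesis using False w(1)[OF i] by (simp add: mult_nonpos_nonneg)
    qed
  qed
  also have "(\<Sum>i<n. if i < q then l i - t else 0) = (\<Sum>i<q. l i - t)"
    using q by (intro sum.mono_neutral_cong_right) auto
  finally show ?thesis by (simp add: sum_subtractf)
qed

text \<open>The rows of U C lie in the range of some Q with q \<le> k orthonormal columns, so the
  norm of A - U C is at least that of A - A Q Q^T. It remains to see that A Q captures no more than
  the q largest \<open>l i\<close>.\<close>

theorem sv_tail_le_low_rank:
  fixes A U C :: "real mat"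
  assumes "dim_row U = dim_row A" "dim_col U = k" "dim_row C = k" "dim_col C = dim_col A"
  shows "sv_tail A k \<le> mfro (A - U * C)"
proof -
  let ?n = "dim_col A"
  obtain V l where V: "V \<in> carrier_mat ?n ?n" "orthocols V"
    "A\<^sup>T * A * V = V * mdiag ?n l" "(A * V)\<^sup>T * (A * V) = mdiag ?n l"
    and l: "\<And>i. i < ?n \<Longrightarrow> 0 \<le> l i" "\<And>i j. i \<le> j \<Longrightarrow> j < ?n \<Longrightarrow> l j \<le> l i"
    and s: "\<And>j. j < ?n \<Longrightarrow> (\<Sum>i<dim_row A. ((A * V) $$ (i, j))\<^sup>2) = l j"
    by (rule gram_spectral[of A]) blast
  have d: "dim_row V = ?n" "dim_col V = ?n" using V by auto
  obtain q Q R R' where *: "q \<le> dim_col (C\<^sup>T)" "Q \<in> carrier_mat (dim_row (C\<^sup>T)) q" "orthocols Q"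
    "R \<in> carrier_mat q (dim_col (C\<^sup>T))" "R' \<in> carrier_mat (dim_col (C\<^sup>T)) q"
    "C\<^sup>T = Q * R" "R * R' = 1\<^sub>m q" "(R' * R)\<^sup>T = R' * R"
    by (rule orthonormal_factorization)
  have dQ: "q \<le> k" "dim_row Q = ?n" "dim_col Q = q" "dim_row R = q" "dim_col R = k"
    using *(1,2,4) assms by auto
  have qn: "q \<le> ?n" using orthocols_dim_le[OF *(3)] dQ by simp
  have QQ: "Q\<^sup>T * Q = 1\<^sub>m q" using *(3) dQ unfolding orthocols_def by simp
  have VV: "V * V\<^sup>T = 1\<^sub>m ?n" by (rule orthocols_square[OF V(2,1)])
  have C: "C = R\<^sup>T * Q\<^sup>T"
    using *(6) dQ transpose_transpose[of C] by (metis mat_transpose_mult)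
  define B where "B = U * C"
  have dB: "dim_row B = dim_row A" "dim_col B = ?n" unfolding B_def using assms by auto
  have BQ: "B * Q * Q\<^sup>T = B"
  proof -
    have "B * Q * Q\<^sup>T = U * (R\<^sup>T * ((Q\<^sup>T * Q) * Q\<^sup>T))"
      unfolding B_def C using assms dQ by (simp add: mat_assoc)
    thus ?thesis unfolding QQ B_def C using dQ assms by (simp add: mat_alg)
  qed
  have "(A - B) - (A - B) * Q * Q\<^sup>T = (A - B) - (A * Q * Q\<^sup>T - B * Q * Q\<^sup>T)"
    using dB dQ by (simp add: mat_minus_mult)
  also have "\<dots> = A - A * Q * Q\<^sup>T"
    unfolding BQ using dB dQ by (intro eq_matI) (auto simp del: index_mult_mat(1))
  finally have 1: "mfro2 (A - A * Q * Q\<^sup>T) \<le> mfro2 (A - B)"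
    using mfro2_ortho_split_right[OF *(3), of "A - B"] dB dQ mfro2_nonneg[of "(A - B) * Q"] by simp
  define N where "N = V\<^sup>T * Q"
  have dN: "dim_row N = ?n" "dim_col N = q" unfolding N_def using d dQ by auto
  have "N\<^sup>T * N = Q\<^sup>T * ((V * V\<^sup>T) * Q)"
    unfolding N_def using d dQ by (simp add: mat_alg)
  hence oN: "orthocols N" unfolding VV orthocols_def using QQ dQ dN by (simp add: mat_left_one)
  \<comment> \<open>The squared row lengths of V^T Q are the weights of \<open>l\<close> in the
    squared norm of A Q. Its columns being orthonormal, they are at most 1 and add up to q.\<close>
  define w where "w i = (\<Sum>c<q. (N $$ (i, c))\<^sup>2)" for i
  have w1: "w i \<le> 1" if i: "i < ?n" for i
  proof -
    let ?e = "unit_mat ?n 1 i 0"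
    have "(N\<^sup>T * ?e) $$ (c, 0) = N $$ (i, c)" if "c < q" for c
    proof -
      have "(N\<^sup>T * (?e * 1\<^sub>m 1)) $$ (c, 0) = N $$ (i, c)"
        using that i dN by (subst mult_unit_mult_entry) auto
      thus ?thesis by (simp add: mat_right_one)
    qed
    hence "mfro2 (N\<^sup>T * ?e) = w i" unfolding mfro2_def w_def using dN by simp
    moreover have "mfro2 (N\<^sup>T * ?e) \<le> mfro2 ?e" by (rule mfro2_transpose_ortho_mult_le[OF oN]) (use dN in simp)
    moreover have "mfro2 ?e = 1"
      using i unfolding mfro2_def by (simp add: unit_mat_def if_distrib[of "\<lambda>x. x\<^sup>2"] cong: if_cong)
    ultimately show ?thesis by simp
  qed
  have ws: "(\<Sum>i<?n. w i) = real q"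
    using orthocols_mfro2[OF oN] dN unfolding mfro2_def w_def by simp
  have "A * Q = A * ((V * V\<^sup>T) * Q)" unfolding VV using dQ by (simp add: mat_left_one)
  also have "\<dots> = (A * V) * N" unfolding N_def using d dQ by (simp add: mat_assoc)
  finally have "mfro2 (A * Q) = mtr (N * (N\<^sup>T * mdiag ?n l))"
  proof -
    assume AQ: "A * Q = (A * V) * N"
    have "mfro2 (A * Q) = mtr (N\<^sup>T * (((A * V)\<^sup>T * (A * V)) * N))"
      unfolding AQ mfro2_mtr' using d dN by (simp add: mat_alg)
    also have "\<dots> = mtr (N * (N\<^sup>T * mdiag ?n l))"
      unfolding V(4) using dN by (subst mtr_comm) (simp_all add: mat_assoc, subst mtr_comm, simp_all add: mat_assoc)
    finally show ?thesis .
  qed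
  also have "\<dots> = (\<Sum>i<?n. l i * w i)"
  proof -
    have "N * (N\<^sup>T * mdiag ?n l) = (N * N\<^sup>T) * mdiag ?n l" using dN by (simp add: mat_assoc)
    moreover have "(N * N\<^sup>T) $$ (i, i) = w i" if "i < ?n" for i
      using that dN unfolding w_def by (subst mult_mat_entry) (auto simp: power2_eq_square)
    ultimately show ?thesis
      unfolding mtr_def using dN by (simp add: mult_mdiag_entry mult.commute del: index_mult_mat(1))
  qed
  also have "\<dots> \<le> (\<Sum>i<q. l i)"
    by (rule weighted_sum_le_leading[OF l _ w1 ws qn]) (auto simp: w_def sum_nonneg)
  finally have 2: "mfro2 (A * Q) \<le> (\<Sum>i<q. l i)" .
  have mA: "mfro2 A = (\<Sum>j<?n. l j)"
  proof -
    have "mfro2 (A * V) = (\<Sum>j<?n. l j)" using mfro2_cols[of "A * V" l] s d by simp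
    moreover have "A - A * V * V\<^sup>T = 0\<^sub>m (dim_row A) ?n"
    proof -
      have "A * V * V\<^sup>T = A" using VV d by (simp add: mat_assoc mat_right_one)
      thus ?thesis by (intro eq_matI) auto
    qed
    ultimately show ?thesis using mfro2_ortho_split_right[OF V(2), of A] d by (simp add: mfro2_def)
  qed
  have "(sv_tail A k)\<^sup>2 = (\<Sum>i\<in>{min k ?n..<?n}. l i)" by (rule gram_tail[OF V l])
  also have "\<dots> \<le> (\<Sum>i\<in>{q..<?n}. l i)"
    by (rule sum_mono2) (use dQ qn l in auto)
  also have "\<dots> = (\<Sum>j<?n. l j) - (\<Sum>j<q. l j)"
    using sum.atLeastLessThan_concat[of 0 q ?n l] qn by (simp add: lessThan_atLeast0)
  also have "\<dots> \<le> mfro2 A - mfro2 (A * Q)" using mA 2 by simp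
  also have "\<dots> \<le> mfro2 (A - B)"
    using mfro2_ortho_split_right[OF *(3), of A] dQ 1 by simp
  finally have "sqrt ((sv_tail A k)\<^sup>2) \<le> mfro (A - B)" unfolding mfro_def by (rule real_sqrt_le_mono)
  moreover have "0 \<le> sv_tail A k" unfolding sv_tail_def by (intro real_sqrt_ge_zero sum_nonneg) auto
  ultimately show ?thesis unfolding B_def by simp
qed

text \<open>\<open>X Z\<close> with \<open>Z = (V\<^sup>T X)\<^sup>\<dagger> V\<^sup>T\<close>, where \<open>V\<close> spans the leading right singular vectors, is not the best choice
  but has a computable error; \<open>sketch_proj_residual_bound\<close> allows any \<open>Z\<close>.\<close>

lemma gauss_range_finder:
  fixes A :: "real mat"
  assumes A: "A \<in> carrier_mat a b" and k: "k + 2 \<le> r"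
  obtains Z where "mat_meas (gauss ({0..<b} \<times> {0..<r})) r b Z"
    "(\<integral>\<^sup>+x. ennreal (mfro2 (A - A * (entry_mat b r x * Z x))) \<partial>gauss ({0..<b} \<times> {0..<r}))
      \<le> ennreal ((1 + real k / (real r - real k - 1)) * (sv_tail A k)\<^sup>2)"
proof -
  let ?g = "gauss ({0..<b} \<times> {0..<r})" and ?X = "entry_mat b r"
  interpret prob_space ?g by (rule prob_space_gauss)
  have d: "dim_row A = a" "dim_col A = b" using A by auto
  define q where "q = min k b"
  obtain V where V: "V \<in> carrier_mat b q" "orthocols V"
    "mfro2 (A - A * V * V\<^sup>T) = (sv_tail A k)\<^sup>2"
    using truncation_error[of A k] d unfolding q_def by metis
  have dV: "dim_row V = b" "dim_col V = q" using V by auto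
  have VV: "V\<^sup>T * V = 1\<^sub>m q" using V(2) dV unfolding orthocols_def by simp
  define A2 where "A2 = A - A * V * V\<^sup>T"
  \<comment> \<open>X acts on A from the right, so the Gaussian bound is applied to transposes, with
    V in the place of Q.\<close>
  define W where "W = A2\<^sup>T"
  have dA2: "dim_row A2 = a" "dim_col A2 = b" "dim_row W = b" "dim_col W = a"
    unfolding A2_def W_def using d dV by auto
  have "A2 * V = A * V - A * V * (V\<^sup>T * V)"
    unfolding A2_def using d dV by (simp add: mat_minus_mult mat_assoc)
  also have "\<dots> = A * V - A * V" unfolding VV using d dV by (simp add: mat_right_one)
  also have "\<dots> = 0\<^sub>m a q" using d dV by (intro eq_matI) (auto simp del: index_mult_mat(1))
  finally have A2V: "A2 * V = 0\<^sub>m a q" .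
  have "(A2 * V)\<^sup>T = 0\<^sub>m q a" unfolding A2V by simp
  hence VW: "V\<^sup>T * W = 0\<^sub>m q a" unfolding W_def using dA2 dV by (simp add: mat_transpose_mult)
  have W: "W \<in> carrier_mat b a" using dA2 by (intro carrier_matI) auto
  let ?G = "\<lambda>x. (?X x)\<^sup>T * V"
  let ?N = "\<lambda>x. pinv (?G x) * ((?X x)\<^sup>T * W)"
  define Z where "Z = (\<lambda>x. (pinv (?G x))\<^sup>T * V\<^sup>T)"
  have mG: "mat_meas ?g r q ?G"
    by (intro mat_meas_mult[OF mat_meas_transpose[OF mat_meas_entry_mat]] mat_meas_const V)
  have mZ: "mat_meas ?g r b Z" unfolding Z_def
    by (rule mat_meas_mult[OF mat_meas_transpose[OF mat_meas_pinv[OF mG]] mat_meas_transpose[OF mat_meas_const[OF V(1)]]])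
  have mN: "mat_meas ?g q a ?N"
    by (intro mat_meas_mult[OF mat_meas_pinv[OF mG]] mat_meas_mult[OF mat_meas_transpose[OF mat_meas_entry_mat]] mat_meas_const W)
  \<comment> \<open>V^T X Z = V^T, so the leading part of A is reproduced exactly. The error is A2
    minus a matrix with rows in the range of V, and these two are orthogonal.\<close>
  have pt: "mfro2 (A - A * (?X x * Z x)) = mfro2 A2 + mfro2 (?N x)"
    if nz: "det ((?G x)\<^sup>T * ?G x) \<noteq> 0" for x
  proof -
    have dN: "dim_row (?N x) = q" "dim_col (?N x) = a" using dV dA2 by auto
    have "(pinv (?G x) * ?G x)\<^sup>T = 1\<^sub>m q" using pinv_full_rank[OF nz] dV by simp
    hence 1: "V\<^sup>T * (?X x * (pinv (?G x))\<^sup>T) = 1\<^sub>m q"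
      using dV by (simp add: mat_alg)
    have A_eq: "A = A * V * V\<^sup>T + A2" unfolding A2_def using d dV by (intro eq_matI) auto
    have "A * (?X x * Z x) = (A * V * V\<^sup>T + A2) * (?X x * Z x)" using A_eq by simp
    also have "\<dots> = A * V * ((V\<^sup>T * (?X x * (pinv (?G x))\<^sup>T)) * V\<^sup>T) + A2 * (?X x * Z x)"
      unfolding Z_def using d dV dA2 by (simp add: mat_add_mult mat_assoc)
    also have "\<dots> = A * V * V\<^sup>T + A2 * (?X x * Z x)" unfolding 1 using dV by (simp add: mat_left_one)
    also have "A2 * (?X x * Z x) = (?N x)\<^sup>T * V\<^sup>T"
      unfolding Z_def W_def using dV dA2 by (simp add: mat_alg)
    finally have "A - A * (?X x * Z x) = A2 + (- ?N x)\<^sup>T * V\<^sup>T"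
    proof -
      assume e: "A * (?X x * Z x) = A * V * V\<^sup>T + (?N x)\<^sup>T * V\<^sup>T"
      have "(- ?N x)\<^sup>T = - (?N x)\<^sup>T" by (intro eq_matI) (auto simp del: index_mult_mat(1))
      hence "(- ?N x)\<^sup>T * V\<^sup>T = - ((?N x)\<^sup>T * V\<^sup>T)"
        using dN dV by (simp add: mat_uminus_mult)
      thus ?thesis unfolding e A2_def using d dV dN by (intro eq_matI) (auto simp del: index_mult_mat(1))
    qed
    also have "mfro2 \<dots> = mfro2 A2 + mfro2 ((- ?N x)\<^sup>T * V\<^sup>T)"
    proof (rule mfro2_pythagoras')
      have "A2 * ((- ?N x)\<^sup>T * V\<^sup>T)\<^sup>T = (A2 * V) * (- ?N x)"
        using dA2 dV dN by (simp add: mat_alg)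
      thus "A2 * ((- ?N x)\<^sup>T * V\<^sup>T)\<^sup>T =
         0\<^sub>m (dim_row ((- ?N x)\<^sup>T * V\<^sup>T)) (dim_row ((- ?N x)\<^sup>T * V\<^sup>T))"
        unfolding A2V using dN dV by (simp add: mat_uminus_zero)
    qed (use dA2 dV dN in auto)
    also have "mfro2 ((- ?N x)\<^sup>T * V\<^sup>T) = mfro2 (V * (- ?N x))"
    proof -
      have "(V * (- ?N x))\<^sup>T = (- ?N x)\<^sup>T * V\<^sup>T"
        by (rule mat_transpose_mult) (use dV dN in auto)
      thus ?thesis using mfro2_transpose[of "V * (- ?N x)"] by (simp only:)
    qed
    also have "\<dots> = mfro2 (- ?N x)" using V(2) dV dN by (intro mfro2_orthocols_mult) auto
    also have "\<dots> = mfro2 (?N x)" unfolding mfro2_def by (simp del: index_mult_mat(1))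
    finally show ?thesis .
  qed
  have qk: "q \<le> k" unfolding q_def by simp
  have "(\<integral>\<^sup>+x. ennreal (mfro2 (A - A * (?X x * Z x))) \<partial>?g) = (\<integral>\<^sup>+x. ennreal (mfro2 A2) + ennreal (mfro2 (?N x)) \<partial>?g)"
  proof (rule nn_integral_cong_AE)
    have "AE x in ?g. det ((?G x)\<^sup>T * ?G x) \<noteq> 0"
      by (rule gauss_full_rank[OF V(1,2)]) (use qk k in auto)
    thus "AE x in ?g. ennreal (mfro2 (A - A * (?X x * Z x))) = ennreal (mfro2 A2) + ennreal (mfro2 (?N x))"
    proof eventually_elim
      case (elim x)
      show ?case unfolding pt[OF elim] by (simp only: ennreal_plus[symmetric] mfro2_nonneg)
    qed
  qed
  also have "\<dots> = ennreal (mfro2 A2) + (\<integral>\<^sup>+x. ennreal (mfro2 (?N x)) \<partial>?g)"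
    using mat_meas_mfro2[OF mN] by (subst nn_integral_add) (auto simp: emeasure_space_1)
  also have "\<dots> \<le> ennreal (mfro2 A2) + ennreal (real q / (real r - real q - 1) * mfro2 W)"
    by (intro add_left_mono gauss_pinv_bound[OF V(1,2) _ W VW]) (use qk k in auto)
  also have "\<dots> \<le> ennreal (mfro2 A2) + ennreal (real k / (real r - real k - 1) * mfro2 A2)"
    unfolding W_def mfro2_transpose
    by (intro add_left_mono ennreal_leI mult_right_mono frac_le) (use qk k in auto)
  also have "\<dots> = ennreal ((1 + real k / (real r - real k - 1)) * mfro2 A2)"
    unfolding distrib_right mult_1 using k
    by (intro ennreal_plus[symmetric] mult_nonneg_nonneg) auto
  also have "mfro2 A2 = (sv_tail A k)\<^sup>2" unfolding A2_def by (rule V(3))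
  finally show ?thesis by (rule that[OF mZ])
qed

text \<open>For fixed X the residual bound is taken with the \<open>Z\<close> of the range finder,
  which may depend on X. Jensen's inequality is used once for Y given X and once for X, and turns
  the two second-moment factors into the product of square roots in \<open>c'_const\<close>.\<close>

theorem sketch_proj_error:
  assumes A: "A \<in> carrier_mat a b" and k: "k + 2 \<le> r" and p: "1 < p"
  shows "(\<integral>\<^sup>+x. (\<integral>\<^sup>+y. ennreal (mfro (A - sketch_proj A (entry_mat b r x) (entry_mat a (r + p) y) * A))
      \<partial>gauss ({0..<a} \<times> {0..<r + p})) \<partial>gauss ({0..<b} \<times> {0..<r}))
    \<le> ennreal (c'_const r p k * sv_tail A k)"
proof -
  let ?g = "gauss ({0..<b} \<times> {0..<r})" and ?X = "entry_mat b r"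
  let ?h = "gauss ({0..<a} \<times> {0..<r + p})" and ?Y = "entry_mat a (r + p)"
  obtain Z where Z: "mat_meas ?g r b Z" and le: "(\<integral>\<^sup>+x. ennreal (mfro2 (A - A * (?X x * Z x))) \<partial>?g)
      \<le> ennreal ((1 + real k / (real r - real k - 1)) * (sv_tail A k)\<^sup>2)"
    by (rule gauss_range_finder[OF A k])
  define c1 where "c1 = 1 + real r / (real p - 1)"
  define c2 where "c2 = 1 + real k / (real r - real k - 1)"
  have c1: "0 \<le> c1" and c2: "0 \<le> c2" unfolding c1_def c2_def using p k by auto
  have X: "?X x \<in> carrier_mat b r" for x by (intro carrier_matI) auto
  have t: "0 \<le> sv_tail A k" unfolding sv_tail_def by (intro real_sqrt_ge_zero sum_nonneg) auto
  have inner: "(\<integral>\<^sup>+y. ennreal (mfro (A - sketch_proj A (?X x) (?Y y) * A)) \<partial>?h) \<le> ennreal (sqrt (c1 * mfro2 (A - A * (?X x * Z x))))"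
    if x: "x \<in> space ?g" for x
  proof (rule nn_integral_le_of_square[OF prob_space_gauss])
    have "mat_meas ?h a b (\<lambda>y. A - sketch_proj A (?X x) (?Y y) * A)"
      unfolding sketch_proj_def
      by (intro mat_meas_minus mat_meas_mult[OF _ mat_meas_const[OF A]] mat_meas_const[OF A]
          mat_meas_mult[OF mat_meas_mult[OF mat_meas_const[OF mult_carrier_mat[OF A X]] mat_meas_pinv] mat_meas_transpose[OF mat_meas_entry_mat]]
          mat_meas_mult[OF mat_meas_mult[OF mat_meas_transpose[OF mat_meas_entry_mat] mat_meas_const[OF A]] mat_meas_const[OF X]])
    thus "(\<lambda>y. mfro (A - sketch_proj A (?X x) (?Y y) * A)) \<in> borel_measurable ?h" by (rule mat_meas_mfro)
    show "(\<integral>\<^sup>+y. ennreal ((mfro (A - sketch_proj A (?X x) (?Y y) * A))\<^sup>2) \<partial>?h) \<le> ennreal ((sqrt (c1 * mfro2 (A - A * (?X x * Z x))))\<^sup>2)"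
      using sketch_proj_residual_bound[OF A X mat_measD(1)[OF Z x] p] c1 unfolding c1_def mfro_sq by simp
  qed (use c1 in auto)
  have "(\<integral>\<^sup>+x. (\<integral>\<^sup>+y. ennreal (mfro (A - sketch_proj A (?X x) (?Y y) * A)) \<partial>?h) \<partial>?g)
     \<le> (\<integral>\<^sup>+x. ennreal (sqrt (c1 * mfro2 (A - A * (?X x * Z x)))) \<partial>?g)"
    by (rule nn_integral_mono) (rule inner)
  also have "\<dots> \<le> ennreal (sqrt c1 * sqrt c2 * sv_tail A k)"
  proof (rule nn_integral_le_of_square[OF prob_space_gauss])
    have "mat_meas ?g a b (\<lambda>x. A - A * (?X x * Z x))"
      by (intro mat_meas_minus mat_meas_const[OF A] mat_meas_mult[OF mat_meas_const[OF A]] mat_meas_mult[OF mat_meas_entry_mat Z])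
    note m [measurable] = mat_meas_mfro2[OF this]
    show "(\<lambda>x. sqrt (c1 * mfro2 (A - A * (?X x * Z x)))) \<in> borel_measurable ?g" by measurable
    have "(\<integral>\<^sup>+x. ennreal ((sqrt (c1 * mfro2 (A - A * (?X x * Z x))))\<^sup>2) \<partial>?g)
       = (\<integral>\<^sup>+x. ennreal c1 * ennreal (mfro2 (A - A * (?X x * Z x))) \<partial>?g)"
      using c1 by (simp add: ennreal_mult)
    also have "\<dots> = ennreal c1 * (\<integral>\<^sup>+x. ennreal (mfro2 (A - A * (?X x * Z x))) \<partial>?g)"
      by (rule nn_integral_cmult) measurable
    also have "\<dots> \<le> ennreal c1 * ennreal (c2 * (sv_tail A k)\<^sup>2)"
      using le unfolding c2_def by (intro mult_left_mono) auto
    also have "\<dots> = ennreal ((sqrt c1 * sqrt c2 * sv_tail A k)\<^sup>2)"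
      using c1 c2 by (simp add: ennreal_mult[symmetric] power_mult_distrib mult.assoc)
    finally show "(\<integral>\<^sup>+x. ennreal ((sqrt (c1 * mfro2 (A - A * (?X x * Z x))))\<^sup>2) \<partial>?g)
       \<le> ennreal ((sqrt c1 * sqrt c2 * sv_tail A k)\<^sup>2)" .
  qed (use c1 c2 t in auto)
  finally show ?thesis unfolding c1_def c2_def c'_const_def .
qed

section \<open>Unfoldings, mode products and TTN ranks\<close>

lemma colex_nth_pos: "finite I \<Longrightarrow> q < dim_prod n I \<Longrightarrow> colex_pos n I (colex_nth n I q) = q"
  using colex_nth_pos_aux by blast

lemma colex_nth_mem:
  assumes "finite I" "q < dim_prod n I" shows "colex_nth n I q \<in> multi_indices n I"
  using colex_nth_pos_aux[OF assms] unfolding multi_indices_def by (auto simp: colex_nth_def PiE_def)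

lemma finite_multi_indices: "finite I \<Longrightarrow> finite (multi_indices n I)"
  unfolding multi_indices_def by (intro finite_PiE) auto

lemma bij_betw_colex_nth:
  assumes "finite I" shows "bij_betw (colex_nth n I) {..<dim_prod n I} (multi_indices n I)"
proof -
  have inj: "inj_on (colex_nth n I) {..<dim_prod n I}"
    by (rule inj_on_inverseI[where g = "colex_pos n I"]) (use colex_nth_pos[OF assms] in auto)
  have "colex_nth n I ` {..<dim_prod n I} = multi_indices n I"
  proof (rule card_subset_eq)
    show "card (colex_nth n I ` {..<dim_prod n I}) = card (multi_indices n I)"
      using assms card_image[OF inj] unfolding multi_indices_def by (simp add: card_PiE dim_prod_def)
  qed (use colex_nth_mem[OF assms] finite_multi_indices[OF assms] in auto)
  thus ?thesis using inj unfolding bij_betw_def by blast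
qed

lemma colex_pos_nth:
  assumes "finite I" "i \<in> multi_indices n I"
  shows "colex_pos n I i < dim_prod n I" "colex_nth n I (colex_pos n I i) = i"
proof -
  obtain q where q: "q < dim_prod n I" "i = colex_nth n I q"
    using bij_betw_colex_nth[OF assms(1), of n] assms(2) unfolding bij_betw_def by auto
  thus "colex_pos n I i < dim_prod n I" "colex_nth n I (colex_pos n I i) = i"
    using colex_nth_pos[OF assms(1) q(1)] by auto
qed

lemma multi_indices_restrict: "i \<in> multi_indices n D \<Longrightarrow> I \<subseteq> D \<Longrightarrow> restrict i I \<in> multi_indices n I"
  unfolding multi_indices_def by (auto simp: PiE_def Pi_def)

lemma colex_pos_restrict: "colex_pos n I (restrict i I) = colex_pos n I i"
  by (rule colex_pos_cong) simp

text \<open>The combined index that occurs inside \<open>matricize\<close>. Only the values of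
  \<open>i\<close> outside I count, so \<open>i\<close> may be an index on D or on D - I.\<close>

definition splice_index :: "nat set \<Rightarrow> nat set \<Rightarrow> (nat \<Rightarrow> nat) \<Rightarrow> (nat \<Rightarrow> nat) \<Rightarrow> nat \<Rightarrow> nat" where
  "splice_index D I j i = (\<lambda>\<mu>\<in>D. if \<mu> \<in> I then j \<mu> else i \<mu>)"

lemma splice_index_apply: "\<mu> \<in> D \<Longrightarrow> splice_index D I j i \<mu> = (if \<mu> \<in> I then j \<mu> else i \<mu>)"
  unfolding splice_index_def by simp

lemma splice_index_mem:
  assumes "I \<subseteq> D" "j \<in> multi_indices n I" "i \<in> multi_indices n (D - I)"
  shows "splice_index D I j i \<in> multi_indices n D"
  using assms unfolding multi_indices_def splice_index_def by (auto simp: PiE_def Pi_def)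

lemma splice_index_mem':
  assumes "I \<subseteq> D" "j \<in> multi_indices n I" "i \<in> multi_indices n D"
  shows "splice_index D I j i \<in> multi_indices n D"
  using assms unfolding multi_indices_def splice_index_def by (auto simp: PiE_def Pi_def)

lemma splice_index_self:
  assumes "i \<in> multi_indices n D" shows "splice_index D I (restrict i I) (restrict i (D - I)) = i"
  using assms unfolding splice_index_def multi_indices_def by (auto simp: PiE_def extensional_def fun_eq_iff)

lemma colex_pos_splice:
  assumes "I \<subseteq> D" shows "colex_pos n I (splice_index D I j i) = colex_pos n I j"
    "colex_pos n (D - I) (splice_index D I j i) = colex_pos n (D - I) i"
  by (rule colex_pos_cong, use assms in \<open>auto simp: splice_index_def\<close>)+

lemma matricize_dim [simp]:
  "dim_row (matricize n D I S) = dim_prod n I" "dim_col (matricize n D I S) = dim_prod n (D - I)"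
  unfolding matricize_def by simp_all

lemma matricize_carrier: "matricize n D I S \<in> carrier_mat (dim_prod n I) (dim_prod n (D - I))"
  by (intro carrier_matI) auto

lemma matricize_entry:
  "a < dim_prod n I \<Longrightarrow> b < dim_prod n (D - I) \<Longrightarrow>
   matricize n D I S $$ (a, b) = S (splice_index D I (colex_nth n I a) (colex_nth n (D - I) b))"
  unfolding matricize_def splice_index_def by simp

lemma bij_betw_matricize_index:
  assumes "finite D" "I \<subseteq> D"
  shows "bij_betw (\<lambda>(a, b). splice_index D I (colex_nth n I a) (colex_nth n (D - I) b))
    ({..<dim_prod n I} \<times> {..<dim_prod n (D - I)}) (multi_indices n D)"
proof (rule bij_betw_byWitness[where f' = "\<lambda>i. (colex_pos n I i, colex_pos n (D - I) i)"])
  have f: "finite I" "finite (D - I)" using assms finite_subset by auto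
  show "\<forall>ab\<in>{..<dim_prod n I} \<times> {..<dim_prod n (D - I)}.
     (\<lambda>i. (colex_pos n I i, colex_pos n (D - I) i)) ((\<lambda>(a, b). splice_index D I (colex_nth n I a) (colex_nth n (D - I) b)) ab) = ab"
    using f by (auto simp: colex_pos_splice[OF assms(2)] colex_nth_pos)
  show "\<forall>i\<in>multi_indices n D. (\<lambda>(a, b). splice_index D I (colex_nth n I a) (colex_nth n (D - I) b))
      ((\<lambda>i. (colex_pos n I i, colex_pos n (D - I) i)) i) = i"
  proof
    fix i assume i: "i \<in> multi_indices n D"
    have 1: "colex_nth n I (colex_pos n I i) = restrict i I"
      using colex_pos_nth(2)[OF f(1) multi_indices_restrict[OF i assms(2)]] by (simp add: colex_pos_restrict)
    have 2: "colex_nth n (D - I) (colex_pos n (D - I) i) = restrict i (D - I)"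
      using colex_pos_nth(2)[OF f(2) multi_indices_restrict[OF i]] by (simp add: colex_pos_restrict)
    show "(\<lambda>(a, b). splice_index D I (colex_nth n I a) (colex_nth n (D - I) b))
      ((\<lambda>i. (colex_pos n I i, colex_pos n (D - I) i)) i) = i"
      using splice_index_self[OF i, of I] by (simp add: 1 2)
  qed
  show "(\<lambda>(a, b). splice_index D I (colex_nth n I a) (colex_nth n (D - I) b)) `
    ({..<dim_prod n I} \<times> {..<dim_prod n (D - I)}) \<subseteq> multi_indices n D"
    using f colex_nth_mem by (auto intro!: splice_index_mem[OF assms(2)])
  show "(\<lambda>i. (colex_pos n I i, colex_pos n (D - I) i)) ` multi_indices n D \<subseteq> {..<dim_prod n I} \<times> {..<dim_prod n (D - I)}"
  proof safe
    fix i assume i: "i \<in> multi_indices n D"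
    show "colex_pos n I i < dim_prod n I"
      using colex_pos_nth(1)[OF f(1) multi_indices_restrict[OF i assms(2)]] by (simp add: colex_pos_restrict)
    show "colex_pos n (D - I) i < dim_prod n (D - I)"
      using colex_pos_nth(1)[OF f(2) multi_indices_restrict[OF i]] by (simp add: colex_pos_restrict)
  qed
qed

lemma frob_norm_matricize:
  assumes "finite D" "I \<subseteq> D"
  shows "frob_norm n D S = mfro (matricize n D I S)"
proof -
  have "(\<Sum>i\<in>multi_indices n D. (S i)\<^sup>2) =
     (\<Sum>ab\<in>{..<dim_prod n I} \<times> {..<dim_prod n (D - I)}. (matricize n D I S $$ ab)\<^sup>2)"
    by (subst sum.reindex_bij_betw[OF bij_betw_matricize_index[OF assms], symmetric])
      (auto simp: matricize_entry intro!: sum.cong)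
  also have "\<dots> = mfro2 (matricize n D I S)"
    unfolding mfro2_def by (simp add: sum.cartesian_product split_def)
  finally show ?thesis unfolding frob_norm_def mfro_def by simp
qed

lemma matricize_minus:
  "matricize n D I (S - S') = matricize n D I S - matricize n D I S'"
  by (intro eq_matI) (auto simp: matricize_entry)

lemma matricize_cong:
  assumes "finite D" "I \<subseteq> D" "\<And>i. i \<in> multi_indices n D \<Longrightarrow> S i = S' i"
  shows "matricize n D I S = matricize n D I S'"
proof (intro eq_matI)
  have f: "finite I" "finite (D - I)" using assms finite_subset by auto
  fix a b assume "a < dim_row (matricize n D I S')" "b < dim_col (matricize n D I S')"
  hence ab: "a < dim_prod n I" "b < dim_prod n (D - I)" by auto
  show "matricize n D I S $$ (a, b) = matricize n D I S' $$ (a, b)"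
    unfolding matricize_entry[OF ab]
    by (intro assms(3) splice_index_mem[OF assms(2)] colex_nth_mem f ab)
qed auto

lemma mode_apply_cong:
  assumes "finite D" "I \<subseteq> D" "\<And>i. i \<in> multi_indices n D \<Longrightarrow> S i = S' i"
  shows "mode_apply n D I M S = mode_apply n D I M S'"
  unfolding mode_apply_def using matricize_cong[OF assms] by simp

text \<open>A sum over multi-indices on I, without any enumeration of the columns, lets operators in
  different modes be compared by swapping sums.\<close>

lemma mode_apply_eq_sum:
  assumes "finite D" "I \<subseteq> D" "M \<in> carrier_mat (dim_prod n I) (dim_prod n I)" "i \<in> multi_indices n D"
  shows "mode_apply n D I M S i =
    (\<Sum>j\<in>multi_indices n I. M $$ (colex_pos n I i, colex_pos n I j) * S (splice_index D I j i))"
proof -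
  have f: "finite I" "finite (D - I)" using assms finite_subset by auto
  have p: "colex_pos n I i < dim_prod n I"
    using colex_pos_nth(1)[OF f(1) multi_indices_restrict[OF assms(4,2)]] by (simp add: colex_pos_restrict)
  have p': "colex_pos n (D - I) i < dim_prod n (D - I)"
    using colex_pos_nth(1)[OF f(2) multi_indices_restrict[OF assms(4)]] by (simp add: colex_pos_restrict)
  have r: "colex_nth n (D - I) (colex_pos n (D - I) i) = restrict i (D - I)"
    using colex_pos_nth(2)[OF f(2) multi_indices_restrict[OF assms(4)]] by (simp add: colex_pos_restrict)
  have s: "splice_index D I j (restrict i (D - I)) = splice_index D I j i" for j
    unfolding splice_index_def by (auto simp: fun_eq_iff)
  have "mode_apply n D I M S i =
     (\<Sum>k<dim_prod n I. M $$ (colex_pos n I i, k) * matricize n D I S $$ (k, colex_pos n (D - I) i))"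
    unfolding mode_apply_def tensorize_def using assms(3) p p' by (subst mult_mat_entry) auto
  also have "\<dots> = (\<Sum>k<dim_prod n I. M $$ (colex_pos n I i, colex_pos n I (colex_nth n I k))
      * S (splice_index D I (colex_nth n I k) i))"
    using p' f(1) by (intro sum.cong refl) (simp add: matricize_entry r s colex_nth_pos)
  also have "\<dots> = (\<Sum>j\<in>multi_indices n I. M $$ (colex_pos n I i, colex_pos n I j) * S (splice_index D I j i))"
    by (rule sum.reindex_bij_betw[OF bij_betw_colex_nth[OF f(1)]])
  finally show ?thesis .
qed

text \<open>Both sides are the same double sum, because entries at disjoint index sets can be
  replaced in either order. The equation is claimed at multi-indices only, as
  \<open>tensorize\<close> has no meaningful values elsewhere.\<close>

lemma mode_apply_commute:
  assumes D: "finite D" and I: "I \<subseteq> D" "M \<in> carrier_mat (dim_prod n I) (dim_prod n I)"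
    and J: "J \<subseteq> D" "N \<in> carrier_mat (dim_prod n J) (dim_prod n J)" and IJ: "I \<inter> J = {}"
    and i: "i \<in> multi_indices n D"
  shows "mode_apply n D I M (mode_apply n D J N S) i = mode_apply n D J N (mode_apply n D I M S) i"
proof -
  have *: "mode_apply n D I M (mode_apply n D J N S) i =
     (\<Sum>j\<in>multi_indices n I. \<Sum>k\<in>multi_indices n J. M $$ (colex_pos n I i, colex_pos n I j) *
        (N $$ (colex_pos n J i, colex_pos n J k) * S (splice_index D J k (splice_index D I j i))))"
    if I: "I \<subseteq> D" "M \<in> carrier_mat (dim_prod n I) (dim_prod n I)"
    and J: "J \<subseteq> D" "N \<in> carrier_mat (dim_prod n J) (dim_prod n J)" and IJ: "I \<inter> J = {}" for I J M N
  proof -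
    have "colex_pos n J (splice_index D I j i) = colex_pos n J i" for j
      by (rule colex_pos_cong) (use J IJ in \<open>auto simp: splice_index_def\<close>)
    hence "mode_apply n D J N S (splice_index D I j i) =
       (\<Sum>k\<in>multi_indices n J. N $$ (colex_pos n J i, colex_pos n J k) * S (splice_index D J k (splice_index D I j i)))"
      if "j \<in> multi_indices n I" for j
      using splice_index_mem'[OF I(1) that i] by (simp add: mode_apply_eq_sum[OF D J])
    thus ?thesis by (simp add: mode_apply_eq_sum[OF D I i] sum_distrib_left)
  qed
  have s: "splice_index D J k (splice_index D I j i) = splice_index D I j (splice_index D J k i)" for j k
    unfolding splice_index_def using IJ by (auto simp: fun_eq_iff)
  have JI: "J \<inter> I = {}" using IJ by auto
  show ?thesis
    unfolding *[OF I J IJ] *[OF J I JI] s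
    by (subst sum.swap) (simp add: mult.left_commute)
qed

text \<open>The definition of a level applies the largest k first, whereas the products in the bound
  require it to come last. As the operators commute only on \<open>E\<close>, the first premise asks
  that an operator reads its argument only on \<open>E\<close>.\<close>

lemma foldr_commute_rev:
  fixes f :: "'k \<Rightarrow> ('i \<Rightarrow> 'v) \<Rightarrow> ('i \<Rightarrow> 'v)"
  assumes cong: "\<And>x S S'. x \<in> A \<Longrightarrow> (\<And>i. i \<in> E \<Longrightarrow> S i = S' i) \<Longrightarrow> f x S = f x S'"
    and comm: "\<And>x y S i. x \<in> A \<Longrightarrow> y \<in> A \<Longrightarrow> x \<noteq> y \<Longrightarrow> i \<in> E \<Longrightarrow> f x (f y S) i = f y (f x S) i"
  shows "set xs \<subseteq> A \<Longrightarrow> distinct xs \<Longrightarrow> i \<in> E \<Longrightarrow> foldr f (rev xs) S i = foldr f xs S i"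
proof -
  have move: "foldr f ys (f x S) i = f x (foldr f ys S) i"
    if "set ys \<subseteq> A" "x \<in> A" "x \<notin> set ys" "i \<in> E" for ys x S i
    using that
  proof (induction ys arbitrary: i)
    case (Cons y ys)
    have "foldr f (y # ys) (f x S) = f y (f x (foldr f ys S))"
      using Cons by (simp, intro cong) auto
    moreover have "f y (f x (foldr f ys S)) i = f x (f y (foldr f ys S)) i"
      by (rule comm) (use Cons.prems in auto)
    ultimately show ?case by simp
  qed simp
  show "set xs \<subseteq> A \<Longrightarrow> distinct xs \<Longrightarrow> i \<in> E \<Longrightarrow> foldr f (rev xs) S i = foldr f xs S i"
  proof (induction xs arbitrary: i)
    case (Cons x xs)
    have "foldr f (rev (x # xs)) S i = f x (foldr f (rev xs) S) i"
      using Cons.prems by (simp add: move)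
    also have "f x (foldr f (rev xs) S) = f x (foldr f xs S)"
      using Cons by (intro cong) auto
    finally show ?case by simp
  qed simp
qed

section \<open>Index trees and the matrix rank of unfoldings\<close>

lemma index_tree_node_subset:
  assumes "is_index_tree d \<I>" "(l, k) \<in> tree_nodes \<I>" shows "node_set \<I> l k \<subseteq> {1..d}"
  using assms unfolding is_index_tree_def by auto

lemma nonroot_tree_nodes: "(l, k) \<in> nonroot_nodes \<I> \<Longrightarrow> (l, k) \<in> tree_nodes \<I>"
  unfolding nonroot_nodes_def tree_nodes_def by auto

lemma index_tree_parent:
  assumes "is_index_tree d \<I>" "(Suc l, k) \<in> tree_nodes \<I>"
  shows "(l, parent \<I> (Suc l) k) \<in> tree_nodes \<I>" "k \<in> children \<I> l (parent \<I> (Suc l) k)"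
proof -
  have "(Suc l, k) \<in> nonroot_nodes \<I>" using assms(2) unfolding tree_nodes_def nonroot_nodes_def by auto
  thus "(l, parent \<I> (Suc l) k) \<in> tree_nodes \<I>"
    using assms(1) unfolding is_index_tree_def by fastforce
  show "k \<in> children \<I> l (parent \<I> (Suc l) k)" unfolding children_def using assms(2) by simp
qed

lemma index_tree_children:
  assumes "is_index_tree d \<I>" "(l, k) \<in> tree_nodes \<I>" "s \<in> children \<I> l k"
  shows "node_set \<I> (Suc l) s \<subseteq> node_set \<I> l k"
    "s' \<in> children \<I> l k \<Longrightarrow> s \<noteq> s' \<Longrightarrow> node_set \<I> (Suc l) s \<inter> node_set \<I> (Suc l) s' = {}"
proof -
  have "\<forall>(l, k)\<in>tree_nodes \<I>. (\<Union>s\<in>children \<I> l k. node_set \<I> (l + 1) s) \<subseteq> node_set \<I> l k \<and>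
      disjoint_family_on (node_set \<I> (l + 1)) (children \<I> l k)"
    using assms(1) unfolding is_index_tree_def by (elim conjE)
  from bspec[OF this assms(2)]
  have *: "(\<Union>s\<in>children \<I> l k. node_set \<I> (Suc l) s) \<subseteq> node_set \<I> l k"
      "disjoint_family_on (node_set \<I> (Suc l)) (children \<I> l k)" by auto
  show "node_set \<I> (Suc l) s \<subseteq> node_set \<I> l k" using *(1) assms(3) by (meson UN_upper order_trans)
  show "node_set \<I> (Suc l) s \<inter> node_set \<I> (Suc l) s' = {}" if "s' \<in> children \<I> l k" "s \<noteq> s'"
    using *(2) assms(3) that by (rule disjoint_family_onD)
qed

text \<open>Siblings are disjoint by definition; otherwise the parents are disjoint by induction and
  contain the nodes.\<close>

lemma index_tree_level_disjoint:
  assumes "is_index_tree d \<I>"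
  shows "(l, k) \<in> tree_nodes \<I> \<Longrightarrow> (l, k') \<in> tree_nodes \<I> \<Longrightarrow> k \<noteq> k' \<Longrightarrow>
    node_set \<I> l k \<inter> node_set \<I> l k' = {}"
proof (induction l arbitrary: k k')
  case 0
  thus ?case using assms unfolding is_index_tree_def tree_nodes_def by auto
next
  case (Suc l)
  note p = index_tree_parent[OF assms Suc.prems(1)] index_tree_parent[OF assms Suc.prems(2)]
  show ?case
  proof (cases "parent \<I> (Suc l) k = parent \<I> (Suc l) k'")
    case True
    thus ?thesis using index_tree_children(2)[OF assms p(1,2)] p(4) Suc.prems(3) by simp
  next
    case False
    hence "node_set \<I> l (parent \<I> (Suc l) k) \<inter> node_set \<I> l (parent \<I> (Suc l) k') = {}"
      using Suc.IH p(1,3) by blast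
    thus ?thesis using index_tree_children(1)[OF assms p(1,2)] index_tree_children(1)[OF assms p(3,4)] by blast
  qed
qed

lemma finite_children: "finite (children \<I> l k)"
  by (rule finite_subset[of _ "{1..width \<I> (l + 1)}"]) (auto simp: children_def tree_nodes_def)

text \<open>Going down from the root, the part of S outside a node is kept in \<open>F\<close>. At a
  child s the transfer equation is inserted and everything but the factor of s is collected in the
  new \<open>F\<close>; this avoids the modes of s because siblings and leftover modes are disjoint
  from s.\<close>

lemma ttn_rank_factor:
  assumes tree: "is_index_tree d \<I>"
    and root: "\<And>i. i \<in> multi_indices n {1..d} \<Longrightarrow> U 0 1 $$ (colex_pos n {1..d} i, 0) = S i"
    and inner: "\<forall>(l, k)\<in>tree_nodes \<I>. children \<I> l k \<noteq> {} \<longrightarrow>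
           (let I = node_set \<I> l k;
                C = children \<I> l k;
                J = I - (\<Union>s\<in>C. node_set \<I> (l + 1) s)
            in \<exists>B :: (nat \<Rightarrow> nat) \<Rightarrow> (nat \<Rightarrow> nat) \<Rightarrow> nat \<Rightarrow> real.
                 \<forall>i\<in>multi_indices n I. \<forall>a<node_rank r l k.
                   U l k $$ (colex_pos n I i, a) =
                   (\<Sum>\<alpha>\<in>PiE C (\<lambda>s. {0..<node_rank r (l + 1) s}).
                      (\<Prod>s\<in>C. U (l + 1) s $$ (colex_pos n (node_set \<I> (l + 1) s) i, \<alpha> s))
                      * B \<alpha> (restrict i J) a))"
  shows "(l, k) \<in> tree_nodes \<I> \<Longrightarrow> \<exists>F :: (nat \<Rightarrow> nat) \<Rightarrow> nat \<Rightarrow> real.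
     (\<forall>i j a. (\<forall>\<mu>\<in>{1..d} - node_set \<I> l k. i \<mu> = j \<mu>) \<longrightarrow> F i a = F j a) \<and>
     (\<forall>i\<in>multi_indices n {1..d}. S i =
        (\<Sum>a<node_rank r l k. U l k $$ (colex_pos n (node_set \<I> l k) i, a) * F i a))"
proof (induction l arbitrary: k)
  case 0
  hence "k = 1" "node_set \<I> 0 k = {1..d}" using tree unfolding is_index_tree_def tree_nodes_def by auto
  thus ?case using root by (intro exI[of _ "\<lambda>_ _. 1"]) (auto simp: node_rank_def)
next
  case (Suc l s)
  define k where "k = parent \<I> (Suc l) s"
  have k: "(l, k) \<in> tree_nodes \<I>" "s \<in> children \<I> l k"
    unfolding k_def using index_tree_parent[OF tree Suc.prems] by auto
  let ?D = "{1..d}" and ?I = "node_set \<I> l k" and ?C = "children \<I> l k" and ?t = "node_set \<I> (Suc l) s"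
  let ?J = "?I - (\<Union>s\<in>?C. node_set \<I> (l + 1) s)"
  let ?R = "\<lambda>s. node_rank r (Suc l) s"
  obtain F where F: "\<And>i j a. (\<forall>\<mu>\<in>?D - ?I. i \<mu> = j \<mu>) \<Longrightarrow> F i a = F j a"
    and S: "\<And>i. i \<in> multi_indices n ?D \<Longrightarrow>
       S i = (\<Sum>a<node_rank r l k. U l k $$ (colex_pos n ?I i, a) * F i a)"
    using Suc.IH[OF k(1)] by blast
  have "\<exists>B :: (nat \<Rightarrow> nat) \<Rightarrow> (nat \<Rightarrow> nat) \<Rightarrow> nat \<Rightarrow> real.
     \<forall>i\<in>multi_indices n ?I. \<forall>a<node_rank r l k. U l k $$ (colex_pos n ?I i, a) =
       (\<Sum>\<alpha>\<in>PiE ?C (\<lambda>s. {0..<?R s}).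
          (\<Prod>s\<in>?C. U (Suc l) s $$ (colex_pos n (node_set \<I> (Suc l) s) i, \<alpha> s)) * B \<alpha> (restrict i ?J) a)"
    using inner k unfolding Let_def by fastforce
  then obtain B :: "(nat \<Rightarrow> nat) \<Rightarrow> (nat \<Rightarrow> nat) \<Rightarrow> nat \<Rightarrow> real" where
    B: "\<And>i a. i \<in> multi_indices n ?I \<Longrightarrow> a < node_rank r l k \<Longrightarrow> U l k $$ (colex_pos n ?I i, a) =
       (\<Sum>\<alpha>\<in>PiE ?C (\<lambda>s. {0..<?R s}).
          (\<Prod>s\<in>?C. U (Suc l) s $$ (colex_pos n (node_set \<I> (Suc l) s) i, \<alpha> s)) * B \<alpha> (restrict i ?J) a)"
    by blast
  have tI: "?t \<subseteq> ?I" by (rule index_tree_children(1)[OF tree k])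
  have ID: "?I \<subseteq> ?D" by (rule index_tree_node_subset[OF tree k(1)])
  have fC: "finite ?C" by (rule finite_children)
  define V where "V i s' a = U (Suc l) s' $$ (colex_pos n (node_set \<I> (Suc l) s') i, a)" for i s' a
  define A where "A = PiE ?C (\<lambda>s. {0..<?R s})"
  have fA: "finite A" unfolding A_def by (intro finite_PiE fC) auto
  have UB: "U l k $$ (colex_pos n ?I i, a) = (\<Sum>\<alpha>\<in>A. (\<Prod>s\<in>?C. V i s (\<alpha> s)) * B \<alpha> (restrict i ?J) a)"
    if i: "i \<in> multi_indices n ?D" and a: "a < node_rank r l k" for i a
  proof -
    have "colex_pos n (node_set \<I> (Suc l) s') (restrict i ?I) = colex_pos n (node_set \<I> (Suc l) s') i" if "s' \<in> ?C" for s'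
      using index_tree_children(1)[OF tree k(1) that] by (intro colex_pos_cong) auto
    moreover have "restrict (restrict i ?I) ?J = restrict i ?J" by (auto simp: fun_eq_iff restrict_def)
    ultimately show ?thesis
      using B[OF multi_indices_restrict[OF i ID] a] unfolding A_def V_def by (simp add: colex_pos_restrict)
  qed
  \<comment> \<open>The sum over the ranks \<alpha> of all children is grouped by the value b =
    \<alpha> s at the chosen child.\<close>
  define G where "G i b = (\<Sum>a<node_rank r l k. (\<Sum>\<alpha>\<in>{\<alpha>\<in>A. \<alpha> s = b}.
      (\<Prod>s'\<in>?C - {s}. V i s' (\<alpha> s')) * B \<alpha> (restrict i ?J) a) * F i a)" for i b
  show ?case
  proof (intro exI[of _ G] conjI allI impI ballI)
    fix i j :: "nat \<Rightarrow> nat" and b assume ij: "\<forall>\<mu>\<in>?D - ?t. i \<mu> = j \<mu>"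
    have "V i s' a = V j s' a" if "s' \<in> ?C - {s}" for s' a
    proof -
      have "node_set \<I> (Suc l) s' \<subseteq> ?D - ?t"
        using index_tree_children(1)[OF tree k(1), of s'] index_tree_children(2)[OF tree k(1), of s' s] that k(2) ID
        by auto
      hence "colex_pos n (node_set \<I> (Suc l) s') i = colex_pos n (node_set \<I> (Suc l) s') j"
        using ij by (intro colex_pos_cong) auto
      thus ?thesis unfolding V_def by simp
    qed
    moreover have "restrict i ?J = restrict j ?J"
      using ij ID k(2) by (auto simp: fun_eq_iff restrict_def)
    moreover have "F i a = F j a" for a by (rule F) (use ij tI in auto)
    ultimately show "G i b = G j b" unfolding G_def by simp
  next
    fix i assume i: "i \<in> multi_indices n ?D"
    have bij: "\<alpha> s < ?R s" if "\<alpha> \<in> A" for \<alpha> using that k(2) unfolding A_def by auto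
    have "U l k $$ (colex_pos n ?I i, a) = (\<Sum>b<?R s. V i s b *
       (\<Sum>\<alpha>\<in>{\<alpha>\<in>A. \<alpha> s = b}. (\<Prod>s'\<in>?C - {s}. V i s' (\<alpha> s')) * B \<alpha> (restrict i ?J) a))"
      if a: "a < node_rank r l k" for a
    proof -
      have "U l k $$ (colex_pos n ?I i, a) = (\<Sum>\<alpha>\<in>A. V i s (\<alpha> s) * ((\<Prod>s'\<in>?C - {s}. V i s' (\<alpha> s')) * B \<alpha> (restrict i ?J) a))"
        unfolding UB[OF i a] using fC k(2) by (intro sum.cong refl) (simp add: prod.remove mult.assoc)
      also have "\<dots> = (\<Sum>b<?R s. \<Sum>\<alpha>\<in>{\<alpha>\<in>A. \<alpha> s = b}. V i s (\<alpha> s) * ((\<Prod>s'\<in>?C - {s}. V i s' (\<alpha> s')) * B \<alpha> (restrict i ?J) a))"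
        by (rule sum.group[symmetric]) (use fA bij in auto)
      finally show ?thesis by (simp add: sum_distrib_left)
    qed
    hence "S i = (\<Sum>a<node_rank r l k. \<Sum>b<?R s. V i s b *
       ((\<Sum>\<alpha>\<in>{\<alpha>\<in>A. \<alpha> s = b}. (\<Prod>s'\<in>?C - {s}. V i s' (\<alpha> s')) * B \<alpha> (restrict i ?J) a) * F i a))"
      unfolding S[OF i] by (intro sum.cong refl) (simp add: sum_distrib_right mult.assoc)
    also have "\<dots> = (\<Sum>b<?R s. V i s b * G i b)"
      unfolding G_def by (subst sum.swap) (simp add: sum_distrib_left)
    finally show "S i = (\<Sum>b<?R s. U (Suc l) s $$ (colex_pos n ?t i, b) * G i b)" unfolding V_def .
  qed
qed

text \<open>The values of \<open>F\<close> at the column indices form a matrix C such that the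
  unfolding of S is U C with inner dimension \<open>r l k\<close>, and the Eckart-Young bound
  applies.\<close>

lemma sv_tail_le_ttn_error:
  assumes tree: "is_index_tree d \<I>" and S: "has_ttn_rank n d \<I> r S" and lk: "(l, k) \<in> nonroot_nodes \<I>"
  shows "sv_tail (matricize n {1..d} (node_set \<I> l k) T) (r l k) \<le> frob_norm n {1..d} (T - S)"
proof -
  let ?D = "{1..d}" and ?t = "node_set \<I> l k" and ?R = "node_rank r l k"
  have lk': "(l, k) \<in> tree_nodes \<I>" by (rule nonroot_tree_nodes[OF lk])
  have tD: "?t \<subseteq> ?D" by (rule index_tree_node_subset[OF tree lk'])
  have f: "finite ?t" "finite (?D - ?t)" using tD finite_subset by auto
  have R: "?R = r l k" using lk unfolding node_rank_def nonroot_nodes_def by auto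
  obtain U :: "nat \<Rightarrow> nat \<Rightarrow> real mat" where
    U1: "\<And>l k. (l, k) \<in> tree_nodes \<I> \<Longrightarrow> U l k \<in> carrier_mat (dim_prod n (node_set \<I> l k)) (node_rank r l k)"
    and U2: "\<And>i. i \<in> multi_indices n ?D \<Longrightarrow> U 0 1 $$ (colex_pos n ?D i, 0) = S i"
    and U3: "\<forall>(l, k)\<in>tree_nodes \<I>. children \<I> l k \<noteq> {} \<longrightarrow>
           (let I = node_set \<I> l k;
                C = children \<I> l k;
                J = I - (\<Union>s\<in>C. node_set \<I> (l + 1) s)
            in \<exists>B :: (nat \<Rightarrow> nat) \<Rightarrow> (nat \<Rightarrow> nat) \<Rightarrow> nat \<Rightarrow> real.
                 \<forall>i\<in>multi_indices n I. \<forall>a<node_rank r l k.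
                   U l k $$ (colex_pos n I i, a) =
                   (\<Sum>\<alpha>\<in>PiE C (\<lambda>s. {0..<node_rank r (l + 1) s}).
                      (\<Prod>s\<in>C. U (l + 1) s $$ (colex_pos n (node_set \<I> (l + 1) s) i, \<alpha> s))
                      * B \<alpha> (restrict i J) a))"
    using S unfolding has_ttn_rank_def by (elim exE conjE) blast
  obtain F :: "(nat \<Rightarrow> nat) \<Rightarrow> nat \<Rightarrow> real" where
    F1: "\<And>i j a. (\<forall>\<mu>\<in>?D - ?t. i \<mu> = j \<mu>) \<Longrightarrow> F i a = F j a"
    and F2: "\<And>i. i \<in> multi_indices n ?D \<Longrightarrow> S i = (\<Sum>a<?R. U l k $$ (colex_pos n ?t i, a) * F i a)"
    using ttn_rank_factor[OF tree U2 U3 lk'] by blast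
  have dU: "dim_row (U l k) = dim_prod n ?t" "dim_col (U l k) = ?R" using U1[OF lk'] by auto
  define C where "C = Matrix.mat ?R (dim_prod n (?D - ?t)) (\<lambda>(a, b). F (colex_nth n (?D - ?t) b) a)"
  have dC: "dim_row C = ?R" "dim_col C = dim_prod n (?D - ?t)" unfolding C_def by auto
  have "matricize n ?D ?t S = U l k * C"
  proof (intro eq_matI)
    fix x y assume "x < dim_row (U l k * C)" "y < dim_col (U l k * C)"
    hence xy: "x < dim_prod n ?t" "y < dim_prod n (?D - ?t)" using dU dC by auto
    let ?i = "splice_index ?D ?t (colex_nth n ?t x) (colex_nth n (?D - ?t) y)"
    have i: "?i \<in> multi_indices n ?D" by (intro splice_index_mem[OF tD] colex_nth_mem f xy)
    have "F ?i a = F (colex_nth n (?D - ?t) y) a" for a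
      by (rule F1) (simp add: splice_index_apply)
    moreover have "colex_pos n ?t ?i = x"
      unfolding colex_pos_splice(1)[OF tD] by (rule colex_nth_pos[OF f(1) xy(1)])
    ultimately have "matricize n ?D ?t S $$ (x, y) = (\<Sum>a<?R. U l k $$ (x, a) * F (colex_nth n (?D - ?t) y) a)"
      unfolding matricize_entry[OF xy] F2[OF i] by (simp only:)
    also have "\<dots> = (U l k * C) $$ (x, y)"
      using xy dU dC by (subst mult_mat_entry) (auto simp: C_def)
    finally show "matricize n ?D ?t S $$ (x, y) = (U l k * C) $$ (x, y)" .
  qed (use dU dC in auto)
  hence "mfro (matricize n ?D ?t T - U l k * C) = frob_norm n ?D (T - S)"
    using frob_norm_matricize[of ?D ?t n "T - S"] tD by (simp add: matricize_minus)
  moreover have "sv_tail (matricize n ?D ?t T) ?R \<le> mfro (matricize n ?D ?t T - U l k * C)"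
    by (rule sv_tail_le_low_rank) (use dU dC in auto)
  ultimately show ?thesis unfolding R by simp
qed

section \<open>Propagation of the error through the tree\<close>

definition node_less :: "nat \<times> nat \<Rightarrow> nat \<times> nat \<Rightarrow> bool" where
  "node_less u v \<longleftrightarrow> fst u < fst v \<or> fst u = fst v \<and> snd u < snd v"

text \<open>Lexicographically decreasing, since \<open>foldr\<close> applies the last operator of the list first.\<close>

fun nodes_desc :: "index_tree \<Rightarrow> nat \<Rightarrow> (nat \<times> nat) list" where
  "nodes_desc \<I> 0 = []"
| "nodes_desc \<I> (Suc l) = map (Pair (Suc l)) (rev [1..<Suc (width \<I> (Suc l))]) @ nodes_desc \<I> l"

lemma set_nodes_desc: "set (nodes_desc \<I> L) = (SIGMA l:{1..L}. {1..width \<I> l})"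
proof (induction L)
  case (Suc L)
  have "set (nodes_desc \<I> (Suc L)) = {Suc L} \<times> {1..width \<I> (Suc L)} \<union> (SIGMA l:{1..L}. {1..width \<I> l})"
    using Suc.IH by auto
  thus ?case by (auto simp: atLeastAtMostSuc_conv)
qed auto

lemma sorted_nodes_desc: "sorted_wrt (\<lambda>u v. node_less v u) (nodes_desc \<I> L)"
proof (induction L)
  case (Suc L)
  have "sorted_wrt (\<lambda>u v. node_less v u) (map (Pair (Suc L)) (rev [1..<Suc (width \<I> (Suc L))]))"
    unfolding sorted_wrt_map sorted_wrt_rev
    by (rule sorted_wrt_mono_rel[OF _ sorted_wrt_upt]) (auto simp: node_less_def)
  thus ?case using Suc.IH by (auto simp: sorted_wrt_append set_nodes_desc node_less_def)
qed simp

lemma distinct_nodes_desc: "distinct (nodes_desc \<I> L)"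
proof -
  have "sorted_wrt (\<lambda>u v. node_less v u) vs \<Longrightarrow> distinct vs" for vs
    by (induction vs) (auto simp: node_less_def)
  thus ?thesis using sorted_nodes_desc by blast
qed

text \<open>The recursion for the expected error. The head of the list is the projection applied
  last: it adds its own error and amplifies the error made before.\<close>

fun err_rec :: "('v \<Rightarrow> real) \<Rightarrow> ('v \<Rightarrow> real) \<Rightarrow> 'v list \<Rightarrow> real" where
  "err_rec c e [] = 0"
| "err_rec c e (v # vs) = e v + c v * err_rec c e vs"

lemma err_rec_nonneg:
  "(\<And>v. v \<in> set vs \<Longrightarrow> 0 \<le> c v) \<Longrightarrow> (\<And>v. v \<in> set vs \<Longrightarrow> 0 \<le> e v) \<Longrightarrow> 0 \<le> err_rec c e vs"
  by (induction vs) auto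

text \<open>Unrolling multiplies the error of a node by the factors of the nodes in front of it, and
  in a decreasing list these are the larger nodes.\<close>

lemma err_rec_eq_sum:
  "sorted_wrt (\<lambda>u v. node_less v u) vs \<Longrightarrow>
   err_rec c e vs = (\<Sum>v\<in>set vs. (\<Prod>u\<in>{u \<in> set vs. node_less v u}. c u) * e v)"
proof (induction vs)
  case (Cons v vs)
  have less: "node_less w v" if "w \<in> set vs" for w using Cons.prems that by auto
  hence nl: "\<not> node_less v w" if "w \<in> set vs" for w using that by (fastforce simp: node_less_def)
  have vn: "v \<notin> set vs" using less[of v] by (auto simp: node_less_def)
  have 1: "{u \<in> set (v # vs). node_less v u} = {}"
    using nl node_less_def[of v v] by auto
  have 2: "(\<Prod>u\<in>{u \<in> set (v # vs). node_less w u}. c u) = c v * (\<Prod>u\<in>{u \<in> set vs. node_less w u}. c u)"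
    if "w \<in> set vs" for w
  proof -
    have "{u \<in> set (v # vs). node_less w u} = insert v {u \<in> set vs. node_less w u}" using less[OF that] by auto
    thus ?thesis using vn by simp
  qed
  define f where "f w = (\<Prod>u\<in>{u \<in> set (v # vs). node_less w u}. c u) * e w" for w
  have "(\<Sum>w\<in>set (v # vs). f w) = f v + (\<Sum>w\<in>set vs. f w)" using vn by simp
  also have "f v = e v" unfolding f_def 1 by simp
  also have "(\<Sum>w\<in>set vs. f w) = (\<Sum>w\<in>set vs. c v * ((\<Prod>u\<in>{u \<in> set vs. node_less w u}. c u) * e w))"
    unfolding f_def by (intro sum.cong refl) (simp add: 2 mult.assoc del: list.set)
  also have "e v + \<dots> = err_rec c e (v # vs)" using Cons by (simp add: sum_distrib_left)
  finally show ?case unfolding f_def ..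
qed simp

definition node_apply ::
  "(nat \<Rightarrow> nat) \<Rightarrow> nat \<Rightarrow> index_tree \<Rightarrow> tensor \<Rightarrow> (nat \<Rightarrow> nat \<Rightarrow> real mat) \<Rightarrow> (nat \<Rightarrow> nat \<Rightarrow> real mat) \<Rightarrow>
   nat \<times> nat \<Rightarrow> tensor \<Rightarrow> tensor" where
  "node_apply n d \<I> T X Y v = mode_apply n {1..d} (node_set \<I> (fst v) (snd v))
     (sketch_proj (matricize n {1..d} (node_set \<I> (fst v) (snd v)) T) (X (fst v) (snd v)) (Y (fst v) (snd v)))"

lemma foldr_cong_on:
  assumes "\<And>x S S'. x \<in> set xs \<Longrightarrow> (\<And>i. i \<in> E \<Longrightarrow> S i = S' i) \<Longrightarrow> f x S = f x S'"
    and "\<And>i. i \<in> E \<Longrightarrow> S i = S' i" "i \<in> E"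
  shows "foldr f xs S i = foldr f xs S' i"
  using assms
proof (induction xs arbitrary: i)
  case (Cons x xs)
  have "foldr f xs S i = foldr f xs S' i" if "i \<in> E" for i
  proof (rule Cons.IH)
    show "f y S1 = f y S2" if "y \<in> set xs" "\<And>i. i \<in> E \<Longrightarrow> S1 i = S2 i" for y S1 S2
      by (rule Cons.prems(1)[OF _ that(2)]) (use that(1) in simp_all)
  qed (use Cons.prems(2) that in auto)
  hence "f x (foldr f xs S) = f x (foldr f xs S')"
    by (intro Cons.prems(1)) auto
  thus ?case by simp
qed simp

lemma sketch_proj_carrier:
  assumes "A \<in> carrier_mat a b" "X \<in> carrier_mat b r" "Y \<in> carrier_mat a s"
  shows "sketch_proj A X Y \<in> carrier_mat a a"
  using assms unfolding sketch_proj_def by (intro carrier_matI) auto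

text \<open>Level by level, the ascending list in the definition is reversed with
  \<open>foldr_commute_rev\<close>.\<close>

lemma ttnn_level_eq_foldr:
  assumes tree: "is_index_tree d \<I>"
    and X: "\<And>l k. (l, k) \<in> nonroot_nodes \<I> \<Longrightarrow>
      X l k \<in> carrier_mat (dim_prod n ({1..d} - node_set \<I> l k)) (r l k)"
    and Y: "\<And>l k. (l, k) \<in> nonroot_nodes \<I> \<Longrightarrow> Y l k \<in> carrier_mat (dim_prod n (node_set \<I> l k)) (s l k)"
  shows "L \<le> depth \<I> \<Longrightarrow> i \<in> multi_indices n {1..d} \<Longrightarrow>
    ttnn_level n d \<I> T X Y L i = foldr (node_apply n d \<I> T X Y) (nodes_desc \<I> L) T i"
proof (induction L arbitrary: i)
  case (Suc L)
  let ?D = "{1..d}" and ?l = "Suc L"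
  let ?f = "\<lambda>k. mode_apply n ?D (node_set \<I> ?l k) (ttnn_proj n d \<I> T X Y ?l k)"
  let ?A = "{1..width \<I> ?l}"
  have tn: "(?l, k) \<in> nonroot_nodes \<I>" if "k \<in> ?A" for k
    using that Suc.prems(1) unfolding nonroot_nodes_def by auto
  have sub: "node_set \<I> ?l k \<subseteq> ?D" if "k \<in> ?A" for k
    by (rule index_tree_node_subset[OF tree nonroot_tree_nodes[OF tn[OF that]]])
  have f_eq: "?f k = node_apply n d \<I> T X Y (?l, k)" for k
    unfolding node_apply_def ttnn_proj_def sketch_proj_def Let_def by simp
  have car: "ttnn_proj n d \<I> T X Y ?l k \<in> carrier_mat (dim_prod n (node_set \<I> ?l k)) (dim_prod n (node_set \<I> ?l k))"
    if "k \<in> ?A" for k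
    using sketch_proj_carrier[OF matricize_carrier X[OF tn[OF that]] Y[OF tn[OF that]]]
    unfolding ttnn_proj_def sketch_proj_def Let_def by simp
  have cong: "?f k S = ?f k S'" if "k \<in> ?A" "\<And>i. i \<in> multi_indices n ?D \<Longrightarrow> S i = S' i" for k S S'
    by (rule mode_apply_cong[OF _ sub[OF that(1)] that(2)]) auto
  have comm: "?f k (?f k' S) i = ?f k' (?f k S) i" if "k \<in> ?A" "k' \<in> ?A" "k \<noteq> k'" "i \<in> multi_indices n ?D" for k k' S i
    by (rule mode_apply_commute[OF _ sub[OF that(1)] car[OF that(1)] sub[OF that(2)] car[OF that(2)]
        index_tree_level_disjoint[OF tree nonroot_tree_nodes[OF tn[OF that(1)]] nonroot_tree_nodes[OF tn[OF that(2)]] that(3)] that(4)]) simp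
  have sx: "set [1..<Suc (width \<I> ?l)] = ?A" by auto
  have "ttnn_level n d \<I> T X Y ?l i = foldr ?f [1..<Suc (width \<I> ?l)] (ttnn_level n d \<I> T X Y L) i"
    by simp
  also have "\<dots> = foldr ?f (rev [1..<Suc (width \<I> ?l)]) (ttnn_level n d \<I> T X Y L) i"
  proof (rule foldr_commute_rev[where A = ?A and E = "multi_indices n ?D" and f = ?f, symmetric])
    show "?f k S = ?f k S'" if "k \<in> ?A" "\<And>i. i \<in> multi_indices n ?D \<Longrightarrow> S i = S' i" for k S S'
      using that by (rule cong)
    show "?f k (?f k' S) i = ?f k' (?f k S) i" if "k \<in> ?A" "k' \<in> ?A" "k \<noteq> k'" "i \<in> multi_indices n ?D" for k k' S i
      using that by (rule comm)
  qed (use sx Suc.prems in auto)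
  also have "\<dots> = foldr ?f (rev [1..<Suc (width \<I> ?l)]) (foldr (node_apply n d \<I> T X Y) (nodes_desc \<I> L) T) i"
  proof (rule foldr_cong_on[where E = "multi_indices n ?D" and f = ?f])
    show "?f k S = ?f k S'" if "k \<in> set (rev [1..<Suc (width \<I> ?l)])"
      "\<And>i. i \<in> multi_indices n ?D \<Longrightarrow> S i = S' i" for k S S'
      using that sx by (intro cong) auto
  qed (use Suc in auto)
  also have "\<dots> = foldr (node_apply n d \<I> T X Y) (nodes_desc \<I> ?l) T i"
    unfolding f_eq by (simp add: foldr_map comp_def)
  finally show ?case .
qed simp

lemma mat_meas_compose:
  assumes F: "mat_meas N a b F" and g: "g \<in> measurable M N"
  shows "mat_meas M a b (\<lambda>x. F (g x))"
  unfolding mat_meas_def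
  using mat_measD(1)[OF F measurable_space[OF g]] measurable_compose[OF g mat_measD(4)[OF F]] by auto

lemma tensor_meas_matricize:
  assumes "finite D" "I \<subseteq> D" "\<And>i. i \<in> multi_indices n D \<Longrightarrow> (\<lambda>x. S x i) \<in> borel_measurable M"
  shows "mat_meas M (dim_prod n I) (dim_prod n (D - I)) (\<lambda>x. matricize n D I (S x))"
proof (rule mat_meas_entrywise)
  have f: "finite I" "finite (D - I)" using assms finite_subset by auto
  show "matricize n D I (S x) $$ (a, b) = S x (splice_index D I (colex_nth n I a) (colex_nth n (D - I) b))"
    if "a < dim_prod n I" "b < dim_prod n (D - I)" for x a b
    using that by (rule matricize_entry)
  show "(\<lambda>x. S x (splice_index D I (colex_nth n I a) (colex_nth n (D - I) b))) \<in> borel_measurable M"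
    if "a < dim_prod n I" "b < dim_prod n (D - I)" for a b
    by (intro assms(3) splice_index_mem[OF assms(2)] colex_nth_mem f that)
qed (rule matricize_carrier)

lemma tensor_meas_mode_apply:
  assumes D: "finite D" "I \<subseteq> D" and S: "\<And>i. i \<in> multi_indices n D \<Longrightarrow> (\<lambda>x. S x i) \<in> borel_measurable M"
    and P: "mat_meas M (dim_prod n I) (dim_prod n I) P" and i: "i \<in> multi_indices n D"
  shows "(\<lambda>x. mode_apply n D I (P x) (S x) i) \<in> borel_measurable M"
proof -
  have f: "finite I" using D finite_subset by auto
  have p: "colex_pos n I i < dim_prod n I"
    using colex_pos_nth(1)[OF f multi_indices_restrict[OF i D(2)]] by (simp add: colex_pos_restrict)
  have "(\<lambda>x. \<Sum>j\<in>multi_indices n I. P x $$ (colex_pos n I i, colex_pos n I j) * S x (splice_index D I j i)) \<in> borel_measurable M"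
    by (intro borel_measurable_sum borel_measurable_times mat_measD(4)[OF P p] S splice_index_mem'[OF D(2) _ i] colex_pos_nth(1)[OF f])
  thus ?thesis
    by (subst measurable_cong[OF mode_apply_eq_sum[OF D mat_measD(1)[OF P] i]])
qed

text \<open>The rank condition is an inequality of natural numbers, r' + 2 \<le> r, the form in
  which the Gaussian bounds take it.\<close>

locale ttnn_setting =
  fixes n :: "nat \<Rightarrow> nat" and d :: nat and \<I> :: index_tree and T :: tensor and r p r' :: "nat \<Rightarrow> nat \<Rightarrow> nat"
  assumes tree: "is_index_tree d \<I>"
    and p_gt: "(l, k) \<in> nonroot_nodes \<I> \<Longrightarrow> 1 < p l k"
    and r'_le: "(l, k) \<in> nonroot_nodes \<I> \<Longrightarrow> r' l k + 2 \<le> r l k"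
begin

definition node_rows where "node_rows v = dim_prod n (node_set \<I> (fst v) (snd v))"
definition node_cols where "node_cols v = dim_prod n ({1..d} - node_set \<I> (fst v) (snd v))"
definition node_r where "node_r v = r (fst v) (snd v)"
definition node_p where "node_p v = p (fst v) (snd v)"

text \<open>On the product of these measures independence becomes Fubini's theorem, and the sketches
  of a node are two coordinates that can be integrated out.\<close>

definition coord_law :: "(nat \<times> nat) + (nat \<times> nat) \<Rightarrow> (nat \<times> nat \<Rightarrow> real) measure" where
  "coord_law = case_sum (\<lambda>v. gauss ({0..<node_cols v} \<times> {0..<node_r v})) (\<lambda>v. gauss ({0..<node_rows v} \<times> {0..<node_r v + node_p v}))"

definition coords :: "(nat \<times> nat) list \<Rightarrow> ((nat \<times> nat) + (nat \<times> nat)) set" where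
  "coords vs = set vs <+> set vs"

definition col_sketch where "col_sketch \<xi> v = entry_mat (node_cols v) (node_r v) (\<xi> (Inl v))"
definition row_sketch where "row_sketch \<xi> v = entry_mat (node_rows v) (node_r v + node_p v) (\<xi> (Inr v))"

definition node_mat where "node_mat v = matricize n {1..d} (node_set \<I> (fst v) (snd v)) T"

definition node_step where "node_step \<xi> v = mode_apply n {1..d} (node_set \<I> (fst v) (snd v)) (sketch_proj (node_mat v) (col_sketch \<xi> v) (row_sketch \<xi> v))"

definition approx where "approx \<xi> vs = foldr (node_step \<xi>) vs T"

definition node_err where "node_err v = c'_const (node_r v) (node_p v) (r' (fst v) (snd v)) * sv_tail (node_mat v) (r' (fst v) (snd v))"

definition node_amp where "node_amp v = c_const (node_r v) (node_p v)"

lemma node_sub: "v \<in> nonroot_nodes \<I> \<Longrightarrow> node_set \<I> (fst v) (snd v) \<subseteq> {1..d}"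
  by (rule index_tree_node_subset[OF tree nonroot_tree_nodes]) simp

lemma node_mat_carrier: "node_mat v \<in> carrier_mat (node_rows v) (node_cols v)"
  unfolding node_mat_def node_rows_def node_cols_def by (rule matricize_carrier)

lemma col_sketch_carrier: "col_sketch \<xi> v \<in> carrier_mat (node_cols v) (node_r v)"
  unfolding col_sketch_def by (intro carrier_matI) auto

lemma row_sketch_carrier: "row_sketch \<xi> v \<in> carrier_mat (node_rows v) (node_r v + node_p v)"
  unfolding row_sketch_def by (intro carrier_matI) auto

lemma proj_carrier: "sketch_proj (node_mat v) (col_sketch \<xi> v) (row_sketch \<xi> v) \<in> carrier_mat (node_rows v) (node_rows v)"
  by (rule sketch_proj_carrier[OF node_mat_carrier col_sketch_carrier row_sketch_carrier])

lemma prob_coord_law: "prob_space (coord_law c)"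
  unfolding coord_law_def by (cases c) (auto intro: prob_space_gauss)

lemma col_sketch_meas: "Inl v \<in> K \<Longrightarrow> mat_meas (PiM K coord_law) (node_cols v) (node_r v) (\<lambda>\<xi>. col_sketch \<xi> v)"
proof -
  assume "Inl v \<in> K"
  hence "(\<lambda>\<xi>. \<xi> (Inl v)) \<in> measurable (PiM K coord_law) (coord_law (Inl v))" by measurable
  thus ?thesis unfolding col_sketch_def by (intro mat_meas_compose[OF mat_meas_entry_mat]) (simp add: coord_law_def)
qed

lemma row_sketch_meas: "Inr v \<in> K \<Longrightarrow> mat_meas (PiM K coord_law) (node_rows v) (node_r v + node_p v) (\<lambda>\<xi>. row_sketch \<xi> v)"
proof -
  assume "Inr v \<in> K"
  hence "(\<lambda>\<xi>. \<xi> (Inr v)) \<in> measurable (PiM K coord_law) (coord_law (Inr v))" by measurable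
  thus ?thesis unfolding row_sketch_def by (intro mat_meas_compose[OF mat_meas_entry_mat]) (simp add: coord_law_def)
qed

lemma proj_meas:
  assumes "Inl v \<in> K" "Inr v \<in> K"
  shows "mat_meas (PiM K coord_law) (node_rows v) (node_rows v) (\<lambda>\<xi>. sketch_proj (node_mat v) (col_sketch \<xi> v) (row_sketch \<xi> v))"
proof -
  note A = mat_meas_const[OF node_mat_carrier] and X = col_sketch_meas[OF assms(1)] and Y = row_sketch_meas[OF assms(2)]
  show ?thesis unfolding sketch_proj_def
    by (rule mat_meas_mult[OF mat_meas_mult[OF mat_meas_mult[OF A X]
        mat_meas_pinv[OF mat_meas_mult[OF mat_meas_mult[OF mat_meas_transpose[OF Y] A] X]]] mat_meas_transpose[OF Y]])
qed

lemma approx_meas: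
  assumes "set vs \<subseteq> nonroot_nodes \<I>" "Inl ` set vs \<subseteq> K" "Inr ` set vs \<subseteq> K" "i \<in> multi_indices n {1..d}"
  shows "(\<lambda>\<xi>. approx \<xi> vs i) \<in> borel_measurable (PiM K coord_law)"
  using assms
proof (induction vs arbitrary: i)
  case (Cons v vs)
  have "(\<lambda>\<xi>. mode_apply n {1..d} (node_set \<I> (fst v) (snd v)) (sketch_proj (node_mat v) (col_sketch \<xi> v) (row_sketch \<xi> v)) (approx \<xi> vs) i)
     \<in> borel_measurable (PiM K coord_law)"
    by (rule tensor_meas_mode_apply) (use Cons node_sub proj_meas in \<open>auto simp: node_rows_def[symmetric]\<close>)
  thus ?case unfolding approx_def node_step_def by simp
qed (simp add: approx_def)

text \<open>The independence of the earlier approximation from the sketches of a new node, in the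
  form used under the integral.\<close>

lemma approx_upd:
  assumes "v \<notin> set vs" shows "approx (\<xi>(Inl v := x)) vs = approx \<xi> vs" "approx (\<xi>(Inr v := y)) vs = approx \<xi> vs"
  using assms by (induction vs) (auto simp: approx_def node_step_def col_sketch_def row_sketch_def)

lemma approx_Cons_error:
  assumes "v \<in> nonroot_nodes \<I>"
  defines "P \<equiv> \<lambda>\<xi>. sketch_proj (node_mat v) (col_sketch \<xi> v) (row_sketch \<xi> v)"
  shows "frob_norm n {1..d} (T - approx \<xi> (v # vs)) \<le>
    mfro (node_mat v - P \<xi> * node_mat v) + mfro (P \<xi> * matricize n {1..d} (node_set \<I> (fst v) (snd v)) (T - approx \<xi> vs))"
proof -
  let ?I = "node_set \<I> (fst v) (snd v)" and ?D = "{1..d}"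
  let ?S = "matricize n ?D ?I (approx \<xi> vs)"
  have P: "P \<xi> \<in> carrier_mat (dim_prod n ?I) (dim_prod n ?I)" unfolding P_def using proj_carrier by (simp add: node_rows_def)
  hence dP: "dim_row (P \<xi>) = dim_prod n ?I" "dim_col (P \<xi>) = dim_prod n ?I" by auto
  have dA: "dim_row (node_mat v) = dim_prod n ?I" "dim_col (node_mat v) = dim_prod n (?D - ?I)" unfolding node_mat_def by auto
  have "frob_norm n ?D (T - approx \<xi> (v # vs)) = mfro (node_mat v - matricize n ?D ?I (approx \<xi> (v # vs)))"
    using frob_norm_matricize[of ?D ?I n "T - approx \<xi> (v # vs)"] node_sub[OF assms(1)]
    unfolding matricize_minus node_mat_def by simp
  also have "matricize n ?D ?I (approx \<xi> (v # vs)) = P \<xi> * ?S"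
  proof -
    have "approx \<xi> (v # vs) = mode_apply n ?D ?I (P \<xi>) (approx \<xi> vs)"
      unfolding approx_def node_step_def P_def by simp
    thus ?thesis using matricize_mode_apply[OF _ node_sub[OF assms(1)] P] by simp
  qed
  also have "node_mat v - P \<xi> * ?S = (node_mat v - P \<xi> * node_mat v) + P \<xi> * (node_mat v - ?S)"
    using dP dA by (subst mat_mult_minus) (auto intro!: eq_matI simp del: index_mult_mat(1))
  also have "mfro \<dots> \<le> mfro (node_mat v - P \<xi> * node_mat v) + mfro (P \<xi> * (node_mat v - ?S))"
    by (rule mfro_triangle) (use dP dA in auto)
  also have "node_mat v - ?S = matricize n ?D ?I (T - approx \<xi> vs)" unfolding matricize_minus node_mat_def ..
  finally show ?thesis .
qed

text \<open>Induction over the list: the two sketches of the head are integrated out while the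
  approximation by the tail stays fixed.\<close>

lemma nn_integral_approx_error:
  "distinct vs \<Longrightarrow> set vs \<subseteq> nonroot_nodes \<I> \<Longrightarrow>
   (\<integral>\<^sup>+\<xi>. ennreal (frob_norm n {1..d} (T - approx \<xi> vs)) \<partial>PiM (coords vs) coord_law) \<le> ennreal (err_rec node_amp node_err vs)"
proof (induction vs)
  case Nil
  show ?case by (simp add: approx_def frob_norm_def)
next
  case (Cons v vs)
  interpret product_prob_space coord_law
  proof -
    interpret prob_space "coord_law c" for c by (rule prob_coord_law)
    show "product_prob_space coord_law" by unfold_locales
  qed
  let ?D = "{1..d}" and ?I = "node_set \<I> (fst v) (snd v)"
  let ?J = "coords vs" and ?\<mu> = coord_law
  have v: "v \<in> nonroot_nodes \<I>" "v \<notin> set vs" and vs: "distinct vs" "set vs \<subseteq> nonroot_nodes \<I>" using Cons.prems by auto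
  have v': "(fst v, snd v) \<in> nonroot_nodes \<I>" using v by simp
  have fJ: "finite ?J" unfolding coords_def by simp
  have nJ: "Inl v \<notin> ?J" "Inr v \<notin> insert (Inl v) ?J" unfolding coords_def using v by auto
  have K: "coords (v # vs) = insert (Inr v) (insert (Inl v) ?J)" unfolding coords_def by auto
  let ?K = "insert (Inr v) (insert (Inl v) ?J)"
  define P where "P \<xi> = sketch_proj (node_mat v) (col_sketch \<xi> v) (row_sketch \<xi> v)" for \<xi>
  define S where "S \<xi> = matricize n ?D ?I (T - approx \<xi> vs)" for \<xi>
  have SC: "S \<xi> \<in> carrier_mat (node_rows v) (node_cols v)" for \<xi> unfolding S_def node_rows_def node_cols_def by (rule matricize_carrier)
  have Sm: "mat_meas (PiM K' ?\<mu>) (node_rows v) (node_cols v) S" if "?J \<subseteq> K'" for K'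
    unfolding S_def node_rows_def node_cols_def
  proof (rule tensor_meas_matricize[OF _ node_sub[OF v(1)]])
    fix i assume "i \<in> multi_indices n ?D"
    hence "(\<lambda>\<xi>. approx \<xi> vs i) \<in> borel_measurable (PiM K' ?\<mu>)"
      using that vs by (intro approx_meas) (auto simp: coords_def)
    thus "(\<lambda>\<xi>. (T - approx \<xi> vs) i) \<in> borel_measurable (PiM K' ?\<mu>)" by simp
  qed simp
  have Pm: "mat_meas (PiM ?K ?\<mu>) (node_rows v) (node_rows v) P" unfolding P_def by (rule proj_meas) auto
  let ?f1 = "\<lambda>\<xi>. ennreal (mfro (node_mat v - P \<xi> * node_mat v))" and ?f2 = "\<lambda>\<xi>. ennreal (mfro (P \<xi> * S \<xi>))"
  have m1: "?f1 \<in> borel_measurable (PiM ?K ?\<mu>)"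
    by (rule measurable_compose[OF mat_meas_mfro[OF mat_meas_minus[OF mat_meas_const[OF node_mat_carrier]
        mat_meas_mult[OF Pm mat_meas_const[OF node_mat_carrier]]]] measurable_ennreal])
  have m2: "?f2 \<in> borel_measurable (PiM ?K ?\<mu>)"
    by (rule measurable_compose[OF mat_meas_mfro[OF mat_meas_mult[OF Pm Sm]] measurable_ennreal]) auto
  \<comment> \<open>The row sketch is innermost, then the column sketch, then the earlier
    coordinates, because the one-step bounds integrate over Y for fixed X.\<close>
  have split: "(\<integral>\<^sup>+\<xi>. f \<xi> \<partial>PiM ?K ?\<mu>) =
     (\<integral>\<^sup>+\<xi>. (\<integral>\<^sup>+x. (\<integral>\<^sup>+y. f (\<xi>(Inl v := x, Inr v := y)) \<partial>?\<mu> (Inr v)) \<partial>?\<mu> (Inl v)) \<partial>PiM ?J ?\<mu>)"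
    if f: "f \<in> borel_measurable (PiM ?K ?\<mu>)" for f
  proof -
    have fI: "finite (insert (Inl v) ?J)" using fJ by simp
    have g: "(\<lambda>\<xi>. \<integral>\<^sup>+y. f (\<xi>(Inr v := y)) \<partial>?\<mu> (Inr v)) \<in> borel_measurable (PiM (insert (Inl v) ?J) ?\<mu>)"
    proof -
      have "(\<lambda>(\<xi>, y). f (\<xi>(Inr v := y))) \<in> borel_measurable (PiM (insert (Inl v) ?J) ?\<mu> \<Otimes>\<^sub>M ?\<mu> (Inr v))"
        using measurable_compose[OF measurable_add_dim f] by (simp add: split_def)
      thus ?thesis
        by (rule sigma_finite_measure.borel_measurable_nn_integral[OF prob_space_imp_sigma_finite[OF prob_coord_law]])
    qed
    show ?thesis
      by (subst product_nn_integral_insert[OF fI nJ(2) f], subst product_nn_integral_insert[OF fJ nJ(1) g]) simp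
  qed
  have laws: "?\<mu> (Inl v) = gauss ({0..<node_cols v} \<times> {0..<node_r v})" "?\<mu> (Inr v) = gauss ({0..<node_rows v} \<times> {0..<node_r v + node_p v})"
    unfolding coord_law_def by auto
  have Pu: "P (\<xi>(Inl v := x, Inr v := y)) = sketch_proj (node_mat v) (entry_mat (node_cols v) (node_r v) x) (entry_mat (node_rows v) (node_r v + node_p v) y)" for \<xi> x y
    unfolding P_def col_sketch_def row_sketch_def by simp
  have Su: "S (\<xi>(Inl v := x, Inr v := y)) = S \<xi>" for \<xi> x y
    unfolding S_def approx_upd[OF v(2)] ..
  have node_p: "1 < node_p v" and rr: "r' (fst v) (snd v) + 2 \<le> node_r v"
    unfolding node_p_def node_r_def using p_gt[OF v'] r'_le[OF v'] by auto
  have node_err0: "0 \<le> node_err w" if "w \<in> nonroot_nodes \<I>" for w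
  proof -
    have w: "(fst w, snd w) \<in> nonroot_nodes \<I>" using that by simp
    show ?thesis unfolding node_err_def c'_const_def sv_tail_def node_p_def node_r_def
      using p_gt[OF w] r'_le[OF w] by (auto intro!: mult_nonneg_nonneg sum_nonneg)
  qed
  have node_amp0: "0 \<le> node_amp w" if "w \<in> nonroot_nodes \<I>" for w
  proof -
    have w: "(fst w, snd w) \<in> nonroot_nodes \<I>" using that by simp
    show ?thesis unfolding node_amp_def c_const_def node_p_def node_r_def using p_gt[OF w] by auto
  qed
  \<comment> \<open>The residual of T itself does not read the earlier coordinates, so integrating
    over them contributes only the total mass 1.\<close>
  have i1: "(\<integral>\<^sup>+\<xi>. ?f1 \<xi> \<partial>PiM ?K ?\<mu>) \<le> ennreal (node_err v)"
  proof -
    interpret J: prob_space "PiM ?J ?\<mu>" by (rule prob_space_PiM) (rule prob_coord_law)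
    have "(\<integral>\<^sup>+\<xi>. ?f1 \<xi> \<partial>PiM ?K ?\<mu>) \<le> (\<integral>\<^sup>+\<xi>. ennreal (node_err v) \<partial>PiM ?J ?\<mu>)"
      unfolding split[OF m1] Pu laws node_err_def
      by (intro nn_integral_mono sketch_proj_error[OF node_mat_carrier rr node_p])
    also have "\<dots> = ennreal (node_err v)" by (simp add: J.emeasure_space_1)
    finally show ?thesis .
  qed
  \<comment> \<open>The bound for applying the projection is uniform in X, so the integral over X
    contributes only mass 1, and what remains is the induction hypothesis.\<close>
  have i2: "(\<integral>\<^sup>+\<xi>. ?f2 \<xi> \<partial>PiM ?K ?\<mu>) \<le> ennreal (node_amp v) * ennreal (err_rec node_amp node_err vs)"
  proof -
    interpret X: prob_space "gauss ({0..<node_cols v} \<times> {0..<node_r v})" by (rule prob_space_gauss)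
    have "(\<integral>\<^sup>+\<xi>. ?f2 \<xi> \<partial>PiM ?K ?\<mu>) \<le> (\<integral>\<^sup>+\<xi>. (\<integral>\<^sup>+x. ennreal (node_amp v * mfro (S \<xi>)) \<partial>gauss ({0..<node_cols v} \<times> {0..<node_r v})) \<partial>PiM ?J ?\<mu>)"
      unfolding split[OF m2] Pu Su laws node_amp_def
      by (intro nn_integral_mono sketch_proj_apply_bound[OF node_mat_carrier _ SC node_p] carrier_matI) auto
    also have "\<dots> = (\<integral>\<^sup>+\<xi>. ennreal (node_amp v) * ennreal (mfro (S \<xi>)) \<partial>PiM ?J ?\<mu>)"
      using node_amp0[OF v(1)] by (simp add: X.emeasure_space_1 ennreal_mult)
    also have "\<dots> = ennreal (node_amp v) * (\<integral>\<^sup>+\<xi>. ennreal (mfro (S \<xi>)) \<partial>PiM ?J ?\<mu>)"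
      by (rule nn_integral_cmult[OF measurable_compose[OF mat_meas_mfro[OF Sm] measurable_ennreal]]) simp
    also have "(\<lambda>\<xi>. mfro (S \<xi>)) = (\<lambda>\<xi>. frob_norm n ?D (T - approx \<xi> vs))"
      unfolding S_def using frob_norm_matricize[of ?D ?I n] node_sub[OF v(1)] by simp
    also have "ennreal (node_amp v) * (\<integral>\<^sup>+\<xi>. ennreal (frob_norm n ?D (T - approx \<xi> vs)) \<partial>PiM ?J ?\<mu>) \<le> ennreal (node_amp v) * ennreal (err_rec node_amp node_err vs)"
      by (intro mult_left_mono Cons.IH vs) simp
    finally show ?thesis .
  qed
  have "(\<integral>\<^sup>+\<xi>. ennreal (frob_norm n ?D (T - approx \<xi> (v # vs))) \<partial>PiM (coords (v # vs)) ?\<mu>) \<le> (\<integral>\<^sup>+\<xi>. ?f1 \<xi> + ?f2 \<xi> \<partial>PiM ?K ?\<mu>)"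
    unfolding K
  proof (rule nn_integral_mono)
    fix \<xi>
    show "ennreal (frob_norm n ?D (T - approx \<xi> (v # vs))) \<le> ?f1 \<xi> + ?f2 \<xi>"
      using approx_Cons_error[OF v(1), of \<xi> vs] unfolding P_def S_def
      by (simp only: ennreal_plus[symmetric] mfro_nonneg ennreal_leI)
  qed
  also have "\<dots> = (\<integral>\<^sup>+\<xi>. ?f1 \<xi> \<partial>PiM ?K ?\<mu>) + (\<integral>\<^sup>+\<xi>. ?f2 \<xi> \<partial>PiM ?K ?\<mu>)"
    by (rule nn_integral_add[OF m1 m2])
  also have "\<dots> \<le> ennreal (node_err v) + ennreal (node_amp v) * ennreal (err_rec node_amp node_err vs)"
    by (intro add_mono i1 i2)
  also have "\<dots> = ennreal (err_rec node_amp node_err (v # vs))"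
  proof -
    have e: "0 \<le> err_rec node_amp node_err vs" by (rule err_rec_nonneg) (use vs node_amp0 node_err0 in auto)
    show ?thesis using e node_amp0[OF v(1)] node_err0[OF v(1)]
      by (simp only: err_rec.simps ennreal_mult[symmetric] ennreal_plus[symmetric] mult_nonneg_nonneg)
  qed
  finally show ?case .
qed

end

section \<open>From the model space to the given sketches\<close>

lemma std_gaussian_mat_law:
  assumes "prob_space M" "std_gaussian_mat M m n G" "0 < m" "0 < n"
  shows "distr M (mat_space m n) (\<lambda>\<omega>. mat_entries m n (G \<omega>)) = gauss ({0..<m} \<times> {0..<n})"
    "(\<lambda>\<omega>. mat_entries m n (G \<omega>)) \<in> measurable M (mat_space m n)"
proof -
  interpret prob_space M by fact
  let ?I = "{0..<m} \<times> {0..<n}"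
  have ind: "indep_vars (\<lambda>_. borel) (\<lambda>ij \<omega>. G \<omega> $$ ij) ?I"
    and dis: "\<And>i j. i < m \<Longrightarrow> j < n \<Longrightarrow> distributed M lborel (\<lambda>\<omega>. G \<omega> $$ (i, j)) std_normal_density"
    using assms(2) unfolding std_gaussian_mat_def by auto
  have rv: "(\<lambda>\<omega>. G \<omega> $$ ij) \<in> borel_measurable M" if "ij \<in> ?I" for ij
    using ind that unfolding indep_vars_def by blast
  have law: "distr M borel (\<lambda>\<omega>. G \<omega> $$ ij) = std_gauss" if ij: "ij \<in> ?I" for ij
  proof -
    obtain i j where ij': "ij = (i, j)" "i < m" "j < n" using ij by auto
    have "distr M borel (\<lambda>\<omega>. G \<omega> $$ ij) = distr M lborel (\<lambda>\<omega>. G \<omega> $$ (i, j))"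
      unfolding ij' by (rule distr_cong) auto
    also have "\<dots> = std_gauss"
      unfolding std_gauss_def by (rule distributed_distr_eq_density[OF dis[OF ij'(2,3)]])
    finally show ?thesis .
  qed
  \<comment> \<open>Positive sizes keep the index set nonempty, which the characterization of
    independence by the product law requires.\<close>
  have ne: "?I \<noteq> {}" using assms(3,4) by auto
  have "distr M (PiM ?I (\<lambda>_. borel)) (\<lambda>\<omega>. \<lambda>ij\<in>?I. G \<omega> $$ ij) = PiM ?I (\<lambda>ij. distr M borel (\<lambda>\<omega>. G \<omega> $$ ij))"
    using indep_vars_iff_distr_eq_PiM'[OF ne, where M' = "\<lambda>_. borel" and X = "\<lambda>ij \<omega>. G \<omega> $$ ij"] rv ind by blast
  also have "\<dots> = PiM ?I (\<lambda>_. std_gauss)" by (rule PiM_cong) (auto simp: law)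
  finally show "distr M (mat_space m n) (\<lambda>\<omega>. mat_entries m n (G \<omega>)) = gauss ?I"
    unfolding mat_space_def mat_entries_def gauss_def .
  show "(\<lambda>\<omega>. mat_entries m n (G \<omega>)) \<in> measurable M (mat_space m n)"
    unfolding mat_space_def mat_entries_def by (rule measurable_restrict) (rule rv)
qed

lemma entry_mat_mat_entries: "A \<in> carrier_mat m n \<Longrightarrow> entry_mat m n (mat_entries m n A) = A"
  by (intro eq_matI) (auto simp: entry_mat_def mat_entries_def)

lemma frob_norm_cong:
  "(\<And>i. i \<in> multi_indices n D \<Longrightarrow> S i = S' i) \<Longrightarrow> frob_norm n D (T - S) = frob_norm n D (T - S')"
  unfolding frob_norm_def by (simp cong: sum.cong)

text \<open>Independence makes the joint law of all entries the product measure of the model, so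
  expectations over the given sketches become integrals there. \<open>\<Phi>\<close> collects the
  entries, from which the matrices are recovered.\<close>

lemma (in ttnn_setting) sketch_law:
  assumes M: "prob_space M" and n: "\<forall>\<mu>\<in>{1..d}. 0 < n \<mu>" and r: "\<forall>(l, k)\<in>nonroot_nodes \<I>. 0 < r l k"
    and g: "gaussian_sketches M n d \<I> r p X Y" and ne: "nonroot_nodes \<I> \<noteq> {}"
  obtains \<Phi> where "distr M (PiM (nonroot_nodes \<I> <+> nonroot_nodes \<I>) coord_law) \<Phi> =
      PiM (nonroot_nodes \<I> <+> nonroot_nodes \<I>) coord_law"
    "\<Phi> \<in> measurable M (PiM (nonroot_nodes \<I> <+> nonroot_nodes \<I>) coord_law)"
    "\<And>\<omega> l k. \<omega> \<in> space M \<Longrightarrow> (l, k) \<in> nonroot_nodes \<I> \<Longrightarrow>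
       col_sketch (\<Phi> \<omega>) (l, k) = X l k \<omega> \<and> row_sketch (\<Phi> \<omega>) (l, k) = Y l k \<omega>"
proof -
  interpret prob_space M by fact
  let ?N = "nonroot_nodes \<I>"
  let ?K = "?N <+> ?N"
  let ?rows = "\<lambda>l k. dim_prod n (node_set \<I> l k)" and ?cols = "\<lambda>l k. dim_prod n ({1..d} - node_set \<I> l k)"
  define M' where "M' = case_sum (\<lambda>(l, k). mat_space (?cols l k) (r l k)) (\<lambda>(l, k). mat_space (?rows l k) (r l k + p l k))"
  define E where "E = case_sum (\<lambda>(l, k) \<omega>. mat_entries (?cols l k) (r l k) (X l k \<omega>))
      (\<lambda>(l, k) \<omega>. mat_entries (?rows l k) (r l k + p l k) (Y l k \<omega>))"
  have gX: "std_gaussian_mat M (?cols l k) (r l k) (X l k)"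
    and gY: "std_gaussian_mat M (?rows l k) (r l k + p l k) (Y l k)" if "(l, k) \<in> ?N" for l k
    using g that unfolding gaussian_sketches_def Let_def by auto
  have ind: "indep_vars M' E ?K"
    using g unfolding gaussian_sketches_def Let_def M'_def E_def by blast
  have pos: "0 < ?cols l k" "0 < ?rows l k" "0 < r l k" "0 < r l k + p l k" if "(l, k) \<in> ?N" for l k
    using n r that node_sub[OF that] unfolding dim_prod_def by (auto intro!: prod_pos)
  have law: "distr M (M' c) (E c) = coord_law c \<and> E c \<in> measurable M (M' c)" if c: "c \<in> ?K" for c
  proof (cases c)
    case (Inl v)
    then obtain l k where lk: "c = Inl (l, k)" "(l, k) \<in> ?N" using c by (cases v) auto
    show ?thesis
      using std_gaussian_mat_law[OF M gX[OF lk(2)] pos(1,3)[OF lk(2)]]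
      unfolding lk M'_def E_def coord_law_def node_cols_def node_r_def by simp
  next
    case (Inr v)
    then obtain l k where lk: "c = Inr (l, k)" "(l, k) \<in> ?N" using c by (cases v) auto
    show ?thesis
      using std_gaussian_mat_law[OF M gY[OF lk(2)] pos(2,4)[OF lk(2)]]
      unfolding lk M'_def E_def coord_law_def node_rows_def node_r_def node_p_def by simp
  qed
  define \<Phi> where "\<Phi> = (\<lambda>\<omega>. \<lambda>c\<in>?K. E c \<omega>)"
  \<comment> \<open>The entry spaces and the Gaussian measures have the same measurable sets; this
    is read off from the equality of laws.\<close>
  have sets: "sets (PiM ?K M') = sets (PiM ?K coord_law)"
  proof (rule sets_PiM_cong[OF refl])
    fix c assume "c \<in> ?K"
    from law[OF this] show "sets (M' c) = sets (coord_law c)" by (metis sets_distr)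
  qed
  have "distr M (PiM ?K M') \<Phi> = PiM ?K (\<lambda>c. distr M (M' c) (E c))"
    unfolding \<Phi>_def using indep_vars_iff_distr_eq_PiM'[where I = ?K and M' = M' and X = E] ne law ind by auto
  also have "\<dots> = PiM ?K coord_law" by (rule PiM_cong) (use law in auto)
  finally have 1: "distr M (PiM ?K coord_law) \<Phi> = PiM ?K coord_law"
    using distr_cong[OF refl sets[symmetric], of M \<Phi> \<Phi>] by simp
  have "\<Phi> \<in> measurable M (PiM ?K M')"
    unfolding \<Phi>_def by (rule measurable_restrict) (use law in blast)
  hence 2: "\<Phi> \<in> measurable M (PiM ?K coord_law)" using measurable_cong_sets[OF refl sets] by blast
  have 3: "col_sketch (\<Phi> \<omega>) (l, k) = X l k \<omega> \<and> row_sketch (\<Phi> \<omega>) (l, k) = Y l k \<omega>"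
    if "\<omega> \<in> space M" "(l, k) \<in> ?N" for \<omega> l k
  proof -
    have "X l k \<omega> \<in> carrier_mat (?cols l k) (r l k)" "Y l k \<omega> \<in> carrier_mat (?rows l k) (r l k + p l k)"
      using gX[OF that(2)] gY[OF that(2)] that(1) unfolding std_gaussian_mat_def by auto
    moreover have "Inl (l, k) \<in> ?K" "Inr (l, k) \<in> ?K" using that(2) by auto
    ultimately show ?thesis
      unfolding col_sketch_def row_sketch_def \<Phi>_def E_def node_cols_def node_rows_def node_r_def node_p_def by (simp add: entry_mat_mat_entries)
  qed
  show ?thesis by (rule that[OF 1 2 3])
qed

theorem theorem6p6:
  fixes M :: "'w measure"
    and d :: nat and n :: "nat \<Rightarrow> nat"
    and T :: tensor
    and \<I> :: index_tree
    and r p r' :: "nat \<Rightarrow> nat \<Rightarrow> nat"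
    and X Y :: "nat \<Rightarrow> nat \<Rightarrow> 'w \<Rightarrow> real mat"
  assumes "prob_space M"
    and "\<forall>\<mu>\<in>{1..d}. 0 < n \<mu>"
    and "is_index_tree d \<I>"
    and "\<forall>(l, k)\<in>nonroot_nodes \<I>. 0 < r l k"
    and "\<forall>(l, k)\<in>nonroot_nodes \<I>. 1 < p l k"
    and "gaussian_sketches M n d \<I> r p X Y"
    and "\<forall>(l, k)\<in>nonroot_nodes \<I>. 0 < r' l k \<and> real (r' l k) < real (r l k) - 1"
  shows "let err = (\<lambda>\<omega>. frob_norm n {1..d}
                    (T - ttnn n d \<I> T (\<lambda>l k. X l k \<omega>) (\<lambda>l k. Y l k \<omega>)));
             bound = (\<Sum>l = 1..depth \<I>. \<Sum>k = 1..width \<I> l.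
                    node_factor \<I> r p r' l k *
                    sv_tail (matricize n {1..d} (node_set \<I> l k) T) (r' l k))
         in integrable M err \<and> prob_space.expectation M err \<le> bound \<and>
            (\<forall>S. best_ttn_approx n d \<I> r' T S \<longrightarrow>
               bound \<le> (\<Sum>l = 1..depth \<I>. \<Sum>k = 1..width \<I> l. node_factor \<I> r p r' l k)
                        * frob_norm n {1..d} (T - S))"
proof -
  interpret prob_space M by fact
  interpret ttnn_setting n d \<I> T r p r'
    by unfold_locales (use assms(3,5,7) in fastforce)+
  let ?D = "{1..d}" and ?N = "nonroot_nodes \<I>"
  define err where "err \<omega> = frob_norm n ?D (T - ttnn n d \<I> T (\<lambda>l k. X l k \<omega>) (\<lambda>l k. Y l k \<omega>))" for \<omega>
  define bound where "bound = (\<Sum>l = 1..depth \<I>. \<Sum>k = 1..width \<I> l.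
     node_factor \<I> r p r' l k * sv_tail (matricize n ?D (node_set \<I> l k) T) (r' l k))"
  define vs where "vs = nodes_desc \<I> (depth \<I>)"
  have vs: "set vs = ?N" "distinct vs"
    unfolding vs_def set_nodes_desc nonroot_nodes_def by (auto simp: distinct_nodes_desc)
  have sum_nodes: "(\<Sum>l = 1..depth \<I>. \<Sum>k = 1..width \<I> l. f l k) = (\<Sum>(l, k)\<in>?N. f l k)" for f :: "nat \<Rightarrow> nat \<Rightarrow> real"
    unfolding nonroot_nodes_def by (rule sum.Sigma) auto
  have nf0: "0 \<le> node_factor \<I> r p r' l k" if lk: "(l, k) \<in> ?N" for l k
  proof -
    have "0 \<le> c_const (r t s) (p t s)" if "(t, s) \<in> ?N" for t s
      using p_gt[OF that] unfolding c_const_def by auto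
    moreover have "0 \<le> c'_const (r l k) (p l k) (r' l k)"
      using p_gt[OF lk] r'_le[OF lk] unfolding c'_const_def by (auto intro!: mult_nonneg_nonneg)
    ultimately show ?thesis unfolding node_factor_def by (intro mult_nonneg_nonneg prod_nonneg) auto
  qed
  have bound_eq: "err_rec node_amp node_err vs = bound"
  proof -
    have "err_rec node_amp node_err vs = (\<Sum>v\<in>?N. (\<Prod>u\<in>{u \<in> ?N. node_less v u}. node_amp u) * node_err v)"
      using err_rec_eq_sum[of vs node_amp node_err] sorted_nodes_desc unfolding vs(1) unfolding vs_def by blast
    also have "\<dots> = (\<Sum>(l, k)\<in>?N. node_factor \<I> r p r' l k * sv_tail (matricize n ?D (node_set \<I> l k) T) (r' l k))"
    proof (intro sum.cong refl)
      fix v assume "v \<in> ?N"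
      obtain l k where v: "v = (l, k)" by (cases v)
      have "{u \<in> ?N. node_less v u} = {(t, s). (t, s) \<in> ?N \<and> (l < t \<or> l = t \<and> k < s)}"
        unfolding v node_less_def by auto
      thus "(\<Prod>u\<in>{u \<in> ?N. node_less v u}. node_amp u) * node_err v =
         (case v of (l, k) \<Rightarrow> node_factor \<I> r p r' l k * sv_tail (matricize n ?D (node_set \<I> l k) T) (r' l k))"
        unfolding v node_factor_def node_amp_def node_err_def node_r_def node_p_def node_mat_def by (simp add: split_def)
    qed
    finally show ?thesis unfolding bound_def sum_nodes .
  qed
  have sv0: "0 \<le> sv_tail A q" for A q unfolding sv_tail_def by (intro real_sqrt_ge_zero sum_nonneg) auto
  have bound0: "0 \<le> bound"
    unfolding bound_def sum_nodes by (intro sum_nonneg) (auto intro!: mult_nonneg_nonneg nf0 sv0)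
  have XY: "X l k \<omega> \<in> carrier_mat (dim_prod n (?D - node_set \<I> l k)) (r l k)"
    "Y l k \<omega> \<in> carrier_mat (dim_prod n (node_set \<I> l k)) (r l k + p l k)"
    if "(l, k) \<in> ?N" "\<omega> \<in> space M" for l k \<omega>
    using assms(6) that unfolding gaussian_sketches_def Let_def std_gaussian_mat_def by fast+
  have err_eq: "err \<omega> = frob_norm n ?D (T - foldr (node_apply n d \<I> T (\<lambda>l k. X l k \<omega>) (\<lambda>l k. Y l k \<omega>)) vs T)"
    if \<omega>: "\<omega> \<in> space M" for \<omega>
    unfolding err_def ttnn_def vs_def
    by (intro frob_norm_cong ttnn_level_eq_foldr[OF tree XY(1)[OF _ \<omega>] XY(2)[OF _ \<omega>]]) auto
  have main: "integrable M err \<and> expectation err \<le> bound"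
  \<comment> \<open>Without non-root nodes the approximant is T itself and the error vanishes; the
    transport to the model needs a nonempty family.\<close>
  proof (cases "?N = {}")
    case True
    hence "err \<omega> = 0" if "\<omega> \<in> space M" for \<omega>
      using err_eq[OF that] vs by (simp add: frob_norm_def)
    hence "integrable M err" "expectation err = 0"
      by (auto cong: Bochner_Integration.integrable_cong Bochner_Integration.integral_cong)
    thus ?thesis using bound0 by simp
  next
    case False
    let ?L = "PiM (?N <+> ?N) coord_law"
    obtain \<Phi> where \<Phi>: "distr M ?L \<Phi> = ?L" "\<Phi> \<in> measurable M ?L"
      and col_sketch: "\<And>\<omega> l k. \<omega> \<in> space M \<Longrightarrow> (l, k) \<in> ?N \<Longrightarrow> col_sketch (\<Phi> \<omega>) (l, k) = X l k \<omega> \<and> row_sketch (\<Phi> \<omega>) (l, k) = Y l k \<omega>"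
      using sketch_law[OF assms(1,2,4,6) False] by metis
    define f where "f \<xi> = frob_norm n ?D (T - approx \<xi> vs)" for \<xi>
    have fm: "f \<in> borel_measurable ?L"
    proof -
      have "(\<lambda>\<xi>. approx \<xi> vs i) \<in> borel_measurable ?L" if "i \<in> multi_indices n ?D" for i
        by (rule approx_meas[OF _ _ _ that]) (use vs in auto)
      hence "(\<lambda>\<xi>. sqrt (\<Sum>i\<in>multi_indices n ?D. ((T - approx \<xi> vs) i)\<^sup>2)) \<in> borel_measurable ?L"
        by (intro measurable_compose[OF _ borel_measurable_sqrt] borel_measurable_sum borel_measurable_power) simp
      thus ?thesis unfolding f_def frob_norm_def .
    qed
    have ef: "err \<omega> = f (\<Phi> \<omega>)" if \<omega>: "\<omega> \<in> space M" for \<omega>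
    proof -
      have "node_apply n d \<I> T (\<lambda>l k. X l k \<omega>) (\<lambda>l k. Y l k \<omega>) v = node_step (\<Phi> \<omega>) v" if "v \<in> ?N" for v
        using col_sketch[OF \<omega>, of "fst v" "snd v"] that unfolding node_apply_def node_step_def node_mat_def by simp
      hence "foldr (node_apply n d \<I> T (\<lambda>l k. X l k \<omega>) (\<lambda>l k. Y l k \<omega>)) vs T = approx (\<Phi> \<omega>) vs"
        unfolding approx_def by (intro foldr_cong refl) (use vs in auto)
      thus ?thesis using err_eq[OF \<omega>] unfolding f_def by simp
    qed
    have em: "err \<in> borel_measurable M"
      using measurable_compose[OF \<Phi>(2) fm] measurable_cong[of M err "\<lambda>\<omega>. f (\<Phi> \<omega>)"] ef by blast
    have e0: "0 \<le> err \<omega>" for \<omega> unfolding err_def frob_norm_def by (intro real_sqrt_ge_zero sum_nonneg) auto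
    have "(\<integral>\<^sup>+\<omega>. ennreal (err \<omega>) \<partial>M) = (\<integral>\<^sup>+\<omega>. ennreal (f (\<Phi> \<omega>)) \<partial>M)"
      by (intro nn_integral_cong) (simp add: ef)
    also have "\<dots> = (\<integral>\<^sup>+\<xi>. ennreal (f \<xi>) \<partial>distr M ?L \<Phi>)"
      using \<Phi>(2) fm by (subst nn_integral_distr) auto
    also have "\<dots> \<le> ennreal (err_rec node_amp node_err vs)"
      using nn_integral_approx_error[OF vs(2)] vs(1) unfolding \<Phi>(1) f_def coords_def by simp
    finally have le: "(\<integral>\<^sup>+\<omega>. ennreal (err \<omega>) \<partial>M) \<le> ennreal bound" unfolding bound_eq .
    \<comment> \<open>The finite nonnegative integral yields integrability, so that the expectation
      is meaningful.\<close>
    have int: "integrable M err"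
      by (rule integrableI_nonneg[OF em]) (use e0 le in \<open>auto simp: top_unique less_top[symmetric]\<close>)
    moreover have "expectation err \<le> bound"
      using le nn_integral_eq_integral[OF int] e0 bound0 by simp
    ultimately show ?thesis ..
  qed
  have "bound \<le> (\<Sum>l = 1..depth \<I>. \<Sum>k = 1..width \<I> l. node_factor \<I> r p r' l k) * frob_norm n ?D (T - S)"
    if S: "best_ttn_approx n d \<I> r' T S" for S
  proof -
    have "has_ttn_rank n d \<I> r' S" using S unfolding best_ttn_approx_def by blast
    hence "sv_tail (matricize n ?D (node_set \<I> l k) T) (r' l k) \<le> frob_norm n ?D (T - S)" if "(l, k) \<in> ?N" for l k
      by (rule sv_tail_le_ttn_error[OF tree _ that])
    thus ?thesis unfolding bound_def sum_nodes sum_distrib_right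
      by (intro sum_mono) (auto intro!: mult_left_mono nf0)
  qed
  thus ?thesis using main unfolding Let_def bound_def err_def[abs_def] by blast
qed

end
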